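(* Let $n\ge 2$ be an integer and $\epsilon>0$ a fixed constant. The output of the algorithm "Sampler for Pólya trees" described in the context, run with parameter $n$, is uniformly distributed among all Pólya trees with $n$ vertices.
   Context: Basics. A Pólya tree is a rooted unordered unlabelled tree, i.e. a rooted tree considered up to isomorphism; $|T|$ is its number of vertices. A forest is a finite multiset of Pólya trees (possibly empty, $\emptyset$); $|f|$ is the total number of vertices of a forest $f$. Let $a_k$ be the number of Pólya trees with $k$ vertices, $A(z)=\sum_{k\ge1}a_kz^k$, and let $\rho\approx0.338321$ be the radius of convergence of $A$; it is known that $A(\rho)=1$. Set $\Phi(z)=\exp\big(\sum_{i\ge2}A(z^i)/i\big)$, which has radius of convergence $\sqrt\rho$; $A(z)=z\exp(A(z))\Phi(z)$. $\mathbb N=\{1,2,\dots\}$, $\mathbb N_0=\{0,1,2,\dots\}$. Elementary samplers (every call uses fresh independent randomness). $\mathrm{Poisson}(x)$ samples a Poisson variable with mean $x>0$; $\mathrm{Poisson}_{\ge1}(x)$ samples a Poisson variable with mean $x$ conditioned to be positive; for $0<s<\sqrt\rho$, $\mathrm{MAXINDEX}(s)$ samples $K\in\mathbb N_0$ with $\mathbb P(K\le k)=\Phi(s)^{-1}\exp\big(\sum_{i=2}^kA(s^i)/i\big)$ for all $k\in\mathbb N_0$ (empty sum $=0$). Boltzmann samplers. $\Gamma A(t)$, $0<t\le\rho$: start with a root vertex $v$; draw $X_t$ from $\mathrm{Poisson}(A(t))$; draw $T_1,\dots,T_{X_t}$ by independent recursive calls of $\Gamma A(t)$; draw $F$ by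 $\Gamma B(t)$; join $v$ by an edge to the root of each $T_i$ and of each tree in $F$; return the resulting tree rooted at $v$. $\Gamma B(s)$, $0<s<\sqrt\rho$: start with an empty forest $F$; draw $I$ by $\mathrm{MAXINDEX}(s)$; for $2\le i\le I-1$ draw $M_i$ by $\mathrm{Poisson}(A(s^i)/i)$; if $I\ge2$ draw $M_I$ by $\mathrm{Poisson}_{\ge1}(A(s^I)/I)$; for each $2\le i\le I$ and $1\le j\le M_i$ draw $T_{i,j}$ by $\Gamma A(s^i)$ and add $i$ identical copies of $T_{i,j}$ to $F$; return $F$. Parameters. Put $N=n-1$, $\lambda=\min\big(\epsilon/\sqrt N,\tfrac14\log(1/\rho)\big)$. For $\sigma\in\{+,-\}$ put $C_\sigma=\exp(e^{\sigma\lambda}-1)\,\Phi(\rho e^{\sigma\lambda})/\Phi(\rho)-\rho$, and $B_N=(C_++C_-)/2$. For $1\le k\le N$ let $c_k=\lfloor N/k\rfloor$, $r_k=N-kc_k$, $D_N(k)=\cosh(\lambda c_k)^{-(k-r_k)}\cosh(\lambda(c_k+1))^{-r_k}$. For $0\le m\le N$ let $s(k,m)=B_N^k\rho^m\frac{(k+m-1)!}{k!\,m!}D_N(k)$ and $\widehat M_N=\max_{1\le k\le N,\,0\le m\le N}s(k,m)$. Sampler Q. (1) Choose $\sigma_0\in\{+,-\}$ with $\mathbb P(\sigma_0=\pm)=C_\pm/(C_++C_-)$. (2) Independently sample $X$ from $\mathrm{Poisson}(e^{\sigma_0\lambda})$ and $F$ from $\Gamma B(\rho e^{\sigma_0\lambda})$;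 put $Y=|F|$. (3) If $(X,Y)=(0,0)$, resample $(X,Y,F)$ with the same $\sigma_0$ until $(X,Y)\ne(0,0)$. (4) Return $(X,Y,F)$. Bridge sampler. Repeat the following attempt until it is accepted. (1) Sample independent triples $(X_i,Y_i,F_i)$, $i=1,2,\dots$, by Sampler Q until $S_j=\sum_{i=1}^j(X_i+Y_i)$ satisfies $S_j\ge N$. (2) If $S_j>N$, reject and restart. If $S_j=N$, put $K=j$ and $M=1+\sum_{i=1}^K(X_i-1)$; if $M<0$, reject and restart. (3) Perform a Bernoulli test with success probability $R=\widehat M_N^{-1}B_N^K\rho^M\frac{(K+M-1)!}{K!\,M!}\prod_{i=1}^K\cosh(\lambda(X_i+Y_i))^{-1}$ (one has $R\in[0,1]$); if it fails, reject and restart. (4) Let $L=K+M$; choose a uniformly random $K$-element subset of $\{1,\dots,L\}$, insert $(X_1,Y_1,F_1),\dots,(X_K,Y_K,F_K)$ in these positions preserving order, and fill the other positions with $(0,0,\emptyset)$, giving a list $(\xi_1,\zeta_1,\tau_1),\dots,(\xi_L,\zeta_L,\tau_L)$. (5) Return this list. Sampler for Pólya trees. (1) Sample $(\xi_i,\zeta_i,\tau_i)_{1\le i\le L}$ by the Bridge sampler. (2) Let $H_j=\sum_{i=1}^j(\xi_i-1)$, $1\le j\le L$, and let $s\ge1$ be the first index at which $H_j$ is minimal; cyclically rotate the list of triples so that its first-coordinate sequence is $(\xi_{s+1},\dots,\xi_L,\xi_1,\dots,\xi_s)$. (3) Interpret this sequence as the depth-first-search ordered list of outdegrees of the vertices $v_{s+1},\dots,v_L,v_1,\dots,v_s$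 of a plane tree $\tau$. (4) For each $1\le i\le L$ attach the forest $\tau_i$ to $v_i$ by adding an edge between $v_i$ and the root of each tree in $\tau_i$; forget the plane ordering and the vertex labels. (5) Return the resulting (unordered, unlabelled rooted) tree. *)

theory Defs
  imports "HOL-Probability.Probability"
begin

text \<open>
  Randomised algorithms are subprobability mass functions: monadic composition means fresh
  independent randomness for every call, unbounded recursion and rejection loops are least fixed
  points (\<open>partial_function (spmf)\<close>), and the missing mass is the probability of
  non-termination. Below, monadic bind always means \<^const>\<open>bind_spmf\<close>.
\<close>

no_adhoc_overloading Monad_Syntax.bind \<rightleftharpoons> bind_pmf

section \<open>Polya trees and their generating functions\<close>

text \<open>
  A rooted tree up to isomorphism is determined by the multiset of the isomorphism classes of the
  subtrees hanging off its root; \<open>Join F\<close> joins a new root to the root of each tree in \<open>F\<close>.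
\<close>

datatype ptree = Join "ptree multiset"

type_synonym forest = "ptree multiset"

primrec vertices :: "ptree \<Rightarrow> nat" where
  "vertices (Join F) = 1 + \<Sum>\<^sub># (image_mset vertices F)"

definition forest_size :: "forest \<Rightarrow> nat" where
  "forest_size F = \<Sum>\<^sub># (image_mset vertices F)"

definition polya_trees :: "nat \<Rightarrow> ptree set" where
  "polya_trees n = {T. vertices T = n}"

lemma vertices_pos: "vertices T \<ge> 1"
  by (cases T) simp

lemma size_le_forest_size: "size F \<le> forest_size F"
proof (induction F)
  case (add T F)
  then show ?case using vertices_pos[of T] by (simp add: forest_size_def)
qed (simp add: forest_size_def)

text \<open>Hence the cardinality in \<open>a_coeff\<close> below and the uniform distribution on \<open>polya_trees n\<close> (\<open>n \<ge> 1\<close>)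
  are not degenerate.\<close>

lemma finite_polya_trees: "finite (polya_trees n)"
proof (induction n rule: less_induct)
  case (less n)
  define S where "S = (\<Union>k<n. polya_trees k)"
  have fin: "finite (\<Union>k\<le>n. multisets_of_size S k)"
    unfolding S_def using less by (intro finite_UN_I finite_multisets_of_size) auto
  have "polya_trees n \<subseteq> Join ` (\<Union>k\<le>n. multisets_of_size S k)"
  proof
    fix T assume T: "T \<in> polya_trees n"
    obtain F where F: "T = Join F" by (cases T)
    have n: "n = 1 + forest_size F" using T F by (simp add: polya_trees_def forest_size_def)
    have "U \<in> S" if U: "U \<in># F" for U
    proof -
      obtain G where "F = add_mset U G" using multi_member_split[OF U] by blast
      then have "vertices U < n" using n by (simp add: forest_size_def)
      then show ?thesis by (simp add: S_def polya_trees_def)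
    qed
    then have "F \<in> multisets_of_size S (size F)" by (auto simp: multisets_of_size_def)
    moreover have "size F \<le> n" using n size_le_forest_size[of F] by simp
    ultimately show "T \<in> Join ` (\<Union>k\<le>n. multisets_of_size S k)" using F by blast
  qed
  then show ?case using fin finite_imageI finite_subset by metis
qed

lemma polya_trees_nonempty: "n \<ge> 1 \<Longrightarrow> polya_trees n \<noteq> {}"
proof -
  assume "n \<ge> 1"
  have "vertices (Join (replicate_mset m (Join {#}))) = Suc m" for m
    by (induction m) simp_all
  with \<open>n \<ge> 1\<close> have "Join (replicate_mset (n - 1) (Join {#})) \<in> polya_trees n"
    by (simp add: polya_trees_def del: vertices.simps)
  then show ?thesis by blast
qed

definition a_coeff :: "nat \<Rightarrow> nat" where
  "a_coeff k = card (polya_trees k)"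

definition A_gf :: "real \<Rightarrow> real" where
  "A_gf z = (\<Sum>k. real (a_coeff k) * z ^ k)"

definition \<rho> :: real where
  "\<rho> = real_of_ereal (conv_radius (\<lambda>k. real (a_coeff k)))"

text \<open>The sum over \<open>i \<ge> 2\<close>, shifted by two.\<close>

definition \<Phi> :: "real \<Rightarrow> real" where
  "\<Phi> z = exp (\<Sum>j. A_gf (z ^ (j + 2)) / real (j + 2))"

section \<open>Elementary samplers\<close>

definition poisson_ge1 :: "real \<Rightarrow> nat pmf" where
  "poisson_ge1 x = cond_pmf (poisson_pmf x) {1..}"

definition max_index :: "real \<Rightarrow> nat pmf" where
  "max_index s = (THE p. \<forall>k. measure_pmf.prob p {..k} =
     inverse (\<Phi> s) * exp (\<Sum>i = 2..k. A_gf (s ^ i) / real i))"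

primrec sample_all :: "'a spmf list \<Rightarrow> 'a list spmf" where
  "sample_all [] = return_spmf []"
| "sample_all (p # ps) = do { x \<leftarrow> p; xs \<leftarrow> sample_all ps; return_spmf (x # xs) }"

definition iid :: "nat \<Rightarrow> 'a spmf \<Rightarrow> 'a list spmf" where
  "iid m p = sample_all (replicate m p)"

lemma mono_spmf_sample_all [partial_function_mono]:
  assumes "\<And>i. mono_spmf (\<lambda>f. p i f)"
  shows "mono_spmf (\<lambda>f. sample_all (map (\<lambda>i. p i f) is))"
proof (induction "is")
  case Nil
  show ?case by simp
next
  case (Cons i "is")
  have "mono_spmf (\<lambda>f. do { x \<leftarrow> p i f; xs \<leftarrow> sample_all (map (\<lambda>i. p i f) is); return_spmf (x # xs) })"
    by (intro bind_spmf_mono assms Cons.IH spmf.const_mono)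
  then show ?case by simp
qed

lemma mono_spmf_iid [partial_function_mono]:
  assumes "mono_spmf p"
  shows "mono_spmf (\<lambda>f. iid m (p f))"
  unfolding iid_def
  using mono_spmf_sample_all[of "\<lambda>_. p" "replicate m undefined"] assms by simp

section \<open>Boltzmann samplers\<close>

text \<open>
  \<open>\<Gamma>A\<close> and \<open>\<Gamma>B\<close> are mutually recursive. \<open>\<Gamma>B_via \<gamma>\<close> is \<open>\<Gamma>B\<close> with its calls to \<open>\<Gamma>A\<close> replaced
  by \<open>\<gamma>\<close>, so that the recursion can be stated for \<open>\<Gamma>A\<close> alone.
\<close>

definition \<Gamma>B_via :: "(real \<Rightarrow> ptree spmf) \<Rightarrow> real \<Rightarrow> forest spmf" where
  "\<Gamma>B_via \<gamma> s = do {
     I \<leftarrow> spmf_of_pmf (max_index s);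
     Fs \<leftarrow> sample_all (map (\<lambda>i. do {
             M \<leftarrow> spmf_of_pmf (if i < I then poisson_pmf (A_gf (s ^ i) / real i)
                                else poisson_ge1 (A_gf (s ^ i) / real i));
             Ts \<leftarrow> iid M (\<gamma> (s ^ i));
             return_spmf (repeat_mset i (mset Ts)) }) [2..<Suc I]);
     return_spmf (sum_list Fs)
   }"

lemma mono_spmf_\<Gamma>B_via [partial_function_mono]: "mono_spmf (\<lambda>\<gamma>. \<Gamma>B_via \<gamma> s)"
  unfolding \<Gamma>B_via_def
  by (intro bind_spmf_mono mono_spmf_sample_all mono_spmf_iid spmf.const_mono call_mono)

partial_function (spmf) \<Gamma>A :: "real \<Rightarrow> ptree spmf" where
  "\<Gamma>A t = do {
     X \<leftarrow> spmf_of_pmf (poisson_pmf (A_gf t));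
     Ts \<leftarrow> iid X (\<Gamma>A t);
     F \<leftarrow> \<Gamma>B_via \<Gamma>A t;
     return_spmf (Join (mset Ts + F))
   }"

definition \<Gamma>B :: "real \<Rightarrow> forest spmf" where
  "\<Gamma>B = \<Gamma>B_via \<Gamma>A"

section \<open>Parameters\<close>

text \<open>A sign \<open>\<sigma>\<close> is represented by the real number \<open>1\<close> or \<open>-1\<close>. Apart from \<open>lambda\<close>, the
  parameters are functions of \<open>N\<close> and \<open>lam\<close>.\<close>

definition lambda :: "nat \<Rightarrow> real \<Rightarrow> real" where
  "lambda N \<epsilon> = min (\<epsilon> / sqrt (real N)) (1/4 * ln (1 / \<rho>))"

definition C_par :: "real \<Rightarrow> real \<Rightarrow> real" where
  "C_par lam \<sigma> = exp (exp (\<sigma> * lam) - 1) * \<Phi> (\<rho> * exp (\<sigma> * lam)) / \<Phi> \<rho> - \<rho>"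

definition B_par :: "real \<Rightarrow> real" where
  "B_par lam = (C_par lam 1 + C_par lam (-1)) / 2"

definition D_par :: "nat \<Rightarrow> real \<Rightarrow> nat \<Rightarrow> real" where
  "D_par N lam k = (let c = N div k; r = N - k * c in
     inverse (cosh (lam * real c) ^ (k - r)) * inverse (cosh (lam * real (c + 1)) ^ r))"

definition weight :: "real \<Rightarrow> nat \<Rightarrow> nat \<Rightarrow> real" where
  "weight lam k m = B_par lam ^ k * \<rho> ^ m * (fact (k + m - 1) / (fact k * fact m))"

definition M_hat :: "nat \<Rightarrow> real \<Rightarrow> real" where
  "M_hat N lam = Max {weight lam k m * D_par N lam k | k m. 1 \<le> k \<and> k \<le> N \<and> m \<le> N}"

section \<open>Sampler Q and the bridge sampler\<close>

type_synonym triple = "nat \<times> nat \<times> forest"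

partial_function (spmf) sample_nonzero :: "real \<Rightarrow> real \<Rightarrow> triple spmf" where
  "sample_nonzero lam \<sigma> = do {
     X \<leftarrow> spmf_of_pmf (poisson_pmf (exp (\<sigma> * lam)));
     F \<leftarrow> \<Gamma>B (\<rho> * exp (\<sigma> * lam));
     let Y = forest_size F;
     if (X, Y) = (0, 0) then sample_nonzero lam \<sigma> else return_spmf (X, Y, F)
   }"

definition sampler_Q :: "real \<Rightarrow> triple spmf" where
  "sampler_Q lam = do {
     plus \<leftarrow> spmf_of_pmf (bernoulli_pmf (C_par lam 1 / (C_par lam 1 + C_par lam (-1))));
     sample_nonzero lam (if plus then 1 else -1)
   }"

fun fstc :: "triple \<Rightarrow> nat" where "fstc (x, y, f) = x"
fun increment :: "triple \<Rightarrow> nat" where "increment (x, y, f) = x + y"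
fun forest_of :: "triple \<Rightarrow> forest" where "forest_of (x, y, f) = f"

text \<open>The accumulator \<open>ts\<close> holds the triples sampled so far.\<close>

partial_function (spmf) sample_walk :: "nat \<Rightarrow> real \<Rightarrow> triple list \<Rightarrow> triple list spmf" where
  "sample_walk N lam ts =
     (if sum_list (map increment ts) \<ge> N then return_spmf ts
      else do { t \<leftarrow> sampler_Q lam; sample_walk N lam (ts @ [t]) })"

definition accept_prob :: "nat \<Rightarrow> real \<Rightarrow> nat \<Rightarrow> nat \<Rightarrow> triple list \<Rightarrow> real" where
  "accept_prob N lam K M ts =
     inverse (M_hat N lam) * weight lam K M * (\<Prod>t\<leftarrow>ts. inverse (cosh (lam * real (increment t))))"

definition insert_at :: "nat \<Rightarrow> nat set \<Rightarrow> triple list \<Rightarrow> triple list" where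
  "insert_at L P ts =
     map (\<lambda>j. if j \<in> P then ts ! card {i \<in> P. i < j} else (0, 0, {#})) [1..<Suc L]"

partial_function (spmf) bridge_sampler :: "nat \<Rightarrow> real \<Rightarrow> triple list spmf" where
  "bridge_sampler N lam = do {
     ts \<leftarrow> sample_walk N lam [];
     let K = length ts;
     let M = 1 + (\<Sum>t\<leftarrow>ts. (int (fstc t) - 1));
     if sum_list (map increment ts) > N \<or> M < 0 then bridge_sampler N lam
     else do {
       accepted \<leftarrow> spmf_of_pmf (bernoulli_pmf (accept_prob N lam K (nat M) ts));
       if \<not> accepted then bridge_sampler N lam
       else do {
         let L = K + nat M;
         P \<leftarrow> spmf_of_set {P. P \<subseteq> {1..L} \<and> card P = K};
         return_spmf (insert_at L P ts)
       }
     }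
   }"

section \<open>The sampler for Polya trees\<close>

datatype 'v plane_tree = Plane 'v "'v plane_tree list"

text \<open>Depth-first-search (preorder) list of the vertices, each with its outdegree.\<close>

primrec dfs_outdegrees :: "'v plane_tree \<Rightarrow> ('v \<times> nat) list" where
  "dfs_outdegrees (Plane v ts) = (v, length ts) # concat (map dfs_outdegrees ts)"

text \<open>Joins every vertex \<open>v\<close> to the roots of the trees in \<open>f v\<close>, then forgets the plane order and
  the labels.\<close>

primrec attach_forests :: "('v \<Rightarrow> forest) \<Rightarrow> 'v plane_tree \<Rightarrow> ptree" where
  "attach_forests f (Plane v ts) = Join (mset (map (attach_forests f) ts) + f v)"

text \<open>Lists are indexed from zero, so the \<open>i\<close>-th entry of the mathematical list is \<open>xs ! (i - 1)\<close>.\<close>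

definition height :: "triple list \<Rightarrow> nat \<Rightarrow> int" where
  "height xs j = (\<Sum>i = 1..j. (int (fstc (xs ! (i - 1))) - 1))"

definition first_min :: "triple list \<Rightarrow> nat" where
  "first_min xs = (LEAST s. s \<in> {1..length xs} \<and> (\<forall>j \<in> {1..length xs}. height xs s \<le> height xs j))"

text \<open>Vertex \<open>v\<^sub>i\<close> is represented by its index \<open>i\<close>.\<close>

definition plane_tree_of :: "triple list \<Rightarrow> nat plane_tree" where
  "plane_tree_of xs = (THE \<tau>. dfs_outdegrees \<tau> =
     map (\<lambda>i. (i, fstc (xs ! (i - 1)))) (rotate (first_min xs) [1..<Suc (length xs)]))"

definition polya_tree_sampler :: "nat \<Rightarrow> real \<Rightarrow> ptree spmf" where
  "polya_tree_sampler n \<epsilon> = do {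
     let N = n - 1;
     xs \<leftarrow> bridge_sampler N (lambda N \<epsilon>);
     return_spmf (attach_forests (\<lambda>i. forest_of (xs ! (i - 1))) (plane_tree_of xs))
   }"

end

theory Submission
  imports Defs "HOL-Combinatorics.Multiset_Permutations"
begin

text \<open>
  All distributions are computed exactly. Let \<open>d(F)\<close> be the total weight of all ways to write the
  forest \<open>F\<close> as a sum over \<open>i \<ge> 2\<close> of \<open>i\<close> copies of the trees of a list of length \<open>m\<^sub>i\<close>, each
  way weighted by the product of \<open>1 / (m\<^sub>i! i ^ m\<^sub>i)\<close>. Then \<open>\<Gamma>B s\<close> returns \<open>F\<close> with probability
  \<open>s ^ |F| d(F) / \<Phi>(s)\<close>. If \<open>i = 1\<close> is allowed as well, the total weight is \<open>1\<close> for every forest: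
  marking a copy of a tree \<open>u\<close> shows that the multiplicity of \<open>u\<close> in \<open>G\<close>, times the weight of \<open>G\<close>, is the sum
  of the weights of \<open>G\<close> with \<open>i\<close> copies of \<open>u\<close> removed, over \<open>i \<ge> 1\<close>. This identity gives the law of \<open>\<Gamma>A t\<close>
  by induction on the size of the tree.

  Since \<open>\<rho> e \<Phi>(\<rho>) = 1\<close>, the two tilts combine so that Sampler Q returns \<open>(x, |f|, f)\<close> with
  probability \<open>\<rho> ^ (1 + |f|) d(f) cosh(\<lambda>(x + |f|)) / (B x!)\<close>. The acceptance test cancels the
  hyperbolic cosines, and an attempt of the bridge sampler returns an admissible list of length \<open>L\<close>
  with probability \<open>const / L\<close> times the product of \<open>d(\<tau>\<^sub>i) / \<xi>\<^sub>i!\<close>. By the cycle lemma the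
  \<open>L\<close> rotations of such a list represent one plane tree decorated by forests, and by the same
  identity the weights of all decorated plane trees representing a given Polya tree sum to \<open>1\<close>.
\<close>

section \<open>Convolution of functions on multisets\<close>

text \<open>\<open>d(F)\<close> is \<open>fixfree_weight F\<close>: the probability that a uniformly
  random permutation of the trees of \<open>F\<close>, moving each tree only to an isomorphic copy,
  fixes none of them. Indeed, among the permutations of the copies of one tree, those with
  \<open>m_i\<close> cycles of length \<open>i\<close> make up the fraction
  \<open>prod 1 / (m_i! i ^ m_i)\<close>.

  A fixed point equation need not determine a distribution. The one for \<open>\<Gamma>A\<close>
  does, because a tree arises only from calls that return smaller trees, so every probability is a
  finite sum over submultisets. Termination is recovered afterwards by adding up these
  probabilities. For a rejection loop it suffices that one round terminates and succeeds with
  positive probability, so the normalising constant of the bridge stays implicit.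

  The equation \<open>\<rho> * exp 1 * \<Phi> \<rho> = 1\<close> has to be extracted from the
  definition of \<open>\<rho>\<close> as a radius of convergence. As the series of \<open>A\<close>
  diverges beyond \<open>\<rho>\<close>, the estimates are made for the finite truncations
  \<open>A_trunc\<close>.\<close>

lemma finite_submultisets: "finite {H. H \<subseteq># G}"
proof -
  have "{H. H \<subseteq># G} \<subseteq> (\<Union>k\<le>size G. multisets_of_size (set_mset G) k)"
    by (auto simp: multisets_of_size_def size_mset_mono dest: mset_subset_eqD)
  then show ?thesis by (rule finite_subset) auto
qed

text \<open>Multisets are read as monomials, with one variable per element: functions on multisets
  are then formal power series, \<open>mset_conv\<close> is their product, \<open>mset_unit\<close>
  is the series 1, and \<open>mset_shift A\<close> multiplies by the monomial
  \<open>A\<close>.\<close>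

definition mset_conv :: "('a multiset \<Rightarrow> real) \<Rightarrow> ('a multiset \<Rightarrow> real) \<Rightarrow> 'a multiset \<Rightarrow> real" where
  "mset_conv f g G = (\<Sum>H | H \<subseteq># G. f H * g (G - H))"

definition mset_unit :: "'a multiset \<Rightarrow> real" where
  "mset_unit G = (if G = {#} then 1 else 0)"

definition mset_shift :: "'a multiset \<Rightarrow> ('a multiset \<Rightarrow> real) \<Rightarrow> 'a multiset \<Rightarrow> real" where
  "mset_shift A f G = (if A \<subseteq># G then f (G - A) else 0)"

definition mset_convs :: "('a multiset \<Rightarrow> real) list \<Rightarrow> 'a multiset \<Rightarrow> real" where
  "mset_convs fs = foldr mset_conv fs mset_unit"

lemma mset_convs_simps [simp]:
  "mset_convs [] = mset_unit"
  "mset_convs (f # fs) = mset_conv f (mset_convs fs)"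
  by (simp_all add: mset_convs_def)

lemma mset_conv_unit_right [simp]: "mset_conv f mset_unit = f"
proof
  fix G
  have "mset_conv f mset_unit G = (\<Sum>H | H \<subseteq># G. if H = G then f H else 0)"
    unfolding mset_conv_def mset_unit_def
    by (intro sum.cong refl) (auto simp: Diff_eq_empty_iff_mset subset_mset.antisym)
  then show "mset_conv f mset_unit G = f G"
    by (simp add: finite_submultisets)
qed

lemma mset_conv_cong:
  assumes "\<And>H. H \<subseteq># G \<Longrightarrow> f H = f' H" "\<And>H. H \<subseteq># G \<Longrightarrow> g H = g' H"
  shows "mset_conv f g G = mset_conv f' g' G"
  unfolding mset_conv_def using assms by (intro sum.cong refl) (auto intro: arg_cong2[of _ _ _ _ "(*)"])

lemma mset_conv_nonneg:
  assumes "\<And>H. f H \<ge> 0" "\<And>H. g H \<ge> 0"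
  shows "mset_conv f g G \<ge> 0"
  unfolding mset_conv_def using assms by (intro sum_nonneg) auto

lemma mset_conv_diff_right:
  "mset_conv f (\<lambda>H. g H - h H) G = mset_conv f g G - mset_conv f h G"
  unfolding mset_conv_def by (simp add: algebra_simps sum_subtractf)

text \<open>Linearity in the last factor. In \<open>\<Gamma>B\<close> that factor belongs to the
  maximal index, whose block is conditioned to be nonempty, so that a unit is subtracted
  there.\<close>

lemma mset_convs_append_diff:
  "mset_convs (fs @ [\<lambda>H. g H - h H]) G = mset_convs (fs @ [g]) G - mset_convs (fs @ [h]) G"
proof (induction fs arbitrary: G)
  case (Cons f fs)
  then have "mset_convs (fs @ [\<lambda>H. g H - h H]) = (\<lambda>G. mset_convs (fs @ [g]) G - mset_convs (fs @ [h]) G)"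
    by blast
  then show ?case by (simp add: mset_conv_diff_right)
qed simp

lemma mset_convs_append_unit: "mset_convs (fs @ [mset_unit]) = mset_convs fs"
  by (induction fs) simp_all

lemma mset_conv_shift_left: "mset_conv (mset_shift A f) g = mset_shift A (mset_conv f g)"
proof
  fix G
  show "mset_conv (mset_shift A f) g G = mset_shift A (mset_conv f g) G"
  proof (cases "A \<subseteq># G")
    case True
    have "mset_conv (mset_shift A f) g G = (\<Sum>H | A \<subseteq># H \<and> H \<subseteq># G. f (H - A) * g (G - H))"
      unfolding mset_conv_def mset_shift_def
      by (intro sum.mono_neutral_cong_right) (auto simp: finite_submultisets)
    also have "\<dots> = (\<Sum>H | H \<subseteq># G - A. f H * g (G - A - H))"
    proof (rule sum.reindex_bij_witness[of _ "\<lambda>H. A + H" "\<lambda>H. H - A"], goal_cases)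
      case (4 H)
      then show ?case using True subset_mset.le_diff_conv2[OF True, of H] by (simp add: add.commute)
    next
      case (5 H)
      then obtain H' where H': "H = A + H'" by (auto simp: subset_mset.le_iff_add)
      then show ?case by simp
    next
      case (2 H)
      then show ?case
        by (metis (no_types, lifting) mem_Collect_eq subset_mset.diff_add subset_mset.le_diff_conv2 True)
    qed auto
    finally show ?thesis using True by (simp add: mset_shift_def mset_conv_def)
  next
    case False
    then show ?thesis
      by (auto simp: mset_conv_def mset_shift_def intro!: sum.neutral dest: subset_mset.order_trans)
  qed
qed

lemma mset_conv_shift_right: "mset_conv f (mset_shift A g) = mset_shift A (mset_conv f g)"
proof
  fix G
  show "mset_conv f (mset_shift A g) G = mset_shift A (mset_conv f g) G"
  proof (cases "A \<subseteq># G")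
    case True
    have "(H \<subseteq># G \<and> A \<subseteq># G - H) = (H \<subseteq># G - A)" for H
      using True by (metis diff_subset_eq_self subset_mset.le_diff_conv2 subset_mset.order_trans add.commute)
    then have "mset_conv f (mset_shift A g) G = (\<Sum>H | H \<subseteq># G - A. f H * g (G - H - A))"
      unfolding mset_conv_def mset_shift_def
      by (intro sum.mono_neutral_cong_right) (auto simp: finite_submultisets)
    then show ?thesis using True by (simp add: mset_shift_def mset_conv_def diff_diff_add_mset add.commute)
  next
    case False
    then have "\<not> A \<subseteq># G - H" for H
      by (meson diff_subset_eq_self subset_mset.order_trans)
    then show ?thesis using False
      by (auto simp: mset_conv_def mset_shift_def)
  qed
qed

text \<open>Multiplying coefficients by \<open>count G u\<close> is the Euler operator of the
  variable \<open>u\<close>; this is its Leibniz rule.\<close>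

lemma count_mset_conv:
  "real (count G u) * mset_conv f g G =
   mset_conv (\<lambda>H. real (count H u) * f H) g G + mset_conv f (\<lambda>H. real (count H u) * g H) G"
proof -
  have "real (count G u) * (f H * g (G - H)) =
     real (count H u) * f H * g (G - H) + f H * (real (count (G - H) u) * g (G - H))"
    if "H \<subseteq># G" for H
    using mset_subset_eq_count[OF that, of u] by (simp add: of_nat_diff algebra_simps)
  then show ?thesis
    unfolding mset_conv_def by (simp add: sum_distrib_left sum.distrib[symmetric])
qed

section \<open>Blocks of equal trees and their weights\<close>

text \<open>The coefficient of \<open>H\<close> in \<open>exp (\<Sum>u. u^i / i)\<close>. The term
  of degree \<open>m\<close> of the exponential series is expanded over lists of length
  \<open>m\<close>, which avoids multinomial coefficients and matches the lists drawn by
  \<open>iid\<close>.\<close>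

definition block_weight :: "nat \<Rightarrow> 'a multiset \<Rightarrow> real" where
  "block_weight i H = (\<Sum>us | repeat_mset i (mset us) = H. 1 / (fact (length us) * real i ^ length us))"

lemma finite_lists_mset: "finite {us. mset us = H}"
  using finite_permutations_of_multiset[of H] by (simp add: permutations_of_multiset_def)

lemma repeat_mset_inject: "i > 0 \<Longrightarrow> repeat_mset i A = repeat_mset i B \<longleftrightarrow> A = B"
  by (metis repeat_mset_cancel1 not_gr_zero)

lemma block_weight_nonneg: "block_weight i H \<ge> 0"
  unfolding block_weight_def by (intro sum_nonneg) auto

text \<open>All orderings of \<open>H\<close> carry the same weight, and their number is a
  multinomial coefficient.\<close>

lemma block_weight_repeat:
  assumes "i > 0"
  shows "block_weight i (repeat_mset i H) = 1 / ((\<Prod>u\<in>set_mset H. fact (count H u)) * real i ^ size H)"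
proof -
  have "permutations_of_multiset H \<noteq> {}" by (simp add: permutations_of_multiset_not_empty)
  then have ne: "real (card (permutations_of_multiset H)) \<noteq> 0" by simp
  have "block_weight i (repeat_mset i H) = (\<Sum>us | mset us = H. 1 / (fact (size H) * real i ^ size H))"
    unfolding block_weight_def using assms
    by (intro sum.cong) (auto simp: repeat_mset_inject)
  also have "\<dots> = real (card (permutations_of_multiset H)) / (fact (size H) * real i ^ size H)"
    by (simp add: permutations_of_multiset_def)
  also have "fact (size H) = real (card (permutations_of_multiset H)) * (\<Prod>u\<in>set_mset H. fact (count H u))"
    using arg_cong[OF card_permutations_of_multiset_aux[of H], of real] by simp
  finally show ?thesis
    using ne assms by simp
qed

lemma block_weight_not_repeat:
  assumes "\<And>H'. H \<noteq> repeat_mset i H'"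
  shows "block_weight i H = 0"
  unfolding block_weight_def using assms by (intro sum.neutral) auto

lemma block_weight_empty [simp]: "i > 0 \<Longrightarrow> block_weight i {#} = 1"
  using block_weight_repeat[of i "{#}"] by simp

text \<open>A nonempty \<open>i\<close>-fold repetition has at least \<open>i\<close> elements.
  Hence only finitely many \<open>i\<close> matter for a given multiset, and the infinite product
  over \<open>i\<close> can be cut off.\<close>

lemma block_weight_small:
  assumes "size H < i"
  shows "block_weight i H = mset_unit H"
proof (cases "H = {#}")
  case True
  then show ?thesis using assms by (simp add: mset_unit_def)
next
  case False
  have "H \<noteq> repeat_mset i H'" for H'
    using False assms by (cases "H' = {#}") (auto simp: nonempty_has_size)
  then show ?thesis using block_weight_not_repeat False by (metis mset_unit_def)
qed

text \<open>The Euler operator of \<open>u\<close> maps \<open>exp (\<Sum>v. v^i / i)\<close> to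
  \<open>u^i\<close> times itself. In coefficients, the count of \<open>u\<close> cancels one factor
  of a factorial.\<close>

lemma count_block_weight:
  assumes "i > 0"
  shows "real (count G u) * block_weight i G = mset_shift (replicate_mset i u) (block_weight i) G"
proof (cases "\<exists>H. G = repeat_mset i H")
  case True
  then obtain H where H: "G = repeat_mset i H" by blast
  show ?thesis
  proof (cases "u \<in># H")
    case True
    then obtain H' where H': "H = add_mset u H'" by (meson multi_member_split)
    have G: "G = replicate_mset i u + repeat_mset i H'"
      by (simp add: H H')
    \<comment> \<open>Removing one \<open>u\<close> may remove it from the support; extending both
      products to the support of \<open>H\<close> avoids a case distinction.\<close>
    have prod_super: "(\<Prod>x\<in>set_mset K. fact (count K x)) = (\<Prod>x\<in>set_mset H. (fact (count K x) :: real))"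
      if "set_mset K \<subseteq> set_mset H" for K
      using that by (intro prod.mono_neutral_left) (auto simp: not_in_iff)
    have 1: "(\<Prod>x\<in>set_mset H. fact (count H x) :: real) =
        real (count H u) * (\<Prod>x\<in>set_mset H. fact (count H' x))"
    proof -
      have "(\<Prod>x\<in>set_mset H. fact (count H x) :: real) = fact (count H u) * (\<Prod>x\<in>set_mset H - {u}. fact (count H x))"
        using True by (intro prod.remove) auto
      also have "fact (count H u) = real (count H u) * fact (count H' u)"
        by (simp add: H')
      also have "(\<Prod>x\<in>set_mset H - {u}. fact (count H x) :: real) = (\<Prod>x\<in>set_mset H - {u}. fact (count H' x))"
        by (intro prod.cong) (auto simp: H')
      finally show ?thesis
        using True by (simp add: prod.remove[of "set_mset H" u])
    qed
    have "real (count G u) * block_weight i G = real i * real (count H u) / ((\<Prod>x\<in>set_mset H. fact (count H x)) * real i ^ size H)"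
      unfolding H by (subst block_weight_repeat[OF assms]) simp
    also have "\<dots> = 1 / ((\<Prod>x\<in>set_mset H'. fact (count H' x)) * real i ^ size H')"
    proof -
      have "(\<Prod>x\<in>set_mset H. fact (count H' x) :: real) > 0" by (intro prod_pos) auto
      moreover have "count H u > 0" using True by simp
      ultimately show ?thesis
        unfolding 1 using assms by (subst prod_super[of H']) (auto simp: H')
    qed
    also have "\<dots> = block_weight i (repeat_mset i H')"
      using block_weight_repeat[OF assms] by metis
    finally show ?thesis
      by (simp add: mset_shift_def G)
  next
    case False
    then have "\<not> replicate_mset i u \<subseteq># G" using assms
      by (auto simp: H subseteq_mset_def not_in_iff intro!: exI[of _ u])
    then show ?thesis using False by (simp add: H mset_shift_def not_in_iff)
  qed
next
  case False
  have "G - replicate_mset i u \<noteq> repeat_mset i H" if "replicate_mset i u \<subseteq># G" for H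
  proof
    assume "G - replicate_mset i u = repeat_mset i H"
    with that have "G = repeat_mset i (add_mset u H)"
      using subset_mset.add_diff_inverse by fastforce
    with False show False by blast
  qed
  then show ?thesis using False
    by (auto simp: mset_shift_def block_weight_not_repeat)
qed

text \<open>By the Leibniz rule each factor \<open>i\<close> of the product contributes
  \<open>u^i\<close> times the whole product.\<close>

lemma count_mset_convs_block_weight:
  fixes G :: "'a multiset"
  assumes "\<And>i. i \<in> set is \<Longrightarrow> i > 0"
  shows "real (count G u) * mset_convs (map block_weight is) G =
     (\<Sum>i\<leftarrow>is. mset_shift (replicate_mset i u) (mset_convs (map block_weight is)) G)"
  using assms
proof (induction "is" arbitrary: G)
  case Nil
  then show ?case by (simp add: mset_unit_def)
next
  case (Cons i "is")
  define C :: "'a multiset \<Rightarrow> real" where "C = mset_convs (map block_weight is)"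
  have C: "real (count H u) * C H = (\<Sum>j\<leftarrow>is. mset_shift (replicate_mset j u) C H)" for H
    unfolding C_def using Cons by simp
  have lin: "mset_conv f (\<lambda>H. \<Sum>j\<leftarrow>is. g j H) G = (\<Sum>j\<leftarrow>is. mset_conv f (g j) G)" for f g
    by (induction "is") (simp_all add: mset_conv_def sum.distrib algebra_simps)
  have "real (count G u) * mset_conv (block_weight i) C G =
     mset_conv (mset_shift (replicate_mset i u) (block_weight i)) C G +
     mset_conv (block_weight i) (\<lambda>H. \<Sum>j\<leftarrow>is. mset_shift (replicate_mset j u) C H) G"
    using Cons.prems by (simp add: count_mset_conv C count_block_weight)
  also have "\<dots> = (\<Sum>j\<leftarrow>i # is. mset_shift (replicate_mset j u) (mset_conv (block_weight i) C) G)"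
    by (simp add: lin mset_conv_shift_left mset_conv_shift_right)
  finally show ?case by (simp add: C_def)
qed

lemma mset_convs_block_weight_empty:
  "(\<And>i. i \<in> set is \<Longrightarrow> i > 0) \<Longrightarrow> mset_convs (map block_weight is) {#} = 1"
  by (induction "is") (simp_all add: mset_conv_def mset_unit_def)

text \<open>As power series, \<open>exp (\<Sum>i. \<Sum>u. u^i / i)\<close> is the product of all
  \<open>1 / (1 - u)\<close>, in which every monomial has coefficient 1. The bound
  \<open>size G \<le> k\<close> ensures that no block length that fits into \<open>G\<close> is
  missing.\<close>

lemma mset_convs_block_weight_eq_1:
  assumes "size G \<le> k"
  shows "mset_convs (map block_weight [1..<Suc k]) G = 1"
  using assms
proof (induction "size G" arbitrary: G rule: less_induct)
  case less
  let ?e = "mset_convs (map block_weight [1..<Suc k])"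
  show ?case
  proof (cases "G = {#}")
    case True
    then show ?thesis using mset_convs_block_weight_empty[of "[1..<Suc k]"] by (simp del: upt_Suc)
  next
    case False
    then obtain u where u: "u \<in># G" by auto
    have cnt: "count G u \<le> k" using less.prems count_le_size[of G u] by linarith
    have sub: "replicate_mset i u \<subseteq># G \<longleftrightarrow> i \<le> count G u" for i
      by (simp add: count_le_replicate_mset_subset_eq)
    have "real (count G u) * ?e G = (\<Sum>i\<leftarrow>[1..<Suc k]. mset_shift (replicate_mset i u) ?e G)"
      by (rule count_mset_convs_block_weight) auto
    also have "\<dots> = (\<Sum>i\<in>{1..<Suc k}. mset_shift (replicate_mset i u) ?e G)"
      by (simp add: sum_list_distinct_conv_sum_set del: upt_Suc)
    also have "\<dots> = (\<Sum>i\<in>{1..count G u}. 1)"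
    proof (rule sum.mono_neutral_cong_right)
      fix i assume i: "i \<in> {1..count G u}"
      then have "?e (G - replicate_mset i u) = 1"
        using less.prems u cnt sub[of i] False
        by (intro less.hyps) (auto simp: size_Diff_submset nonempty_has_size)
      then show "mset_shift (replicate_mset i u) ?e G = 1"
        using i by (simp add: mset_shift_def sub)
    qed (use cnt sub in \<open>auto simp: mset_shift_def\<close>)
    finally have "real (count G u) * ?e G = real (count G u)" by simp
    moreover have "real (count G u) \<noteq> 0" using u by simp
    ultimately show ?thesis by (metis mult_cancel_left2)
  qed
qed

section \<open>Weights without fixed trees\<close>

text \<open>This stands for the product over all \<open>i \<ge> 2\<close>: longer blocks do not fit
  into \<open>F\<close>, and \<open>fixfree_weight_eq\<close> permits any larger cutoff.\<close>

definition fixfree_weight :: "'a multiset \<Rightarrow> real" where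
  "fixfree_weight F = mset_convs (map block_weight [2..<Suc (size F)]) F"

lemma mset_convs_block_weight_stable:
  assumes "size F < m" "m \<le> k"
  shows "mset_convs (map block_weight [2..<k]) F = mset_convs (map block_weight [2..<m]) F"
  using assms(2)
proof (induction k rule: dec_induct)
  case (step k)
  have eq: "mset_convs (fs @ [block_weight k]) F = mset_convs (fs @ [mset_unit]) F" for fs :: "('a multiset \<Rightarrow> real) list"
    using assms(1) step.hyps(1)
  proof (induction fs arbitrary: F)
    case Nil
    then show ?case by (simp add: block_weight_small)
  next
    case (Cons f fs)
    have "size H < m" if "H \<subseteq># F" for H
      using size_mset_mono[OF that] Cons.prems by linarith
    then show ?case using Cons.IH Cons.prems(2)
      by (auto intro!: mset_conv_cong)
  qed
  show ?case
  proof (cases "k \<ge> 2")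
    case True
    then show ?thesis using step.IH by (simp add: eq mset_convs_append_unit)
  next
    case False
    then show ?thesis using step.IH by auto
  qed
qed simp

lemma fixfree_weight_eq:
  assumes "size F < k"
  shows "mset_convs (map block_weight [2..<k]) F = fixfree_weight F"
  unfolding fixfree_weight_def using mset_convs_block_weight_stable[of F "Suc (size F)" k] assms by simp

lemma mset_convs_nonneg: "(\<And>f H. f \<in> set fs \<Longrightarrow> f H \<ge> 0) \<Longrightarrow> mset_convs fs G \<ge> 0"
  by (induction fs arbitrary: G) (auto simp: mset_unit_def intro!: mset_conv_nonneg)

lemma fixfree_weight_nonneg: "fixfree_weight F \<ge> 0"
  unfolding fixfree_weight_def by (rule mset_convs_nonneg) (auto simp: block_weight_nonneg)

lemma fixfree_weight_empty [simp]: "fixfree_weight {#} = 1"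
  by (simp add: fixfree_weight_def mset_unit_def)

text \<open>The factor \<open>i = 1\<close> is split off from the product over all lengths. It
  stands for the Poisson children in \<open>\<Gamma>A\<close>, and again for the children in the
  plane tree in the final count.\<close>

lemma mset_conv_fixfree_weight: "mset_conv (block_weight 1) fixfree_weight G = 1"
proof -
  let ?k = "Suc (Suc (size G))"
  have "[1..<?k] = 1 # [2..<?k]"
    by (simp add: upt_conv_Cons numeral_2_eq_2 del: upt_Suc)
  then have "1 = mset_convs (map block_weight (1 # [2..<?k])) G"
    using mset_convs_block_weight_eq_1[of G "Suc (size G)"] by simp
  also have "\<dots> = mset_conv (block_weight 1) (mset_convs (map block_weight [2..<?k])) G"
    by simp
  also have "\<dots> = mset_conv (block_weight 1) fixfree_weight G"
    by (intro mset_conv_cong fixfree_weight_eq) (auto simp: less_Suc_eq_le intro!: le_SucI size_mset_mono)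
  finally show ?thesis by simp
qed

section \<open>The generating function of Polya trees\<close>

lemma vertices_Join: "vertices (Join F) = Suc (forest_size F)"
  by (simp add: forest_size_def)

lemma polya_trees_0 [simp]: "polya_trees 0 = {}"
proof -
  have "vertices T \<noteq> 0" for T using vertices_pos[of T] by simp
  then show ?thesis by (simp add: polya_trees_def)
qed

lemma a_coeff_0 [simp]: "a_coeff 0 = 0"
  by (simp add: a_coeff_def)

lemma a_coeff_ge_1: "k \<ge> 1 \<Longrightarrow> a_coeff k \<ge> 1"
  using polya_trees_nonempty[of k] finite_polya_trees[of k]
  by (simp add: a_coeff_def Suc_le_eq card_gt_0_iff)

definition A_trunc :: "nat \<Rightarrow> real \<Rightarrow> real" where
  "A_trunc n x = (\<Sum>k\<le>n. real (a_coeff k) * x ^ k)"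

lemma finite_trees_le: "finite {T. vertices T \<le> n}"
proof -
  have "{T. vertices T \<le> n} = (\<Union>k\<le>n. polya_trees k)" by (auto simp: polya_trees_def)
  then show ?thesis using finite_polya_trees by simp
qed

lemma A_trunc_eq: "A_trunc n x = (\<Sum>T | vertices T \<le> n. x ^ vertices T)"
proof -
  have "(\<Sum>T | vertices T \<le> n. x ^ vertices T) = (\<Sum>T\<in>(\<Union>k\<le>n. polya_trees k). x ^ vertices T)"
    by (intro sum.cong) (auto simp: polya_trees_def)
  also have "\<dots> = (\<Sum>k\<le>n. \<Sum>T\<in>polya_trees k. x ^ vertices T)"
    by (intro sum.UNION_disjoint) (auto simp: finite_polya_trees, auto simp: polya_trees_def)
  also have "\<dots> = (\<Sum>k\<le>n. \<Sum>T\<in>polya_trees k. x ^ k)"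
    by (intro sum.cong refl) (auto simp: polya_trees_def)
  finally show ?thesis by (simp add: A_trunc_def a_coeff_def)
qed

lemma A_trunc_nonneg: "x \<ge> 0 \<Longrightarrow> A_trunc n x \<ge> 0"
  by (simp add: A_trunc_def sum_nonneg)

text \<open>There is no constant term, so every power of \<open>c\<close> that occurs contains at
  least one factor \<open>c\<close>.\<close>

lemma A_term_scale:
  assumes "0 \<le> x" "0 \<le> c" "c \<le> (1::real)"
  shows "real (a_coeff k) * (c * x) ^ k \<le> c * (real (a_coeff k) * x ^ k)"
proof (cases k)
  case (Suc j)
  have "c ^ k * x ^ k \<le> c * x ^ k"
    using assms by (intro mult_right_mono) (simp_all add: Suc mult_left_le power_le_one)
  then have "real (a_coeff k) * (c ^ k * x ^ k) \<le> real (a_coeff k) * (c * x ^ k)"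
    by (intro mult_left_mono) auto
  then show ?thesis by (simp add: power_mult_distrib algebra_simps)
qed simp

lemma A_trunc_scale:
  assumes "0 \<le> x" "0 \<le> c" "c \<le> 1"
  shows "A_trunc n (c * x) \<le> c * A_trunc n x"
  unfolding A_trunc_def sum_distrib_left using assms by (intro sum_mono A_term_scale)

lemma prod_mset_multiplicity_superset:
  assumes "finite S" "set_mset F \<subseteq> S"
  shows "(\<Prod>u\<in>#F. f u) = (\<Prod>u\<in>S. f u ^ count F u)"
proof -
  have "(\<Prod>u\<in>#F. f u) = (\<Prod>u\<in>set_mset F. f u ^ count F u)"
    by (rule image_prod_mset_multiplicity)
  also have "\<dots> = (\<Prod>u\<in>S. f u ^ count F u)"
    using assms by (intro prod.mono_neutral_left) (auto simp: not_in_iff)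
  finally show ?thesis .
qed

text \<open>Expanding the product picks a multiplicity for each \<open>u\<close>, that is, a
  multiset.\<close>

lemma prod_sum_multisets:
  fixes f :: "'a \<Rightarrow> real"
  assumes "finite S"
  shows "(\<Prod>u\<in>S. \<Sum>j\<le>m. f u ^ j) =
         (\<Sum>F | set_mset F \<subseteq> S \<and> (\<forall>u. count F u \<le> m). \<Prod>u\<in>#F. f u)"
proof -
  define M where "M g = (\<Sum>u\<in>S. replicate_mset (g u) u)" for g
  have cnt: "count (M g) v = (if v \<in> S then g v else 0)" for g v
  proof -
    have "count (M g) v = (\<Sum>u\<in>S. if u = v then g v else 0)"
      unfolding M_def count_sum by (intro sum.cong) auto
    then show ?thesis using assms by simp
  qed
  have set: "set_mset (M g) \<subseteq> S" for g
    using cnt[of g] by (metis count_eq_zero_iff subsetI)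
  have "(\<Prod>u\<in>S. \<Sum>j\<le>m. f u ^ j) = (\<Sum>g\<in>S \<rightarrow>\<^sub>E {..m}. \<Prod>u\<in>S. f u ^ g u)"
    using assms by (subst prod_sum_PiE) auto
  also have "\<dots> = (\<Sum>F | set_mset F \<subseteq> S \<and> (\<forall>u. count F u \<le> m). \<Prod>u\<in>S. f u ^ count F u)"
  proof (rule sum.reindex_bij_witness[of _ "\<lambda>F. restrict (count F) S" M], goal_cases)
    case (1 g)
    then show ?case by (auto simp: cnt fun_eq_iff PiE_def extensional_def)
  next
    case (2 g)
    then show ?case using set by (auto simp: cnt PiE_def Pi_def)
  next
    case (3 F)
    then show ?case by (intro multiset_eqI) (auto simp: cnt not_in_iff)
  next
    case (4 F)
    then show ?case by auto
  next
    case (5 g)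
    then show ?case by (intro prod.cong) (auto simp: cnt)
  qed
  also have "\<dots> = (\<Sum>F | set_mset F \<subseteq> S \<and> (\<forall>u. count F u \<le> m). \<Prod>u\<in>#F. f u)"
    using assms by (intro sum.cong refl) (auto simp: prod_mset_multiplicity_superset)
  finally show ?thesis .
qed

lemma prod_mset_power_vertices: "(\<Prod>U\<in>#F. x ^ vertices U) = (x :: real) ^ forest_size F"
  by (induction F) (simp_all add: forest_size_def power_add)

text \<open>The generating function, by number of vertices, of the forests all of whose trees have
  at most \<open>n\<close> vertices.\<close>

definition euler_trunc :: "nat \<Rightarrow> real \<Rightarrow> real" where
  "euler_trunc n x = (\<Prod>U | vertices U \<le> n. 1 / (1 - x ^ vertices U))"

lemma power_vertices_less_1: "0 \<le> x \<Longrightarrow> x < 1 \<Longrightarrow> x ^ vertices U < (1::real)"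
  using vertices_pos[of U] by (simp add: power_less_one_iff)

lemma vertices_le_forest_size: "U \<in># F \<Longrightarrow> vertices U \<le> forest_size F"
  by (auto simp: forest_size_def dest!: multi_member_split)

text \<open>Deleting the root leaves a forest of trees with at most \<open>n\<close> vertices. This
  is only an inequality, as the total size of such forests is unbounded.\<close>

lemma A_trunc_le_euler:
  assumes "0 < x" "x < 1"
  shows "A_trunc (Suc n) x \<le> x * euler_trunc n x"
proof -
  let ?S = "{U. vertices U \<le> n}"
  have "A_trunc (Suc n) x = (\<Sum>F | forest_size F \<le> n. x ^ vertices (Join F))"
    unfolding A_trunc_eq
    by (rule sum.reindex_bij_witness[of _ Join "\<lambda>T. case T of Join F \<Rightarrow> F"])
       (auto simp: vertices_Join split: ptree.splits simp del: vertices.simps)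
  also have "\<dots> = x * (\<Sum>F | forest_size F \<le> n. \<Prod>U\<in>#F. x ^ vertices U)"
    by (simp add: vertices_Join prod_mset_power_vertices sum_distrib_left del: vertices.simps)
  also have "(\<Sum>F | forest_size F \<le> n. \<Prod>U\<in>#F. x ^ vertices U) \<le>
      (\<Sum>F | set_mset F \<subseteq> ?S \<and> (\<forall>u. count F u \<le> n). \<Prod>U\<in>#F. x ^ vertices U)"
  proof (rule sum_mono2)
    have "{F. set_mset F \<subseteq> ?S \<and> (\<forall>u. count F u \<le> n)} \<subseteq> {F. F \<subseteq># repeat_mset n (mset_set ?S)}"
      using finite_trees_le by (auto simp: subseteq_mset_def count_mset_set' not_in_iff subset_iff)
    then show "finite {F. set_mset F \<subseteq> ?S \<and> (\<forall>u. count F u \<le> n)}"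
      using finite_submultisets finite_subset by blast
    show "{F. forest_size F \<le> n} \<subseteq> {F. set_mset F \<subseteq> ?S \<and> (\<forall>u. count F u \<le> n)}"
    proof clarsimp
      fix F assume F: "forest_size F \<le> n"
      have "count F u \<le> n" for u
        using F size_le_forest_size[of F] count_le_size[of F u] by linarith
      moreover have "vertices U \<le> n" if "U \<in># F" for U
        using F vertices_le_forest_size[OF that] by linarith
      ultimately show "set_mset F \<subseteq> {U. vertices U \<le> n} \<and> (\<forall>u. count F u \<le> n)" by blast
    qed
  qed (use assms in \<open>simp add: prod_mset_power_vertices\<close>)
  also have "\<dots> = (\<Prod>U\<in>?S. \<Sum>j\<le>n. (x ^ vertices U) ^ j)"
    using prod_sum_multisets[OF finite_trees_le] by metis
  also have "\<dots> \<le> euler_trunc n x"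
    unfolding euler_trunc_def
  proof (intro prod_mono conjI)
    fix U :: ptree
    have *: "norm (x ^ vertices U) < 1" using assms power_vertices_less_1[of x U] by simp
    show "(\<Sum>j\<le>n. (x ^ vertices U) ^ j) \<le> 1 / (1 - x ^ vertices U)"
      unfolding suminf_geometric[OF *, symmetric] lessThan_Suc_atMost[symmetric]
      using * assms by (intro sum_le_suminf summable_geometric) auto
  qed (use assms in \<open>auto intro: sum_nonneg\<close>)
  finally show ?thesis using assms by simp
qed

lemma euler_trunc_pos: "0 < x \<Longrightarrow> x < 1 \<Longrightarrow> euler_trunc n x > 0"
  unfolding euler_trunc_def by (intro prod_pos) (use power_vertices_less_1[of x] in auto)

text \<open>The Polya exponential for finitely many trees: in the series of
  \<open>- ln (1 - y)\<close> for \<open>y = x ^ vertices U\<close>, the terms of order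
  \<open>i\<close> add up over \<open>U\<close> to the truncation at \<open>x ^ i\<close>.\<close>

lemma ln_euler_trunc:
  assumes "0 < x" "x < 1"
  shows "(\<lambda>i. A_trunc n (x ^ Suc i) / real (Suc i)) sums ln (euler_trunc n x)"
proof -
  have log: "(\<lambda>i. y ^ Suc i / real (Suc i)) sums (- ln (1 - y))" if "0 < y" "y < 1" for y :: real
  proof -
    have "(\<lambda>n. - (- ((- (- y)) ^ n) / real n)) sums (- ln (1 + (- y)))"
      using that by (intro sums_minus ln_series') auto
    then have "(\<lambda>n. y ^ n / real n) sums (- ln (1 - y))"
      by simp
    then show ?thesis by (subst sums_Suc_iff) simp
  qed
  have "(\<lambda>i. \<Sum>U | vertices U \<le> n. (x ^ vertices U) ^ Suc i / real (Suc i)) sums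
        (\<Sum>U | vertices U \<le> n. - ln (1 - x ^ vertices U))"
    using assms power_vertices_less_1[of x] by (intro sums_sum log) auto
  moreover have "(\<Sum>U | vertices U \<le> n. (x ^ vertices U) ^ Suc i / real (Suc i)) =
      A_trunc n (x ^ Suc i) / real (Suc i)" for i
    unfolding A_trunc_eq sum_divide_distrib
    by (intro sum.cong refl) (simp add: power_mult[symmetric] mult.commute del: power_Suc)
  moreover have "ln (euler_trunc n x) = (\<Sum>U | vertices U \<le> n. - ln (1 - x ^ vertices U))"
  proof -
    have "ln (euler_trunc n x) = (\<Sum>U | vertices U \<le> n. ln (1 / (1 - x ^ vertices U)))"
      unfolding euler_trunc_def using assms power_vertices_less_1[of x]
      by (intro ln_prod) (simp_all add: finite_trees_le less_imp_neq)
    also have "\<dots> = (\<Sum>U | vertices U \<le> n. - ln (1 - x ^ vertices U))"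
    proof (intro sum.cong refl)
      fix U show "ln (1 / (1 - x ^ vertices U)) = - ln (1 - x ^ vertices U)"
        using assms power_vertices_less_1[of x U] by (subst ln_div) auto
    qed
    finally show ?thesis .
  qed
  ultimately show ?thesis by (simp only: )
qed

section \<open>Radius of convergence, and continuity of \<Phi>\<close>

abbreviation "A_conv_radius \<equiv> conv_radius (\<lambda>k. real (a_coeff k))"

lemma A_conv_radius_geI:
  assumes "0 < x" "\<And>n. A_trunc n x \<le> c"
  shows "A_conv_radius \<ge> ereal x"
proof -
  have "summable (\<lambda>k. real (a_coeff k) * x ^ k)"
  proof (rule summableI_nonneg_bounded)
    fix n
    have "(\<Sum>i<n. real (a_coeff i) * x ^ i) \<le> A_trunc n x"
      unfolding A_trunc_def using assms by (intro sum_mono2) auto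
    then show "(\<Sum>i<n. real (a_coeff i) * x ^ i) \<le> c" using assms(2)[of n] by linarith
  qed (use assms in auto)
  then show ?thesis using conv_radius_geI[of "\<lambda>k. real (a_coeff k)" x] assms by simp
qed

text \<open>The bound \<open>1\<close> on truncations reproduces itself: the logarithm of the Euler
  product is at most \<open>16 / 15\<close>, the geometric series in \<open>1 / 16\<close>, and the
  crude estimates by \<open>2\<close> and \<open>exp 2 \<le> 9\<close> still fit below
  \<open>16\<close>. The point \<open>1 / 16\<close> is chosen for this slack.\<close>

lemma A_conv_radius_ge: "A_conv_radius \<ge> ereal (1 / 16)"
proof (rule A_conv_radius_geI)
  let ?x = "1 / 16 :: real"
  show "A_trunc n ?x \<le> 1" for n
  proof (induction n)
    case (Suc n)
    have geo: "(\<lambda>i. ?x ^ i * A_trunc n ?x) sums (16 / 15 * A_trunc n ?x)"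
      using sums_mult2[OF geometric_sums[of ?x], of "A_trunc n ?x"] by simp
    have "ln (euler_trunc n ?x) \<le> 16 / 15 * A_trunc n ?x"
    proof (rule sums_le[OF _ ln_euler_trunc geo])
      fix i
      have "A_trunc n (?x ^ Suc i) \<le> ?x ^ i * A_trunc n ?x"
        using A_trunc_scale[of ?x "?x ^ i" n] by (simp add: power_le_one mult.commute)
      moreover have "A_trunc n (?x ^ Suc i) \<ge> 0" by (intro A_trunc_nonneg) auto
      then have "A_trunc n (?x ^ Suc i) / real (Suc i) \<le> A_trunc n (?x ^ Suc i) / 1"
        by (intro divide_left_mono) auto
      ultimately show "A_trunc n (?x ^ Suc i) / real (Suc i) \<le> ?x ^ i * A_trunc n ?x" by linarith
    qed auto
    also have "\<dots> \<le> 2" using Suc by simp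
    finally have "exp (ln (euler_trunc n ?x)) \<le> exp 2" by simp
    then have "euler_trunc n ?x \<le> exp 2"
      using euler_trunc_pos[of ?x n] by simp
    also have "exp (2::real) = exp 1 * exp 1" by (simp add: exp_add[symmetric])
    also have "\<dots> \<le> 3 * 3" by (intro mult_mono exp_le) auto
    finally show ?case using A_trunc_le_euler[of ?x n] by simp
  qed (simp add: A_trunc_def)
qed simp

lemma A_conv_radius_le: "A_conv_radius \<le> 1"
proof -
  have "\<not> summable (\<lambda>k. norm (real (a_coeff k) * 1 ^ k))"
  proof
    assume "summable (\<lambda>k. norm (real (a_coeff k) * 1 ^ k))"
    then have "(\<lambda>k. real (a_coeff k)) \<longlonglongrightarrow> 0" using summable_LIMSEQ_zero by fastforce
    then have "eventually (\<lambda>k. real (a_coeff k) < 1) sequentially" by (rule order_tendstoD) simp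
    moreover have "eventually (\<lambda>k. k \<ge> (1::nat)) sequentially" by (rule eventually_ge_at_top)
    ultimately have "eventually (\<lambda>k::nat. False) sequentially"
      by eventually_elim (use a_coeff_ge_1 in fastforce)
    then show False by simp
  qed
  then show ?thesis using conv_radius_leI[of "\<lambda>k. real (a_coeff k)" "1::real"] by (simp add: one_ereal_def)
qed

text \<open>The radius lies between two finite bounds, so \<open>real_of_ereal\<close> in the
  definition loses no information.\<close>

lemma ereal_\<rho>: "ereal \<rho> = A_conv_radius"
  unfolding \<rho>_def using A_conv_radius_ge A_conv_radius_le by (intro ereal_real') auto

lemma \<rho>_ge: "\<rho> \<ge> 1 / 16"
  using A_conv_radius_ge unfolding ereal_\<rho>[symmetric] by simp

lemma \<rho>_pos: "\<rho> > 0"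
  using \<rho>_ge by simp

lemma \<rho>_le_1: "\<rho> \<le> 1"
  using A_conv_radius_le unfolding ereal_\<rho>[symmetric] by simp

lemma A_summable: "0 \<le> x \<Longrightarrow> x < \<rho> \<Longrightarrow> summable (\<lambda>k. real (a_coeff k) * x ^ k)"
  by (intro summable_in_conv_radius) (simp add: ereal_\<rho>[symmetric])

lemma A_trunc_tendsto: "0 \<le> x \<Longrightarrow> x < \<rho> \<Longrightarrow> (\<lambda>n. A_trunc n x) \<longlonglongrightarrow> A_gf x"
  unfolding A_trunc_def A_gf_def by (intro summable_LIMSEQ' A_summable)

lemma A_trunc_le_A: "0 \<le> x \<Longrightarrow> x < \<rho> \<Longrightarrow> A_trunc n x \<le> A_gf x"
  unfolding A_trunc_def A_gf_def by (intro sum_le_suminf A_summable) auto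

lemma A_gf_nonneg: "0 \<le> x \<Longrightarrow> x < \<rho> \<Longrightarrow> A_gf x \<ge> 0"
  unfolding A_gf_def by (intro suminf_nonneg A_summable) auto

lemma A_gf_ge: "0 \<le> x \<Longrightarrow> x < \<rho> \<Longrightarrow> A_gf x \<ge> x"
  using A_trunc_le_A[of x 1] a_coeff_ge_1[of 1] mult_right_mono[of 1 "real (a_coeff 1)" x]
  by (simp add: A_trunc_def)

lemma A_gf_scale:
  assumes "0 \<le> x" "x < \<rho>" "0 \<le> c" "c \<le> 1"
  shows "A_gf (c * x) \<le> c * A_gf x"
proof -
  have "c * x \<le> x" using assms by (simp add: mult_left_le_one_le)
  then have "c * x < \<rho>" using assms by linarith
  then show ?thesis
    unfolding A_gf_def suminf_mult[OF A_summable[OF assms(1,2)], symmetric]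
    using assms by (intro suminf_le A_term_scale summable_mult A_summable) auto
qed

lemma A_gf_isCont: "\<bar>x\<bar> < \<rho> \<Longrightarrow> isCont A_gf x"
proof -
  assume "\<bar>x\<bar> < \<rho>"
  then obtain K where K: "\<bar>x\<bar> < K" "K < \<rho>" using dense by blast
  then show ?thesis
    unfolding A_gf_def using A_summable[of K] by (intro isCont_powser[of _ K]) auto
qed

lemma less_1_if_square_less_\<rho>:
  assumes "s ^ 2 < \<rho>"
  shows "s < 1"
proof (rule ccontr)
  assume "\<not> s < 1"
  then have "1 \<le> s ^ 2" by (intro one_le_power) simp
  then show False using assms \<rho>_le_1 by linarith
qed

lemma power_le_square: "0 \<le> s \<Longrightarrow> s ^ 2 < \<rho> \<Longrightarrow> s ^ (j + 2) \<le> s ^ 2"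
  using less_1_if_square_less_\<rho>[of s] by (intro power_decreasing) auto


text \<open>Scaling gives the geometric majorant \<open>s ^ j * A_gf (s ^ 2)\<close>. The argument
  \<open>s\<close> itself may exceed \<open>\<rho>\<close>; only its square has to lie inside the
  disc.\<close>

lemma \<Phi>_summable:
  assumes "0 \<le> s" "s ^ 2 < \<rho>"
  shows "summable (\<lambda>j. A_gf (s ^ (j + 2)) / real (j + 2))"
    and "\<And>j. norm (A_gf (s ^ (j + 2)) / real (j + 2)) \<le> s ^ j * A_gf (s ^ 2)"
proof -
  have s1: "s < 1" using less_1_if_square_less_\<rho>[OF assms(2)] .
  show bd: "norm (A_gf (s ^ (j + 2)) / real (j + 2)) \<le> s ^ j * A_gf (s ^ 2)" for j
  proof -
    have "s ^ (j + 2) < \<rho>" using power_le_square[OF assms, of j] assms by linarith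
    then have nn: "A_gf (s ^ (j + 2)) \<ge> 0" using assms by (intro A_gf_nonneg) auto
    then have "A_gf (s ^ (j + 2)) / real (j + 2) \<le> A_gf (s ^ (j + 2)) / 1"
      by (intro divide_left_mono) auto
    also have "\<dots> \<le> s ^ j * A_gf (s ^ 2)"
      unfolding power_add div_by_1 using assms s1 by (intro A_gf_scale) (auto simp: power_le_one)
    finally show ?thesis using nn by simp
  qed
  have "summable (\<lambda>j. s ^ j * A_gf (s ^ 2))"
    using assms s1 by (intro summable_mult2 summable_geometric) auto
  then show "summable (\<lambda>j. A_gf (s ^ (j + 2)) / real (j + 2))"
    by (rule summable_comparison_test') (rule bd)
qed

lemma \<Phi>_term_nonneg: "0 \<le> s \<Longrightarrow> s ^ 2 < \<rho> \<Longrightarrow> A_gf (s ^ (j + 2)) / real (j + 2) \<ge> 0"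
  using power_le_square[of s j] by (intro divide_nonneg_nonneg A_gf_nonneg) auto

lemma \<Phi>_ge_1: "0 \<le> s \<Longrightarrow> s ^ 2 < \<rho> \<Longrightarrow> \<Phi> s \<ge> 1"
  unfolding \<Phi>_def using \<Phi>_term_nonneg \<Phi>_summable by (subst one_le_exp_iff) (intro suminf_nonneg)

text \<open>The majorant at a point \<open>y\<close> strictly between \<open>s\<close> and
  \<open>sqrt \<rho>\<close> gives uniform convergence around \<open>s\<close>. The case of interest
  is \<open>s = \<rho>\<close>, approached from both sides.\<close>

lemma \<Phi>_isCont:
  assumes "0 < s" "s ^ 2 < \<rho>"
  shows "isCont \<Phi> s"
proof -
  define y where "y = (s + sqrt \<rho>) / 2"
  have "s < sqrt \<rho>" using assms by (simp add: real_less_rsqrt)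
  then have y: "s < y" "0 < y" "y < sqrt \<rho>" using assms by (auto simp: y_def)
  have y2: "y ^ 2 < \<rho>" using y by (metis real_less_lsqrt real_sqrt_less_iff real_sqrt_abs2 power2_eq_square abs_of_pos)
  have le: "0 \<le> x \<Longrightarrow> x \<le> y \<Longrightarrow> x ^ 2 < \<rho>" for x
    using y2 power_mono[of x y 2] by linarith
  have "uniform_limit {0..y} (\<lambda>n x. \<Sum>j<n. A_gf (x ^ (j + 2)) / real (j + 2))
          (\<lambda>x. \<Sum>j. A_gf (x ^ (j + 2)) / real (j + 2)) sequentially"
  proof (rule Weierstrass_m_test)
    fix j x assume x: "x \<in> {0..y}"
    have sq: "x ^ 2 \<le> y ^ 2" using x by (intro power_mono) auto
    have "norm (A_gf (x ^ (j + 2)) / real (j + 2)) \<le> x ^ j * A_gf (x ^ 2)"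
      using x le by (intro \<Phi>_summable) auto
    also have "\<dots> \<le> y ^ j * A_gf (y ^ 2)"
    proof (intro mult_mono power_mono)
      show "A_gf (x ^ 2) \<le> A_gf (y ^ 2)"
        unfolding A_gf_def using x y2 sq le[of x]
        by (intro suminf_le A_summable mult_left_mono power_mono) auto
    qed (use x le A_gf_nonneg in auto)
    finally show "norm (A_gf (x ^ (j + 2)) / real (j + 2)) \<le> y ^ j * A_gf (y ^ 2)" .
  next
    show "summable (\<lambda>j. y ^ j * A_gf (y ^ 2))"
      using less_1_if_square_less_\<rho>[OF y2] y by (intro summable_mult2 summable_geometric) auto
  qed
  moreover have "continuous_on {0..y} (\<lambda>x. \<Sum>j<n. A_gf (x ^ (j + 2)) / real (j + 2))" for n
  proof (intro continuous_intros)
    fix j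
    have "continuous_on {0..y} (A_gf \<circ> (\<lambda>x. x ^ (j + 2)))"
    proof (intro continuous_on_compose continuous_intros continuous_at_imp_continuous_on ballI A_gf_isCont)
      fix z assume "z \<in> (\<lambda>x. x ^ (j + 2)) ` {0..y}"
      then obtain x where x: "0 \<le> x" "x \<le> y" "z = x ^ (j + 2)" by auto
      then show "\<bar>z\<bar> < \<rho>" using power_le_square[of x j] le[of x] by auto
    qed
    then show "continuous_on {0..y} (\<lambda>x. A_gf (x ^ (j + 2)))" by (simp add: o_def)
  qed auto
  ultimately have "continuous_on {0..y} (\<lambda>x. \<Sum>j. A_gf (x ^ (j + 2)) / real (j + 2))"
    by (intro uniform_limit_theorem[OF always_eventually]) auto
  then have "continuous_on {0..y} \<Phi>"
    unfolding \<Phi>_def by (intro continuous_intros)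
  then show ?thesis
    using assms y continuous_on_interior[of "{0..y}" \<Phi> s] by simp
qed

lemma square_less_\<rho>: "0 \<le> x \<Longrightarrow> x < \<rho> \<Longrightarrow> x ^ 2 < \<rho>"
  using \<rho>_le_1 mult_left_mono[of x 1 x] by (simp add: power2_eq_square)

text \<open>Only the term \<open>i = 1\<close> of the logarithm keeps its truncation. The others are
  bounded by their full values at \<open>r ^ i\<close>, which lies inside the disc even if
  \<open>r\<close> does not.\<close>

lemma A_trunc_Suc_le:
  assumes "0 < r" "r ^ 2 < \<rho>"
  shows "A_trunc (Suc n) r \<le> r * (exp (A_trunc n r) * \<Phi> r)"
proof -
  have r1: "r < 1" using less_1_if_square_less_\<rho> assms by blast
  have "(\<lambda>j. A_trunc n (r ^ (j + 2)) / real (j + 2)) sums (ln (euler_trunc n r) - A_trunc n r)"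
    using ln_euler_trunc[OF assms(1) r1, of n]
      sums_Suc_iff[of "\<lambda>i. A_trunc n (r ^ Suc i) / real (Suc i)" "ln (euler_trunc n r) - A_trunc n r"]
    by simp
  then have "ln (euler_trunc n r) - A_trunc n r \<le> (\<Sum>j. A_gf (r ^ (j + 2)) / real (j + 2))"
  proof (rule sums_le[OF _ _ summable_sums, rotated])
    fix j
    have "r ^ (j + 2) < \<rho>" using power_le_square[of r j] assms by linarith
    then show "A_trunc n (r ^ (j + 2)) / real (j + 2) \<le> A_gf (r ^ (j + 2)) / real (j + 2)"
      using assms by (intro divide_right_mono A_trunc_le_A) auto
  qed (use assms \<Phi>_summable in auto)
  then have "exp (ln (euler_trunc n r)) \<le> exp (A_trunc n r) * \<Phi> r"
    unfolding \<Phi>_def by (simp add: exp_add[symmetric])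
  then have "euler_trunc n r \<le> exp (A_trunc n r) * \<Phi> r"
    using euler_trunc_pos[of r n] assms r1 by simp
  then show ?thesis
    using A_trunc_le_euler[OF assms(1) r1, of n] assms by (meson mult_left_mono order_trans less_imp_le)
qed

text \<open>With multiplicities bounded by \<open>m\<close>, only finitely many forests occur, and
  adding a root turns them into distinct trees counted by \<open>A\<close>. Then \<open>m\<close>
  tends to infinity.\<close>

lemma euler_trunc_le_A:
  assumes "0 < x" "x < \<rho>"
  shows "x * euler_trunc n x \<le> A_gf x"
proof -
  let ?S = "{U. vertices U \<le> n}"
  have x1: "x < 1" using assms \<rho>_le_1 by simp
  have le: "x * (\<Prod>U\<in>?S. \<Sum>j\<le>m. (x ^ vertices U) ^ j) \<le> A_gf x" for m
  proof -
    let ?M = "{F. set_mset F \<subseteq> ?S \<and> (\<forall>u. count F u \<le> m)}"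
    \<comment> \<open>The largest forest in \<open>?M\<close> has \<open>m\<close> copies of every
      tree in \<open>?S\<close>; the root adds one more vertex.\<close>
    define K where "K = Suc (forest_size (repeat_mset m (mset_set ?S)))"
    have sub: "F \<subseteq># repeat_mset m (mset_set ?S)" if "F \<in> ?M" for F
      using that finite_trees_le by (auto simp: subseteq_mset_def count_mset_set' not_in_iff subset_iff)
    have "x * (\<Prod>U\<in>?S. \<Sum>j\<le>m. (x ^ vertices U) ^ j) = x * (\<Sum>F\<in>?M. \<Prod>U\<in>#F. x ^ vertices U)"
      using prod_sum_multisets[OF finite_trees_le] by metis
    also have "\<dots> = (\<Sum>F\<in>?M. x ^ vertices (Join F))"
      by (simp add: vertices_Join prod_mset_power_vertices sum_distrib_left del: vertices.simps)
    also have "\<dots> = (\<Sum>T\<in>Join ` ?M. x ^ vertices T)"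
      by (subst sum.reindex) (auto simp: inj_on_def simp del: vertices.simps)
    also have "\<dots> \<le> (\<Sum>T | vertices T \<le> K. x ^ vertices T)"
    proof (rule sum_mono2)
      show "Join ` ?M \<subseteq> {T. vertices T \<le> K}"
      proof clarify
        fix F assume "set_mset F \<subseteq> ?S" "\<forall>u. count F u \<le> m"
        then have "F \<subseteq># repeat_mset m (mset_set ?S)" using sub by blast
        then have "forest_size F \<le> forest_size (repeat_mset m (mset_set ?S))"
          by (auto simp: forest_size_def subset_mset.le_iff_add)
        then show "vertices (Join F) \<le> K" by (simp add: vertices_Join K_def del: vertices.simps)
      qed
    qed (use assms finite_trees_le in auto)
    also have "\<dots> \<le> A_gf x"
      using A_trunc_le_A[of x K] assms by (simp add: A_trunc_eq)
    finally show ?thesis .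
  qed
  have "(\<lambda>m. x * (\<Prod>U\<in>?S. \<Sum>j\<le>m. (x ^ vertices U) ^ j)) \<longlonglongrightarrow> x * euler_trunc n x"
    unfolding euler_trunc_def
  proof (intro tendsto_mult_left tendsto_prod)
    fix U :: ptree
    have *: "norm (x ^ vertices U) < 1" using assms power_vertices_less_1[of x U] x1 by simp
    show "(\<lambda>m. \<Sum>j\<le>m. (x ^ vertices U) ^ j) \<longlonglongrightarrow> 1 / (1 - x ^ vertices U)"
      using summable_LIMSEQ'[OF summable_geometric[OF *]] by (simp add: suminf_geometric[OF *])
  qed
  then show ?thesis by (rule LIMSEQ_le_const2) (use le in auto)
qed

section \<open>The functional equation and the value of \<Phi> at \<rho>\<close>

text \<open>Each inequality is a limit of one of the two preceding bounds. For the lower bound the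
  logarithmic series is cut after \<open>m\<close> terms, so that the limit in \<open>n\<close>
  passes through a finite sum.\<close>

lemma A_functional_equation:
  assumes "0 < x" "x < \<rho>"
  shows "A_gf x = x * (exp (A_gf x) * \<Phi> x)"
proof (rule antisym)
  have sq: "x ^ 2 < \<rho>" using square_less_\<rho> assms by simp
  have x1: "x < 1" using assms \<rho>_le_1 by simp
  have "A_trunc (Suc n) x \<le> x * (exp (A_gf x) * \<Phi> x)" for n
  proof -
    have "A_trunc (Suc n) x \<le> x * (exp (A_trunc n x) * \<Phi> x)"
      using assms sq by (intro A_trunc_Suc_le) auto
    also have "\<dots> \<le> x * (exp (A_gf x) * \<Phi> x)"
      using assms A_trunc_le_A[of x n] \<Phi>_ge_1[of x] sq by (intro mult_left_mono mult_right_mono) auto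
    finally show ?thesis .
  qed
  then show "A_gf x \<le> x * (exp (A_gf x) * \<Phi> x)"
    using LIMSEQ_Suc[OF A_trunc_tendsto[of x]] assms by (intro LIMSEQ_le_const2) auto
  have pos: "A_gf x > 0" using A_gf_ge[of x] assms by simp
  have pow: "x ^ Suc i < \<rho>" for i
    unfolding power_Suc
    using assms x1 mult_left_le[of "x ^ i" x] power_le_one[of x i] by linarith
  have part: "(\<Sum>i<m. A_gf (x ^ Suc i) / real (Suc i)) \<le> ln (A_gf x / x)" for m
  proof (rule LIMSEQ_le_const2)
    show "(\<lambda>n. \<Sum>i<m. A_trunc n (x ^ Suc i) / real (Suc i)) \<longlonglongrightarrow> (\<Sum>i<m. A_gf (x ^ Suc i) / real (Suc i))"
      using assms pow by (intro tendsto_sum tendsto_divide A_trunc_tendsto tendsto_const) auto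
    have "(\<Sum>i<m. A_trunc n (x ^ Suc i) / real (Suc i)) \<le> ln (A_gf x / x)" for n
    proof -
      have "(\<Sum>i<m. A_trunc n (x ^ Suc i) / real (Suc i)) \<le> ln (euler_trunc n x)"
        unfolding sums_unique[OF ln_euler_trunc[OF assms(1) x1, of n]]
        using assms sums_summable[OF ln_euler_trunc[OF assms(1) x1, of n]]
        by (intro sum_le_suminf) (auto intro!: divide_nonneg_nonneg A_trunc_nonneg)
      also have "\<dots> \<le> ln (A_gf x / x)"
        using euler_trunc_le_A[OF assms, of n] euler_trunc_pos[OF assms(1) x1, of n] assms
        by (intro ln_mono) (auto simp: field_simps)
      finally show ?thesis .
    qed
    then show "\<exists>N. \<forall>n\<ge>N. (\<Sum>i<m. A_trunc n (x ^ Suc i) / real (Suc i)) \<le> ln (A_gf x / x)" by blast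
  qed
  have "(\<lambda>j. A_gf (x ^ (j + 2)) / real (j + 2)) sums (\<Sum>j. A_gf (x ^ (j + 2)) / real (j + 2))"
    using assms sq by (intro summable_sums \<Phi>_summable) auto
  then have "(\<lambda>i. A_gf (x ^ Suc i) / real (Suc i)) sums ((\<Sum>j. A_gf (x ^ (j + 2)) / real (j + 2)) + A_gf x)"
    using sums_Suc[of "\<lambda>i. A_gf (x ^ Suc i) / real (Suc i)"] by simp
  then have "(\<Sum>j. A_gf (x ^ (j + 2)) / real (j + 2)) + A_gf x \<le> ln (A_gf x / x)"
    unfolding sums_def using part by (intro LIMSEQ_le_const2) auto
  then have "exp (A_gf x) * \<Phi> x \<le> exp (ln (A_gf x / x))"
    unfolding \<Phi>_def by (simp add: exp_add[symmetric] add.commute)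
  also have "\<dots> = A_gf x / x" using pos assms by simp
  finally show "x * (exp (A_gf x) * \<Phi> x) \<le> A_gf x"
    using assms by (simp add: field_simps)
qed

text \<open>With \<open>a = A_gf x\<close>, the functional equation reads
  \<open>x * \<Phi> x = a * exp (- a)\<close>, and \<open>a * exp (- a)\<close> is maximal at
  \<open>a = 1\<close>.\<close>

lemma x_\<Phi>_le:
  assumes "0 < x" "x < \<rho>"
  shows "x * \<Phi> x \<le> exp (- 1)"
proof -
  have "A_gf x \<le> exp (A_gf x - 1)" using exp_ge_add_one_self[of "A_gf x - 1"] by simp
  then have "A_gf x * exp (- A_gf x) \<le> exp (A_gf x - 1) * exp (- A_gf x)" by (intro mult_right_mono) auto
  also have "\<dots> = exp (- 1)" by (simp add: exp_add[symmetric])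
  also have "A_gf x * exp (- A_gf x) = x * \<Phi> x"
    by (subst A_functional_equation[OF assms]) (simp add: exp_minus field_simps)
  finally show ?thesis .
qed

text \<open>The strict inequality makes \<open>\<rho> ^ 2 < \<rho>\<close>, which puts
  \<open>\<rho>\<close> into the interior of the domain of \<open>\<Phi>\<close>.\<close>

lemma \<rho>_less_1: "\<rho> < 1"
proof -
  have "\<rho> \<le> exp (- 1)"
  proof (rule dense_le_bounded[OF \<rho>_pos])
    fix x assume x: "0 < x" "x < \<rho>"
    then have "x * 1 \<le> x * \<Phi> x" using \<Phi>_ge_1[of x] square_less_\<rho>[of x] by (intro mult_left_mono) auto
    then show "x \<le> exp (- 1)" using x_\<Phi>_le[OF x] by simp
  qed
  also have "\<dots> < 1" by simp
  finally show ?thesis .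
qed

lemma \<rho>_square_less: "\<rho> ^ 2 < \<rho>"
  using \<rho>_less_1 \<rho>_pos by (simp add: power2_eq_square)

text \<open>The upper bound is a limit from the left. If it were strict, continuity would give
  \<open>r > \<rho>\<close> with \<open>r * exp 1 * \<Phi> r < 1\<close>; then the bound
  \<open>1\<close> on the truncations at \<open>r\<close> would reproduce itself, and the series
  would converge at \<open>r\<close>, beyond its radius.\<close>

lemma \<rho>_\<Phi>_\<rho>: "\<rho> * \<Phi> \<rho> = exp (- 1)"
proof (rule antisym)
  have cont: "isCont (\<lambda>x. x * \<Phi> x) \<rho>"
    using \<Phi>_isCont[OF \<rho>_pos \<rho>_square_less] by (intro continuous_intros)
  have "((\<lambda>x. x * \<Phi> x) \<longlongrightarrow> \<rho> * \<Phi> \<rho>) (at_left \<rho>)"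
    using cont by (auto simp: isCont_def intro: filterlim_mono[OF _ order_refl at_le])
  moreover have "eventually (\<lambda>x. x * \<Phi> x \<le> exp (- 1)) (at_left \<rho>)"
    using \<rho>_pos x_\<Phi>_le by (auto simp: eventually_at_left_field intro!: exI[of _ 0])
  ultimately show "\<rho> * \<Phi> \<rho> \<le> exp (- 1)"
    by (rule tendsto_upperbound) auto
  show "exp (- 1) \<le> \<rho> * \<Phi> \<rho>"
  proof (rule ccontr)
    assume "\<not> ?thesis"
    moreover have "((\<lambda>x. x * \<Phi> x) \<longlongrightarrow> \<rho> * \<Phi> \<rho>) (at_right \<rho>)"
      using cont by (auto simp: isCont_def intro: filterlim_mono[OF _ order_refl at_le])
    ultimately have "eventually (\<lambda>x. x * \<Phi> x < exp (- 1)) (at_right \<rho>)"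
      by (intro order_tendstoD) auto
    moreover have "((\<lambda>x. x ^ 2) \<longlongrightarrow> \<rho> ^ 2) (at_right \<rho>)"
      by (intro tendsto_intros)
    then have "eventually (\<lambda>x. x ^ 2 < \<rho>) (at_right \<rho>)"
      using \<rho>_square_less by (intro order_tendstoD) auto
    moreover have "eventually (\<lambda>x. x > \<rho>) (at_right \<rho>)"
      by (rule eventually_at_right_less)
    ultimately have "eventually (\<lambda>x. x * \<Phi> x < exp (- 1) \<and> x ^ 2 < \<rho> \<and> x > \<rho>) (at_right \<rho>)"
      by eventually_elim auto
    then obtain r where r: "r * \<Phi> r < exp (- 1)" "r ^ 2 < \<rho>" "r > \<rho>"
      using eventually_happens'[of "at_right \<rho>"] by auto
    have r0: "r > 0" using r \<rho>_pos by simp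
    have "A_trunc n r \<le> 1" for n
    proof (induction n)
      case (Suc n)
      have "A_trunc (Suc n) r \<le> r * (exp (A_trunc n r) * \<Phi> r)"
        using r r0 by (intro A_trunc_Suc_le) auto
      also have "\<dots> \<le> r * (exp 1 * \<Phi> r)"
        using r r0 \<Phi>_ge_1[of r] Suc by (intro mult_left_mono mult_right_mono) auto
      also have "\<dots> = exp 1 * (r * \<Phi> r)" by simp
      also have "\<dots> \<le> exp 1 * exp (- 1)" using r by (intro mult_left_mono) auto
      finally show ?case by (simp add: exp_minus)
    qed (simp add: A_trunc_def)
    then have "ereal r \<le> A_conv_radius" using r0 by (intro A_conv_radius_geI)
    then show False using r by (simp add: ereal_\<rho>[symmetric])
  qed
qed

section \<open>Distribution of the Boltzmann samplers\<close>

text \<open>For a fixed outcome only finitely many intermediate values contribute in all the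
  samplers, so integrals can be replaced by finite sums once and for all.\<close>

lemma spmf_bind_sum:
  assumes "finite A" "\<And>x. x \<notin> A \<Longrightarrow> spmf p x * spmf (f x) y = 0"
  shows "spmf (bind_spmf p f) y = (\<Sum>x\<in>A. spmf p x * spmf (f x) y)"
proof -
  have "ennreal (spmf (bind_spmf p f) y) = (\<integral>\<^sup>+ x. ennreal (spmf p x * spmf (f x) y) \<partial>count_space UNIV)"
    by (simp only: ennreal_spmf_bind nn_integral_measure_spmf ennreal_mult[OF pmf_nonneg pmf_nonneg])
  also have "\<dots> = (\<Sum>x\<in>A. ennreal (spmf p x * spmf (f x) y))"
    using assms by (intro nn_integral_count_space') auto
  also have "\<dots> = ennreal (\<Sum>x\<in>A. spmf p x * spmf (f x) y)"
    by (intro sum_ennreal) auto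
  finally show ?thesis by (subst (asm) ennreal_inj) (auto intro!: sum_nonneg)
qed

lemma sum_spmf_le_weight:
  assumes "finite A"
  shows "(\<Sum>x\<in>A. spmf p x) \<le> weight_spmf p"
proof -
  have "measure (measure_spmf p) A = (\<Sum>x\<in>A. measure (measure_spmf p) {x})"
    by (rule measure_spmf.finite_measure_eq_sum_singleton[OF assms]) simp
  then have "(\<Sum>x\<in>A. spmf p x) = measure (measure_spmf p) A"
    by (simp only: spmf_conv_measure_spmf)
  also have "\<dots> \<le> weight_spmf p"
    unfolding weight_spmf_def by (intro measure_spmf.finite_measure_mono) auto
  finally show ?thesis .
qed

lemma spmf_bind_return_unique:
  assumes "f x = y" "\<And>x'. f x' = y \<Longrightarrow> x' = x"
  shows "spmf (bind_spmf p (\<lambda>x. return_spmf (f x))) y = spmf p x"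
proof (subst spmf_bind_sum[of "{x}"])
  fix x' assume "x' \<notin> {x}"
  then have "f x' \<noteq> y" using assms(2) by blast
  then show "spmf p x' * spmf (return_spmf (f x')) y = 0" by simp
qed (use assms(1) in simp_all)

lemma spmf_bind_return_none:
  assumes "\<And>x. f x \<noteq> y"
  shows "spmf (bind_spmf p (\<lambda>x. return_spmf (f x))) y = 0"
  using assms by (subst spmf_bind_sum[of "{}"]) auto

lemma spmf_sample_all:
  "spmf (sample_all ps) xs = (if length xs = length ps then prod_list (map2 spmf ps xs) else 0)"
proof (induction ps arbitrary: xs)
  case Nil
  then show ?case by auto
next
  case (Cons p ps)
  show ?case
  proof (cases xs)
    case Nil
    then show ?thesis by (auto simp: spmf_bind_return_none intro!: trans[OF spmf_bind_sum[of "{}"]])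
  next
    case xs: (Cons y ys)
    have inner: "spmf (bind_spmf (sample_all ps) (\<lambda>zs. return_spmf (x # zs))) (y # ys) =
        (if x = y then spmf (sample_all ps) ys else 0)" for x
      by (auto simp: spmf_bind_return_none intro!: spmf_bind_return_unique)
    have "spmf (sample_all (p # ps)) xs = (\<Sum>x\<in>{y}. spmf p x * (if x = y then spmf (sample_all ps) ys else 0))"
      unfolding xs sample_all.simps by (subst spmf_bind_sum[of "{y}"]) (auto simp: inner)
    then show ?thesis by (simp add: xs Cons.IH)
  qed
qed

lemma spmf_iid: "spmf (iid m p) xs = (if length xs = m then \<Prod>x\<leftarrow>xs. spmf p x else 0)"
proof -
  have "map2 spmf (replicate (length xs) p) xs = map (spmf p) xs"
    by (induction xs) auto
  then show ?thesis by (auto simp: iid_def spmf_sample_all)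
qed

lemma lossless_sample_all: "(\<And>p. p \<in> set ps \<Longrightarrow> lossless_spmf p) \<Longrightarrow> lossless_spmf (sample_all ps)"
  by (induction ps) auto

lemma lossless_iid: "lossless_spmf p \<Longrightarrow> lossless_spmf (iid m p)"
  unfolding iid_def by (rule lossless_sample_all) auto

lemma spmf_bind_plus:
  "spmf (bind_spmf p (\<lambda>x. bind_spmf q (\<lambda>y. return_spmf (x + y)))) G = mset_conv (spmf p) (spmf q) G"
proof -
  have inner: "spmf (bind_spmf q (\<lambda>y. return_spmf (x + y))) G = (if x \<subseteq># G then spmf q (G - x) else 0)" for x
    by (auto simp: subset_mset.le_iff_add intro!: spmf_bind_return_none spmf_bind_return_unique)
  show ?thesis
    unfolding mset_conv_def
    by (subst spmf_bind_sum[of "{H. H \<subseteq># G}"]) (auto simp: inner finite_submultisets)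
qed

lemma spmf_sum_list_sample_all:
  "spmf (bind_spmf (sample_all ps) (\<lambda>Fs. return_spmf (sum_list Fs))) = mset_convs (map spmf ps)"
proof (induction ps)
  case Nil
  then show ?case by (auto simp: fun_eq_iff mset_unit_def)
next
  case (Cons p ps)
  have "bind_spmf (sample_all (p # ps)) (\<lambda>Fs. return_spmf (sum_list Fs)) =
    bind_spmf p (\<lambda>F. bind_spmf (bind_spmf (sample_all ps) (\<lambda>Fs. return_spmf (sum_list Fs))) (\<lambda>G. return_spmf (F + G)))"
    by simp
  then show ?case by (simp only: spmf_bind_plus Cons.IH list.map mset_convs_simps fun_eq_iff) simp
qed

lemma forest_size_plus [simp]: "forest_size (F + G) = forest_size F + forest_size G"
  by (simp add: forest_size_def)

lemma forest_size_empty [simp]: "forest_size {#} = 0"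
  by (simp add: forest_size_def)

lemma forest_size_repeat [simp]: "forest_size (repeat_mset i F) = i * forest_size F"
  by (induction i) simp_all

lemma forest_size_diff: "H \<subseteq># F \<Longrightarrow> forest_size H + forest_size (F - H) = forest_size F"
  by (auto simp: subset_mset.le_iff_add)

text \<open>The factor \<open>x ^ forest_size H\<close> is multiplicative, hence passes through
  convolutions. The assumption is confined to submultisets of \<open>F\<close>, because in the
  induction on trees the law of the recursive calls is known only for the trees in
  \<open>F\<close>.\<close>

lemma mset_convs_weighted:
  assumes "\<And>i H. i \<in> set is \<Longrightarrow> H \<subseteq># F \<Longrightarrow> f i H = c i * x ^ forest_size H * g i H"
  shows "mset_convs (map f is) F = (\<Prod>i\<leftarrow>is. c i) * x ^ forest_size F * mset_convs (map g is) F"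
  using assms
proof (induction "is" arbitrary: F)
  case Nil
  then show ?case by (simp add: mset_unit_def)
next
  case (Cons i "is")
  have "mset_convs (map f (i # is)) F = (\<Sum>H | H \<subseteq># F. f i H * mset_convs (map f is) (F - H))"
    by (simp add: mset_conv_def)
  also have "\<dots> = (\<Sum>H | H \<subseteq># F. (\<Prod>i\<leftarrow>i # is. c i) * x ^ forest_size F *
      (g i H * mset_convs (map g is) (F - H)))"
  proof (intro sum.cong refl)
    fix H assume "H \<in> {H. H \<subseteq># F}"
    then have H: "H \<subseteq># F" by simp
    have "mset_convs (map f is) (F - H) =
        (\<Prod>i\<leftarrow>is. c i) * x ^ forest_size (F - H) * mset_convs (map g is) (F - H)"
      using Cons.prems by (intro Cons.IH) (auto intro: subset_mset.order_trans[OF _ diff_subset_eq_self])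
    moreover have "x ^ forest_size F = x ^ forest_size H * x ^ forest_size (F - H)"
      by (simp add: power_add[symmetric] forest_size_diff[OF H])
    ultimately show "f i H * mset_convs (map f is) (F - H) = (\<Prod>i\<leftarrow>i # is. c i) * x ^ forest_size F *
      (g i H * mset_convs (map g is) (F - H))"
      using Cons.prems[of i H] H by simp
  qed
  finally show ?case by (simp add: mset_conv_def sum_distrib_left)
qed

text \<open>One pass of the loop over \<open>i\<close> in \<open>\<Gamma>B\<close>, with the law of
  the multiplicity left open. The case \<open>i = 1\<close> covers the Poisson children in
  \<open>\<Gamma>A\<close>.\<close>

definition block_sampler :: "nat \<Rightarrow> nat pmf \<Rightarrow> ptree spmf \<Rightarrow> forest spmf" where
  "block_sampler i \<mu> \<gamma> = do {
     M \<leftarrow> spmf_of_pmf \<mu>;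
     Ts \<leftarrow> iid M \<gamma>;
     return_spmf (repeat_mset i (mset Ts)) }"

lemma finite_lists_repeat_mset:
  assumes "i > 0"
  shows "finite {us. repeat_mset i (mset us) = H}"
proof (cases "\<exists>H'. H = repeat_mset i H'")
  case True
  then show ?thesis using assms finite_lists_mset by (auto simp: repeat_mset_inject)
next
  case False
  then have "{us. repeat_mset i (mset us) = H} = {}" by auto
  then show ?thesis by (metis finite.emptyI)
qed

lemma in_repeat_mset: "i > 0 \<Longrightarrow> x \<in># repeat_mset i A \<longleftrightarrow> x \<in># A"
  by (metis count_greater_zero_iff count_repeat_mset nat_0_less_mult_iff)

text \<open>A tree drawn at parameter \<open>s ^ i\<close> is copied \<open>i\<close> times, so its
  weight becomes \<open>s\<close> to the number of all vertices added.\<close>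

lemma spmf_block_sampler:
  assumes "i > 0" "\<And>T. T \<in># H \<Longrightarrow> spmf \<gamma> T = (s ^ i) ^ vertices T / a"
  shows "spmf (block_sampler i \<mu> \<gamma>) H =
    s ^ forest_size H * (\<Sum>us | repeat_mset i (mset us) = H. pmf \<mu> (length us) / a ^ length us)"
proof -
  have inner: "spmf (bind_spmf (iid M \<gamma>) (\<lambda>Ts. return_spmf (repeat_mset i (mset Ts)))) H =
     (\<Sum>us | repeat_mset i (mset us) = H. if length us = M then \<Prod>x\<leftarrow>us. spmf \<gamma> x else 0)" for M
    using assms(1) by (subst spmf_bind_sum[OF finite_lists_repeat_mset]) (auto simp: spmf_iid intro!: sum.cong)
  have prod: "(\<Prod>x\<leftarrow>us. spmf \<gamma> x) = s ^ forest_size H / a ^ length us" if us: "repeat_mset i (mset us) = H" for us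
  proof -
    have "(\<Prod>x\<leftarrow>us. spmf \<gamma> x) = (\<Prod>x\<leftarrow>us. (s ^ i) ^ vertices x / a)"
      using assms us by (intro arg_cong[of _ _ prod_list] map_cong refl assms) (auto simp: in_repeat_mset)
    also have "\<dots> = (s ^ i) ^ forest_size (mset us) / a ^ length us"
      by (induction us) (simp_all add: forest_size_def power_add)
    finally show ?thesis using us by (auto simp: power_mult[symmetric])
  qed
  have "spmf (block_sampler i \<mu> \<gamma>) H = (\<Sum>M\<in>length ` {us. repeat_mset i (mset us) = H}. pmf \<mu> M *
     (\<Sum>us | repeat_mset i (mset us) = H. if length us = M then \<Prod>x\<leftarrow>us. spmf \<gamma> x else 0))"
    unfolding block_sampler_def using assms(1)
    by (subst spmf_bind_sum[OF finite_imageI[OF finite_lists_repeat_mset]])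
       (auto simp: inner intro!: sum.neutral sum.cong)
  also have "\<dots> = (\<Sum>us | repeat_mset i (mset us) = H. \<Sum>M\<in>length ` {us. repeat_mset i (mset us) = H}.
      if length us = M then pmf \<mu> M * (\<Prod>x\<leftarrow>us. spmf \<gamma> x) else 0)"
    unfolding sum_distrib_left by (subst sum.swap) (intro sum.cong refl, auto)
  also have "\<dots> = (\<Sum>us | repeat_mset i (mset us) = H. pmf \<mu> (length us) * (\<Prod>x\<leftarrow>us. spmf \<gamma> x))"
    using finite_lists_repeat_mset[OF assms(1), of H] by (intro sum.cong refl) (simp add: sum.delta')
  also have "\<dots> = (\<Sum>us | repeat_mset i (mset us) = H. s ^ forest_size H * (pmf \<mu> (length us) / a ^ length us))"
    by (intro sum.cong refl) (auto simp: prod)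
  finally show ?thesis by (simp add: sum_distrib_left)
qed

text \<open>The power \<open>a ^ m\<close> in the Poisson probability cancels the normalising
  constants of the \<open>m\<close> trees.\<close>

lemma spmf_block_sampler_poisson:
  assumes "i > 0" "a > 0" "\<And>T. T \<in># H \<Longrightarrow> spmf \<gamma> T = (s ^ i) ^ vertices T / a"
  shows "spmf (block_sampler i (poisson_pmf (a / real i)) \<gamma>) H =
    exp (- (a / real i)) * s ^ forest_size H * block_weight i H"
proof -
  have "pmf (poisson_pmf (a / real i)) m / a ^ m = exp (- (a / real i)) * (1 / (fact m * real i ^ m))" for m
    using assms by (simp add: power_divide field_simps)
  then show ?thesis
    by (simp only: spmf_block_sampler[OF assms(1,3)] block_weight_def sum_distrib_left[symmetric] ac_simps)
qed

lemma pmf_poisson_ge1: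
  assumes "x > 0"
  shows "pmf (poisson_ge1 x) m = (if m = 0 then 0 else pmf (poisson_pmf x) m / (1 - exp (- x)))"
proof -
  have ne: "set_pmf (poisson_pmf x) \<inter> {1..} \<noteq> {}" using assms by (auto simp: set_pmf_poisson)
  have "measure_pmf.prob (poisson_pmf x) {1..} = 1 - measure_pmf.prob (poisson_pmf x) {0}"
  proof -
    have "{1..} = space (measure_pmf (poisson_pmf x)) - {0 :: nat}" by auto
    then show ?thesis using measure_pmf.prob_compl[of "{0}" "poisson_pmf x"] by simp
  qed
  also have "\<dots> = 1 - exp (- x)" using assms by (simp add: measure_pmf_single)
  finally show ?thesis unfolding poisson_ge1_def by (subst pmf_cond[OF ne]) auto
qed

lemma spmf_block_sampler_poisson_ge1:
  assumes "i > 0" "a > 0" "\<And>T. T \<in># H \<Longrightarrow> spmf \<gamma> T = (s ^ i) ^ vertices T / a"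
  shows "spmf (block_sampler i (poisson_ge1 (a / real i)) \<gamma>) H =
    inverse (exp (a / real i) - 1) * s ^ forest_size H * (block_weight i H - mset_unit H)"
proof -
  define x where "x = a / real i"
  have x: "x > 0" using assms by (simp add: x_def)
  have ex: "exp x > 1" using x by simp
  have c: "exp (- x) / (1 - exp (- x)) = inverse (exp x - 1)"
    using ex by (simp add: exp_minus field_simps)
  have pm: "pmf (poisson_ge1 x) m / a ^ m = inverse (exp x - 1) * (1 / (fact m * real i ^ m) - (if m = 0 then 1 else 0))" for m
  proof (cases "m = 0")
    case True
    then show ?thesis using x by (simp add: pmf_poisson_ge1)
  next
    case False
    then have "pmf (poisson_ge1 x) m / a ^ m = (x / a) ^ m / fact m * (exp (- x) / (1 - exp (- x)))"
      using x by (simp add: pmf_poisson_ge1 power_divide)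
    also have "x / a = 1 / real i" using assms by (simp add: x_def)
    finally show ?thesis using False by (simp add: c power_divide field_simps)
  qed
  have unit: "(\<Sum>us | repeat_mset i (mset us) = H. if length us = 0 then 1 else 0) = mset_unit H"
  proof (cases "H = {#}")
    case True
    then have "{us. repeat_mset i (mset us) = H} = {[]}" using assms(1) by (auto simp: repeat_mset_eq_empty_iff)
    then show ?thesis using True by (simp add: mset_unit_def)
  next
    case False
    then show ?thesis by (auto simp: mset_unit_def intro!: sum.neutral)
  qed
  have "spmf (block_sampler i (poisson_ge1 x) \<gamma>) H = s ^ forest_size H *
      (\<Sum>us | repeat_mset i (mset us) = H. pmf (poisson_ge1 x) (length us) / a ^ length us)"
    by (rule spmf_block_sampler[OF assms(1,3)])
  also have "\<dots> = s ^ forest_size H * (inverse (exp x - 1) * (block_weight i H - mset_unit H))"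
    by (simp only: pm sum_distrib_left[symmetric] sum_subtractf unit block_weight_def)
  finally show ?thesis by (simp only: x_def ac_simps)
qed

section \<open>The maximal index and the laws of the two Boltzmann samplers\<close>

text \<open>\<open>max_index\<close> is a definite description, so existence and uniqueness are due.
  The increments of \<open>C\<close> are nonnegative and telescope, \<open>C\<close> tends to 1 by
  the definition of \<open>\<Phi>\<close>, and a distribution on the naturals is determined by its
  distribution function.\<close>

lemma max_index_cdf:
  assumes "0 \<le> s" "s ^ 2 < \<rho>"
  defines "C \<equiv> \<lambda>k. inverse (\<Phi> s) * exp (\<Sum>i = 2..k. A_gf (s ^ i) / real i)"
  shows "pmf (max_index s) k = (if k = 0 then C 0 else C k - C (k - 1))"
proof -
  have nn: "A_gf (s ^ i) / real i \<ge> 0" if "i \<ge> 2" for i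
    using \<Phi>_term_nonneg[OF assms(1,2), of "i - 2"] that by (simp only: le_add_diff_inverse2)
  have \<Phi>0: "\<Phi> s > 0" by (simp add: \<Phi>_def)
  define f where "f k = (if k = 0 then C 0 else C k - C (k - 1))" for k
  have mono: "C k \<le> C (Suc k)" for k
  proof -
    have "(\<Sum>i = 2..k. A_gf (s ^ i) / real i) \<le> (\<Sum>i = 2..Suc k. A_gf (s ^ i) / real i)"
    proof (rule sum_mono2)
      fix i assume "i \<in> {2..Suc k} - {2..k}"
      then show "0 \<le> A_gf (s ^ i) / real i" by (intro nn) simp
    qed auto
    then show ?thesis unfolding C_def using \<Phi>0 by (intro mult_left_mono) auto
  qed
  have f0: "f k \<ge> 0" for k
    using mono[of "k - 1"] \<Phi>0 by (cases k) (auto simp: f_def C_def)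
  have sumf: "(\<Sum>i\<le>k. f i) = C k" for k
    by (induction k) (auto simp: f_def)
  have "(\<lambda>k. \<Sum>i = 2..k. A_gf (s ^ i) / real i) \<longlonglongrightarrow> (\<Sum>j. A_gf (s ^ (j + 2)) / real (j + 2))"
  proof (rule LIMSEQ_offset[of _ 2])
    have eq: "(\<Sum>i = 2..k + 2. A_gf (s ^ i) / real i) = (\<Sum>j\<le>k. A_gf (s ^ (j + 2)) / real (j + 2))" for k
      by (induction k) simp_all
    show "(\<lambda>k. \<Sum>i = 2..k + 2. A_gf (s ^ i) / real i) \<longlonglongrightarrow> (\<Sum>j. A_gf (s ^ (j + 2)) / real (j + 2))"
      unfolding eq by (rule summable_LIMSEQ'[OF \<Phi>_summable(1)[OF assms(1,2)]])
  qed
  then have "C \<longlonglongrightarrow> inverse (\<Phi> s) * \<Phi> s"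
    unfolding C_def by (subst (2) \<Phi>_def) (intro tendsto_intros)
  then have "C \<longlonglongrightarrow> 1" using \<Phi>0 by simp
  then have "f sums 1" unfolding sums_def' sumf[symmetric] atLeast0AtMost .
  then have "(\<Sum>k. ennreal (f k)) = 1"
    unfolding ennreal_1[symmetric] by (rule suminf_ennreal_eq[OF f0])
  then have one: "(\<integral>\<^sup>+ k. ennreal (f k) \<partial>count_space UNIV) = 1"
    by (simp add: nn_integral_count_space_nat)
  define p where "p = embed_pmf f"
  have pmf_p: "pmf p k = f k" for k unfolding p_def by (rule pmf_embed_pmf[OF f0 one])
  have cdf_p: "measure_pmf.prob p {..k} = C k" for k
    by (simp add: measure_measure_pmf_finite pmf_p sumf)
  have uniq: "q = p" if q: "\<forall>k. measure_pmf.prob q {..k} = C k" for q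
  proof (rule pmf_eqI)
    fix k
    have sumq: "(\<Sum>i\<le>k. pmf q i) = C k" for k using q by (simp add: measure_measure_pmf_finite)
    show "pmf q k = pmf p k"
      using sumq[of k] sumq[of "k - 1"] by (cases k) (auto simp: pmf_p f_def)
  qed
  have "max_index s = (THE p. \<forall>k. measure_pmf.prob p {..k} = C k)"
    by (simp add: max_index_def C_def)
  also have "\<dots> = p"
    using cdf_p uniq by (intro the_equality) auto
  finally have "max_index s = p" .
  then show ?thesis by (simp add: pmf_p f_def)
qed

text \<open>\<open>W k\<close> is the weight of the decompositions of \<open>F\<close> with block
  lengths below \<open>k\<close>. The exponentials in the law of the maximal index cancel the
  Poisson constants, index \<open>I\<close> contributes \<open>W (Suc I) - W I\<close>, and the sum
  telescopes. The sampler \<open>\<gamma>\<close> is arbitrary, with its law assumed only on the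
  trees of \<open>F\<close>, for use inside the induction for \<open>\<Gamma>A\<close>.\<close>

lemma spmf_\<Gamma>B_via:
  assumes s: "0 < s" "s ^ 2 < \<rho>"
    and \<gamma>: "\<And>i T. i \<ge> 2 \<Longrightarrow> T \<in># F \<Longrightarrow> spmf (\<gamma> (s ^ i)) T = (s ^ i) ^ vertices T / A_gf (s ^ i)"
  shows "spmf (\<Gamma>B_via \<gamma> s) F = s ^ forest_size F * fixfree_weight F / \<Phi> s"
proof -
  define x where "x i = A_gf (s ^ i) / real i" for i
  define W where "W k = mset_convs (map block_weight [2..<k]) F" for k
  define blk where "blk I i = block_sampler i (if i < I then poisson_pmf (x i) else poisson_ge1 (x i)) (\<gamma> (s ^ i))" for I i
  have s1: "s < 1" using less_1_if_square_less_\<rho> s by blast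
  have pow: "s ^ i < \<rho>" if "i \<ge> 2" for i
  proof -
    have "s ^ i \<le> s ^ 2" using that s s1 by (intro power_decreasing) auto
    then show ?thesis using s by linarith
  qed
  have Apos: "A_gf (s ^ i) > 0" if "i \<ge> 2" for i
    using A_gf_ge[of "s ^ i"] pow[OF that] s zero_less_power[of s i] by linarith
  have xpos: "x i > 0" if "i \<ge> 2" for i using Apos[OF that] that by (simp add: x_def)
  define D where "D = (\<lambda>I. bind_spmf (sample_all (map (blk I) [2..<Suc I])) (\<lambda>Fs. return_spmf (sum_list Fs)))"
  have \<Gamma>B: "\<Gamma>B_via \<gamma> s = bind_spmf (spmf_of_pmf (max_index s)) D"
    unfolding \<Gamma>B_via_def D_def blk_def block_sampler_def x_def ..
  have D: "spmf (D I) F = (\<Prod>i\<leftarrow>[2..<I]. exp (- x i)) * inverse (exp (x I) - 1) * s ^ forest_size F * (W (Suc I) - W I)"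
    if I: "I \<ge> 2" for I
  proof -
    have up: "[2..<Suc I] = [2..<I] @ [I]" using I by simp
    have "spmf (D I) F = mset_convs (map (\<lambda>i. spmf (blk I i)) [2..<Suc I]) F"
      unfolding D_def by (subst fun_cong[OF spmf_sum_list_sample_all]) (simp add: o_def del: upt_Suc)
    also have "\<dots> = (\<Prod>i\<leftarrow>[2..<Suc I]. if i < I then exp (- x i) else inverse (exp (x i) - 1)) *
       s ^ forest_size F * mset_convs (map (\<lambda>i H. if i < I then block_weight i H else block_weight i H - mset_unit H) [2..<Suc I]) F"
    proof (rule mset_convs_weighted)
      fix i H assume i: "i \<in> set [2..<Suc I]" and H: "H \<subseteq># F"
      have "spmf (\<gamma> (s ^ i)) T = (s ^ i) ^ vertices T / A_gf (s ^ i)" if "T \<in># H" for T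
        using i mset_subset_eqD[OF H that] by (intro \<gamma>) auto
      then show "spmf (blk I i) H = (if i < I then exp (- x i) else inverse (exp (x i) - 1)) *
         s ^ forest_size H * (if i < I then block_weight i H else block_weight i H - mset_unit H)"
        using i Apos[of i] unfolding blk_def x_def
        by (auto simp: spmf_block_sampler_poisson spmf_block_sampler_poisson_ge1)
    qed
    also have "map (\<lambda>i. if i < I then exp (- x i) else inverse (exp (x i) - 1)) [2..<Suc I] =
        map (\<lambda>i. exp (- x i)) [2..<I] @ [inverse (exp (x I) - 1)]"
      unfolding up by auto
    also have "map (\<lambda>i H. if i < I then block_weight i H else block_weight i H - mset_unit H) [2..<Suc I] =
        map block_weight [2..<I] @ [\<lambda>H :: ptree multiset. block_weight I H - mset_unit H]"
      unfolding up by auto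
    also have "mset_convs (map block_weight [2..<I] @ [\<lambda>H. block_weight I H - mset_unit H]) F = W (Suc I) - W I"
      using I by (simp add: mset_convs_append_diff mset_convs_append_unit W_def)
    finally show ?thesis by simp
  qed
  have P: "pmf (max_index s) I = inverse (\<Phi> s) * exp (\<Sum>i\<leftarrow>[2..<I]. x i) * (exp (x I) - 1)" if I: "I \<ge> 2" for I
  proof -
    have "{2..I} = insert I {2..I - 1}" using I by auto
    then have "(\<Sum>i = 2..I. x i) = x I + (\<Sum>i = 2..I - 1. x i)" using I by (simp add: sum.insert)
    moreover have "(\<Sum>i\<leftarrow>[2..<I]. x i) = (\<Sum>i = 2..I - 1. x i)"
    proof -
      have "{2..<I} = {2..I - 1}" using I by auto
      then show ?thesis by (simp add: sum_list_distinct_conv_sum_set)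
    qed
    ultimately show ?thesis using s I
      by (simp add: max_index_cdf x_def[symmetric] exp_add algebra_simps)
  qed
  have E: "exp (\<Sum>i\<leftarrow>is. x i) * (\<Prod>i\<leftarrow>is. exp (- x i)) = 1" for "is"
    by (induction "is") (simp_all add: exp_add exp_minus field_simps)
  have summand: "pmf (max_index s) I * spmf (D I) F = s ^ forest_size F / \<Phi> s * (W (Suc I) - W I)" if I: "I \<ge> 2" for I
  proof -
    have ne: "(exp (x I) - 1) * inverse (exp (x I) - 1) = 1" using xpos[OF I] by simp
    have "pmf (max_index s) I * spmf (D I) F = inverse (\<Phi> s) * (exp (\<Sum>i\<leftarrow>[2..<I]. x i) * (\<Prod>i\<leftarrow>[2..<I]. exp (- x i))) *
       ((exp (x I) - 1) * inverse (exp (x I) - 1)) * s ^ forest_size F * (W (Suc I) - W I)"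
      unfolding D[OF I] P[OF I] by (simp only: ac_simps)
    then show ?thesis unfolding E ne by (simp add: field_simps)
  qed
  \<comment> \<open>Indices above \<open>size F\<close> contribute nothing; the two extra values
    keep \<open>0\<close>, \<open>1\<close> and \<open>2\<close> in range even for small
    \<open>F\<close>.\<close>
  define n where "n = Suc (Suc (size F))"
  have W2: "W 2 = mset_unit F" by (simp add: W_def)
  have "spmf (\<Gamma>B_via \<gamma> s) F = (\<Sum>I\<in>{..n}. pmf (max_index s) I * spmf (D I) F)"
  proof -
    have "W (Suc I) - W I = 0" if "I \<notin> {..n}" for I
      using that fixfree_weight_eq[of F "Suc I"] fixfree_weight_eq[of F I] by (simp add: W_def n_def del: upt_Suc)
    then show ?thesis unfolding \<Gamma>B using summand by (subst spmf_bind_sum[of "{..n}"]) (auto simp: n_def)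
  qed
  also have "{..n} = {0, 1} \<union> {2..n}" by (auto simp: n_def)
  also have "(\<Sum>I\<in>{0, 1} \<union> {2..n}. pmf (max_index s) I * spmf (D I) F) =
      (\<Sum>I\<in>{0, 1}. pmf (max_index s) I * spmf (D I) F) + (\<Sum>I\<in>{2..n}. pmf (max_index s) I * spmf (D I) F)"
    by (rule sum.union_disjoint) auto
  also have "(\<Sum>I\<in>{0, 1}. pmf (max_index s) I * spmf (D I) F) = s ^ forest_size F / \<Phi> s * W 2"
    using s by (auto simp: max_index_cdf D_def W2 mset_unit_def divide_inverse)
  also have "(\<Sum>I\<in>{2..n}. pmf (max_index s) I * spmf (D I) F) = s ^ forest_size F / \<Phi> s * (\<Sum>I\<in>{2..n}. W (Suc I) - W I)"
    unfolding sum_distrib_left by (intro sum.cong refl summand) auto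
  also have "(\<Sum>I\<in>{2..n}. W (Suc I) - W I) = W (Suc n) - W 2"
    by (rule sum_Suc_diff) (simp add: n_def)
  also have "W (Suc n) = fixfree_weight F"
    unfolding W_def by (rule fixfree_weight_eq) (simp add: n_def)
  finally show ?thesis by (simp add: algebra_simps diff_divide_distrib)
qed

text \<open>The parameter varies in the induction since \<open>\<Gamma>B\<close> calls
  \<open>\<Gamma>A\<close> at powers of \<open>t\<close>. The constant
  \<open>exp (- A_gf t) / \<Phi> t\<close> equals \<open>t / A_gf t\<close> by the functional
  equation, and its factor \<open>t\<close> accounts for the root.\<close>

lemma spmf_\<Gamma>A:
  assumes "0 < t" "t < \<rho>"
  shows "spmf (\<Gamma>A t) T = t ^ vertices T / A_gf t"
  using assms
proof (induction "vertices T" arbitrary: T t rule: less_induct)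
  case less
  obtain G where T: "T = Join G" by (cases T)
  have small: "vertices U < vertices T" if "U \<in># G" for U
    using vertices_le_forest_size[OF that] by (simp add: T vertices_Join del: vertices.simps)
  have t2: "t ^ 2 < \<rho>" and t1: "t < 1" using square_less_\<rho> less.prems \<rho>_less_1 by auto
  have Apos: "A_gf t > 0" using A_gf_ge[of t] less.prems by simp
  have "\<Gamma>A t = map_spmf Join (bind_spmf (block_sampler 1 (poisson_pmf (A_gf t / real 1)) (\<Gamma>A t))
      (\<lambda>H. bind_spmf (\<Gamma>B_via \<Gamma>A t) (\<lambda>F. return_spmf (H + F))))"
    by (subst \<Gamma>A.simps) (simp add: block_sampler_def map_spmf_bind_spmf o_def del: bind_spmf_of_pmf)
  then have "spmf (\<Gamma>A t) T = spmf (map_spmf Join (bind_spmf (block_sampler 1 (poisson_pmf (A_gf t / real 1)) (\<Gamma>A t))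
      (\<lambda>H. bind_spmf (\<Gamma>B_via \<Gamma>A t) (\<lambda>F. return_spmf (H + F))))) T"
    by (rule arg_cong)
  also have "\<dots> = mset_conv (spmf (block_sampler 1 (poisson_pmf (A_gf t / real 1)) (\<Gamma>A t))) (spmf (\<Gamma>B_via \<Gamma>A t)) G"
    unfolding T by (subst spmf_map_inj') (auto simp: inj_def spmf_bind_plus)
  also have "\<dots> = (\<Sum>H | H \<subseteq># G. t ^ forest_size G * (exp (- A_gf t) / \<Phi> t) * (block_weight 1 H * fixfree_weight (G - H)))"
    unfolding mset_conv_def
  proof (intro sum.cong refl)
    fix H assume "H \<in> {H. H \<subseteq># G}"
    then have H: "H \<subseteq># G" by simp
    have "spmf (block_sampler 1 (poisson_pmf (A_gf t / real 1)) (\<Gamma>A t)) H =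
      exp (- (A_gf t / real 1)) * t ^ forest_size H * block_weight 1 H"
    proof (rule spmf_block_sampler_poisson)
      fix U assume "U \<in># H"
      then have "U \<in># G" using H by (rule mset_subset_eqD[rotated])
      then show "spmf (\<Gamma>A t) U = (t ^ 1) ^ vertices U / A_gf t"
        using less.hyps[OF small less.prems] by simp
    qed (use Apos in auto)
    moreover have "spmf (\<Gamma>B_via \<Gamma>A t) (G - H) = t ^ forest_size (G - H) * fixfree_weight (G - H) / \<Phi> t"
    proof (rule spmf_\<Gamma>B_via)
      fix i U assume i: "i \<ge> (2::nat)" and "U \<in># G - H"
      then have "U \<in># G" by (meson in_diffD)
      moreover have "t ^ i \<le> t ^ 2" using i less.prems t1 by (intro power_decreasing) auto
      ultimately show "spmf (\<Gamma>A (t ^ i)) U = (t ^ i) ^ vertices U / A_gf (t ^ i)"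
        using less.prems t2 by (intro less.hyps small) auto
    qed (use less.prems t2 in auto)
    moreover have "t ^ forest_size G = t ^ forest_size H * t ^ forest_size (G - H)"
      by (simp add: power_add[symmetric] forest_size_diff[OF H])
    ultimately show "spmf (block_sampler 1 (poisson_pmf (A_gf t / real 1)) (\<Gamma>A t)) H * spmf (\<Gamma>B_via \<Gamma>A t) (G - H) =
      t ^ forest_size G * (exp (- A_gf t) / \<Phi> t) * (block_weight 1 H * fixfree_weight (G - H))"
      by simp
  qed
  also have "\<dots> = t ^ forest_size G * (exp (- A_gf t) / \<Phi> t)"
    using mset_conv_fixfree_weight[of G] by (simp only: mset_conv_def sum_distrib_left[symmetric] mult_1_right)
  also have "exp (- A_gf t) / \<Phi> t = t / A_gf t"
  proof -
    have "\<Phi> t > 0" by (simp add: \<Phi>_def)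
    then show ?thesis
      using A_functional_equation[OF less.prems] Apos by (simp add: exp_minus field_simps)
  qed
  finally show ?case by (simp add: T vertices_Join del: vertices.simps)
qed

text \<open>Termination is read off from the law: the trees with at most \<open>n\<close> vertices
  have total probability \<open>A_trunc n t / A_gf t\<close>, which tends to 1.\<close>

lemma lossless_\<Gamma>A:
  assumes "0 < t" "t < \<rho>"
  shows "lossless_spmf (\<Gamma>A t)"
proof -
  have Apos: "A_gf t > 0" using A_gf_ge[of t] assms by simp
  have le: "A_trunc n t / A_gf t \<le> weight_spmf (\<Gamma>A t)" for n
    using sum_spmf_le_weight[OF finite_trees_le, of "\<Gamma>A t" n] assms
    by (simp add: A_trunc_eq spmf_\<Gamma>A sum_divide_distrib)
  have "(\<lambda>n. A_trunc n t / A_gf t) \<longlonglongrightarrow> A_gf t / A_gf t"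
    using assms Apos by (intro tendsto_divide A_trunc_tendsto tendsto_const) auto
  then have "A_gf t / A_gf t \<le> weight_spmf (\<Gamma>A t)"
    by (rule LIMSEQ_le_const2) (use le in blast)
  then show ?thesis using Apos weight_spmf_le_1[of "\<Gamma>A t"] by (simp add: lossless_spmf_def)
qed

lemma
  assumes "0 < s" "s ^ 2 < \<rho>"
  shows spmf_\<Gamma>B: "spmf (\<Gamma>B s) F = s ^ forest_size F * fixfree_weight F / \<Phi> s"
    and lossless_\<Gamma>B: "lossless_spmf (\<Gamma>B s)"
proof -
  have pow: "0 < s ^ i" "s ^ i < \<rho>" if "i \<ge> 2" for i
  proof -
    have "s ^ i \<le> s ^ 2"
      using that assms less_1_if_square_less_\<rho>[OF assms(2)] by (intro power_decreasing) auto
    then show "s ^ i < \<rho>" using assms by linarith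
  qed (use assms in simp)
  show "spmf (\<Gamma>B s) F = s ^ forest_size F * fixfree_weight F / \<Phi> s"
    unfolding \<Gamma>B_def using assms pow by (intro spmf_\<Gamma>B_via spmf_\<Gamma>A) auto
  show "lossless_spmf (\<Gamma>B s)"
    unfolding \<Gamma>B_def \<Gamma>B_via_def
    using pow by (auto intro!: lossless_sample_all lossless_iid lossless_\<Gamma>A)
qed

section \<open>Sampler Q\<close>

text \<open>The outcome \<open>None\<close> of \<open>p\<close> means a rejected round, whereas
  \<open>pmf L None\<close> is the probability of nontermination. As rejection has probability below
  1, the loop equation can be solved for both the law and the missing mass.\<close>

lemma spmf_rejection_loop:
  fixes p :: "'a option spmf"
  assumes L: "L = bind_spmf p (\<lambda>x. case x of None \<Rightarrow> L | Some y \<Rightarrow> return_spmf y)"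
    and p: "lossless_spmf p" "spmf p None < 1"
  shows "spmf L y = spmf p (Some y) / (1 - spmf p None)" and "lossless_spmf L"
proof -
  let ?f = "\<lambda>x. case x of None \<Rightarrow> L | Some y \<Rightarrow> return_spmf y"
  have "spmf L y = (\<Sum>x\<in>{None, Some y}. spmf p x * spmf (?f x) y)"
    by (subst L, subst spmf_bind_sum[of "{None, Some y}"]) (auto split: option.splits)
  also have "\<dots> = spmf p None * spmf L y + spmf p (Some y)"
    by simp
  finally show "spmf L y = spmf p (Some y) / (1 - spmf p None)"
    using p(2) by (simp add: field_simps)
  have "pmf L None = pmf p None + (\<integral>x. pmf (?f x) None \<partial>measure_spmf p)"
    by (subst L) (rule pmf_bind_spmf_None)
  also have "(\<lambda>x. pmf (?f x) None) = (\<lambda>x. indicator {None} x * pmf L None)"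
    by (auto simp: fun_eq_iff split: option.splits)
  also have "(\<integral>x. indicator {None} x * pmf L None \<partial>measure_spmf p) = spmf p None * pmf L None"
    by (simp add: spmf_conv_measure_spmf del: pmf_None_eq_weight_spmf)
  finally have "(1 - spmf p None) * pmf L None = 0"
    using p(1) by (simp add: lossless_iff_pmf_None algebra_simps)
  then show "lossless_spmf L" using p(2) by (simp add: lossless_iff_pmf_None)
qed

lemma forest_size_eq_0: "forest_size F = 0 \<longleftrightarrow> F = {#}"
  using size_le_forest_size[of F] by auto

definition proper :: "triple \<Rightarrow> bool" where
  "proper t \<longleftrightarrow> fst (snd t) = forest_size (snd (snd t))"

text \<open>The upper bound keeps both tilted arguments below \<open>sqrt \<rho>\<close>, where
  \<open>\<Phi>\<close> is finite; positivity is for the comparison of hyperbolic cosines.\<close>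

locale tilt =
  fixes lam :: real
  assumes lam: "0 < lam" "lam \<le> 1/4 * ln (1 / \<rho>)"
begin

abbreviation "B \<equiv> B_par lam"

definition tilted :: "real \<Rightarrow> real" where
  "tilted \<sigma> = \<rho> * exp (\<sigma> * lam)"

text \<open>The factor \<open>1/4\<close> yields \<open>exp (4 * lam) \<le> 1 / \<rho>\<close>, so
  the square of a tilted argument is at most \<open>\<rho>\<close> to the power
  \<open>3/2\<close>.\<close>

lemma tilted:
  assumes "\<sigma> \<in> {1, -1}"
  shows "0 < tilted \<sigma>" "(tilted \<sigma>)\<^sup>2 < \<rho>"
proof -
  show "0 < tilted \<sigma>" using \<rho>_pos by (simp add: tilted_def)
  define q where "q = exp (2 * lam)"
  have "q ^ 2 = exp (4 * lam)" by (simp add: q_def power2_eq_square exp_add[symmetric])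
  also have "\<dots> \<le> exp (ln (1 / \<rho>))" using lam by simp
  also have "\<dots> = 1 / \<rho>" using \<rho>_pos by simp
  finally have "\<rho> ^ 2 * q ^ 2 \<le> \<rho> ^ 2 * (1 / \<rho>)" by (intro mult_left_mono) auto
  then have "(\<rho> * q) ^ 2 \<le> \<rho>" using \<rho>_pos by (simp add: power_mult_distrib power2_eq_square mult.left_commute)
  then have "(\<rho> * q) ^ 2 < 1 ^ 2" using \<rho>_less_1 by simp
  then have "\<rho> * q < 1" by (rule power2_less_imp_less) simp
  have "(tilted \<sigma>)\<^sup>2 = \<rho>\<^sup>2 * exp (2 * (\<sigma> * lam))"
    by (simp add: tilted_def power_mult_distrib power2_eq_square exp_add[symmetric])
  also have "\<dots> \<le> \<rho>\<^sup>2 * q"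
    unfolding q_def using assms lam by (intro mult_left_mono) auto
  also have "\<dots> = \<rho> * (\<rho> * q)" by (simp add: power2_eq_square)
  also have "\<dots> < \<rho> * 1" using \<rho>_pos \<open>\<rho> * q < 1\<close> by (intro mult_strict_left_mono)
  finally show "(tilted \<sigma>)\<^sup>2 < \<rho>" by simp
qed

lemma exp_\<Phi>_tilted_gt_1:
  assumes "\<sigma> \<in> {1, -1}"
  shows "exp (exp (\<sigma> * lam)) * \<Phi> (tilted \<sigma>) > 1"
proof -
  have "1 < exp (exp (\<sigma> * lam))" by simp
  also have "\<dots> * 1 \<le> exp (exp (\<sigma> * lam)) * \<Phi> (tilted \<sigma>)"
    using \<Phi>_ge_1[of "tilted \<sigma>"] tilted[OF assms] by (intro mult_left_mono) auto
  finally show ?thesis by simp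
qed

text \<open>Here \<open>\<rho> * \<Phi> \<rho> = exp (- 1)\<close> enters. The probability of
  drawing \<open>(0, 0)\<close> is the inverse of
  \<open>exp (exp (\<sigma> * lam)) * \<Phi> (tilted \<sigma>)\<close>, so \<open>C_par\<close> is
  \<open>\<rho>\<close> times the odds against it.\<close>

lemma C_par_eq: "C_par lam \<sigma> = \<rho> * (exp (exp (\<sigma> * lam)) * \<Phi> (tilted \<sigma>) - 1)"
proof -
  have \<Phi>0: "\<Phi> \<rho> > 0" by (simp add: \<Phi>_def)
  have "exp (exp (\<sigma> * lam) - 1) = exp (exp (\<sigma> * lam)) * (\<rho> * \<Phi> \<rho>)"
    by (simp add: \<rho>_\<Phi>_\<rho> exp_add[symmetric])
  then show ?thesis using \<Phi>0 by (simp add: C_par_def tilted_def field_simps)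
qed

lemma C_par_pos: "\<sigma> \<in> {1, -1} \<Longrightarrow> C_par lam \<sigma> > 0"
  unfolding C_par_eq using exp_\<Phi>_tilted_gt_1[of \<sigma>] \<rho>_pos by auto

lemma B_pos: "B > 0"
  using C_par_pos[of 1] C_par_pos[of "-1"] by (simp add: B_par_def)

text \<open>\<open>C_par\<close> clears the normalisation of the rejection loop. What remains
  depends on the sign only through the tilts of the Poisson variable and of the forest, which merge
  into one power with exponent \<open>x + y\<close>.\<close>

lemma
  assumes \<sigma>: "\<sigma> \<in> {1, -1}"
  shows spmf_sample_nonzero: "C_par lam \<sigma> * spmf (sample_nonzero lam \<sigma>) (x, y, f) =
      (if y = forest_size f \<and> x + y \<noteq> 0
       then \<rho> ^ Suc y * fixfree_weight f / fact x * exp (\<sigma> * lam * real (x + y)) else 0)"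
    and lossless_sample_nonzero: "lossless_spmf (sample_nonzero lam \<sigma>)"
proof -
  define E where "E = exp (\<sigma> * lam)"
  let ?s = "tilted \<sigma>"
  note s = tilted[OF \<sigma>]
  have E0: "E > 0" by (simp add: E_def)
  have \<Phi>0: "\<Phi> ?s > 0" by (simp add: \<Phi>_def)
  define g where "g = (\<lambda>X F. if (X, forest_size F) = (0 :: nat, 0) then None else Some (X, forest_size F, F))"
  define p where "p = bind_spmf (spmf_of_pmf (poisson_pmf E)) (\<lambda>X. bind_spmf (\<Gamma>B ?s) (\<lambda>F. return_spmf (g X F)))"
  have loop: "sample_nonzero lam \<sigma> = bind_spmf p (\<lambda>x. case x of None \<Rightarrow> sample_nonzero lam \<sigma> | Some y \<Rightarrow> return_spmf y)"
    unfolding p_def bind_spmf_assoc return_bind_spmf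
    by (subst sample_nonzero.simps, unfold Let_def E_def tilted_def)
       (intro bind_spmf_cong refl, auto simp: g_def)
  have lp: "lossless_spmf p"
    unfolding p_def using lossless_\<Gamma>B[OF s] by simp
  have None: "spmf p None = exp (- E) / \<Phi> ?s"
  proof -
    have inner: "spmf (bind_spmf (\<Gamma>B ?s) (\<lambda>F. return_spmf (g X F))) None = (if X = 0 then spmf (\<Gamma>B ?s) {#} else 0)" for X
      by (auto simp: g_def forest_size_eq_0 split: if_splits intro!: spmf_bind_return_none spmf_bind_return_unique)
    show ?thesis unfolding p_def
      using E0 by (subst spmf_bind_sum[of "{0}"]) (auto simp: inner spmf_\<Gamma>B[OF s])
  qed
  have Some: "spmf p (Some (x, y, f)) = (if y = forest_size f \<and> x + y \<noteq> 0
     then pmf (poisson_pmf E) x * spmf (\<Gamma>B ?s) f else 0)"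
  proof -
    have inner: "spmf (bind_spmf (\<Gamma>B ?s) (\<lambda>F. return_spmf (g X F))) (Some (x, y, f)) =
       (if X = x \<and> y = forest_size f \<and> x + y \<noteq> 0 then spmf (\<Gamma>B ?s) f else 0)" for X
    proof (cases "X = x \<and> y = forest_size f \<and> x + y \<noteq> 0")
      case True
      then have "spmf (bind_spmf (\<Gamma>B ?s) (\<lambda>F. return_spmf (g X F))) (Some (x, y, f)) = spmf (\<Gamma>B ?s) f"
        by (intro spmf_bind_return_unique) (auto simp: g_def split: if_splits)
      then show ?thesis using True by auto
    next
      case False
      then have "g X F \<noteq> Some (x, y, f)" for F by (auto simp: g_def split: if_splits)
      then have "spmf (bind_spmf (\<Gamma>B ?s) (\<lambda>F. return_spmf (g X F))) (Some (x, y, f)) = 0"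
        by (intro spmf_bind_return_none)
      then show ?thesis using False by (simp only: if_False)
    qed
    show ?thesis unfolding p_def by (subst spmf_bind_sum[of "{x}"]) (auto simp: inner)
  qed
  have gt: "exp E * \<Phi> ?s > 1" using exp_\<Phi>_tilted_gt_1[OF \<sigma>] by (simp add: E_def)
  have lt: "spmf p None < 1"
    unfolding None using gt \<Phi>0 by (simp add: exp_minus field_simps)
  note res = spmf_rejection_loop[OF loop lp lt]
  show "lossless_spmf (sample_nonzero lam \<sigma>)" by (rule res(2))
  have norm: "C_par lam \<sigma> * (exp (- E) / \<Phi> ?s / (1 - exp (- E) / \<Phi> ?s)) = \<rho>"
  proof -
    have "exp (- E) / \<Phi> ?s / (1 - exp (- E) / \<Phi> ?s) = 1 / (exp E * \<Phi> ?s - 1)"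
      using gt \<Phi>0 by (simp add: exp_minus divide_simps)
    then show ?thesis using gt by (simp add: C_par_eq E_def)
  qed
  show "C_par lam \<sigma> * spmf (sample_nonzero lam \<sigma>) (x, y, f) =
      (if y = forest_size f \<and> x + y \<noteq> 0
       then \<rho> ^ Suc y * fixfree_weight f / fact x * exp (\<sigma> * lam * real (x + y)) else 0)"
  proof (cases "y = forest_size f \<and> x + y \<noteq> 0")
    case True
    have "C_par lam \<sigma> * spmf (sample_nonzero lam \<sigma>) (x, y, f) =
       C_par lam \<sigma> * (exp (- E) / \<Phi> ?s / (1 - exp (- E) / \<Phi> ?s)) * (E ^ x / fact x * (?s ^ y * fixfree_weight f))"
      unfolding res(1) Some None if_P[OF True] using E0 True by (simp add: spmf_\<Gamma>B[OF s] ac_simps)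
    also have "\<dots> = \<rho> * (E ^ x / fact x * (?s ^ y * fixfree_weight f))"
      unfolding norm ..
    also have "?s ^ y = \<rho> ^ y * E ^ y" by (simp add: tilted_def E_def power_mult_distrib)
    also have "\<rho> * (E ^ x / fact x * (\<rho> ^ y * E ^ y * fixfree_weight f)) = \<rho> ^ Suc y * fixfree_weight f / fact x * E ^ (x + y)"
      by (simp add: power_add)
    also have "E ^ (x + y) = exp (\<sigma> * lam * real (x + y))"
      unfolding E_def by (simp only: exp_of_nat_mult[symmetric] mult.commute)
    finally show ?thesis unfolding if_P[OF True] .
  next
    case False
    then show ?thesis unfolding res(1) Some if_not_P[OF False] by simp
  qed
qed

text \<open>The sign is drawn with probability proportional to \<open>C_par\<close>, the very factor
  in \<open>spmf_sample_nonzero\<close>. The two exponentials add up to \<open>2 * cosh\<close>, and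
  the two constants to \<open>2 * B\<close>.\<close>

lemma spmf_sampler_Q:
  "spmf (sampler_Q lam) (x, y, f) = (if y = forest_size f \<and> x + y \<noteq> 0
     then \<rho> ^ Suc y * fixfree_weight f / (B * fact x) * cosh (lam * real (x + y)) else 0)"
proof -
  define Cs where "Cs = C_par lam 1 + C_par lam (-1)"
  have Cs: "Cs > 0" "C_par lam 1 > 0" "C_par lam (-1) > 0" using C_par_pos[of 1] C_par_pos[of "-1"] by (auto simp: Cs_def)
  define pr where "pr = C_par lam 1 / Cs"
  have pr: "0 \<le> pr" "pr \<le> 1" using Cs by (auto simp: pr_def Cs_def)
  have pr1: "1 - pr = C_par lam (-1) / Cs" using Cs by (simp add: pr_def Cs_def field_simps)
  have "spmf (sampler_Q lam) (x, y, f) = (\<Sum>b\<in>UNIV. pmf (bernoulli_pmf pr) b * spmf (sample_nonzero lam (if b then 1 else -1)) (x, y, f))"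
    unfolding sampler_Q_def Cs_def[symmetric] pr_def[symmetric]
    by (subst spmf_bind_sum[of UNIV]) auto
  also have "\<dots> = (C_par lam 1 * spmf (sample_nonzero lam 1) (x, y, f) + C_par lam (-1) * spmf (sample_nonzero lam (-1)) (x, y, f)) / Cs"
    using pr pr1 by (simp add: UNIV_bool pr_def add_divide_distrib)
  also have "\<dots> = (if y = forest_size f \<and> x + y \<noteq> 0
     then \<rho> ^ Suc y * fixfree_weight f / fact x * (exp (lam * real (x + y)) + exp (- (lam * real (x + y)))) / Cs else 0)"
    using spmf_sample_nonzero[of 1 x y f] spmf_sample_nonzero[of "-1" x y f]
    by (auto simp: distrib_left)
  also have "exp (lam * real (x + y)) + exp (- (lam * real (x + y))) = 2 * cosh (lam * real (x + y))"
    by (simp add: cosh_def)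
  also have "\<rho> ^ Suc y * fixfree_weight f / fact x * (2 * cosh (lam * real (x + y))) / Cs =
      \<rho> ^ Suc y * fixfree_weight f / (B * fact x) * cosh (lam * real (x + y))"
    by (simp add: Cs_def B_par_def mult.commute mult.left_commute)
  finally show ?thesis .
qed

lemma lossless_sampler_Q: "lossless_spmf (sampler_Q lam)"
  unfolding sampler_Q_def using lossless_sample_nonzero[of 1] lossless_sample_nonzero[of "-1"] by auto

lemma set_sampler_Q: "t \<in> set_spmf (sampler_Q lam) \<Longrightarrow> proper t \<and> increment t > 0"
  by (cases t) (auto simp: spmf_sampler_Q proper_def in_set_spmf_iff_spmf split: if_splits)

text \<open>Since \<open>(0, 0)\<close> is excluded, the distance to \<open>N\<close> drops at every
  step; this drives the induction and forces termination.\<close>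

lemma sample_walk_support:
  "lossless_spmf (sample_walk N lam ts) \<and>
   set_spmf (sample_walk N lam ts) \<subseteq> {ts @ us | us. (\<forall>t\<in>set us. proper t \<and> increment t > 0) \<and>
     N \<le> sum_list (map increment (ts @ us))}"
proof (induction "N - sum_list (map increment ts)" arbitrary: ts rule: less_induct)
  case less
  show ?case
  proof (cases "sum_list (map increment ts) \<ge> N")
    case True
    then show ?thesis by (subst (1 2) sample_walk.simps) auto
  next
    case False
    have IH: "lossless_spmf (sample_walk N lam (ts @ [t])) \<and>
      set_spmf (sample_walk N lam (ts @ [t])) \<subseteq> {(ts @ [t]) @ us | us. (\<forall>t\<in>set us. proper t \<and> increment t > 0) \<and>
     N \<le> sum_list (map increment ((ts @ [t]) @ us))}" if "t \<in> set_spmf (sampler_Q lam)" for t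
      using set_sampler_Q[OF that] False by (intro less) auto
    have eq: "sample_walk N lam ts = bind_spmf (sampler_Q lam) (\<lambda>t. sample_walk N lam (ts @ [t]))"
      using False by (subst sample_walk.simps) simp
    have "lossless_spmf (sample_walk N lam ts)"
      unfolding eq using lossless_sampler_Q IH by simp
    moreover have "ws \<in> {ts @ us | us. (\<forall>t\<in>set us. proper t \<and> increment t > 0) \<and>
     N \<le> sum_list (map increment (ts @ us))}" if ws: "ws \<in> set_spmf (sample_walk N lam ts)" for ws
    proof -
      obtain t where t: "t \<in> set_spmf (sampler_Q lam)" "ws \<in> set_spmf (sample_walk N lam (ts @ [t]))"
        using ws unfolding eq by (auto simp: set_bind_spmf)
      then obtain us where "ws = (ts @ [t]) @ us" "\<forall>t\<in>set us. proper t \<and> increment t > 0"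
          "N \<le> sum_list (map increment ((ts @ [t]) @ us))"
        using IH[OF t(1)] by blast
      then show ?thesis using set_sampler_Q[OF t(1)]
        by (intro CollectI exI[of _ "t # us"]) auto
    qed
    ultimately show ?thesis by blast
  qed
qed

text \<open>All increments are positive and the sum hits \<open>N\<close> exactly, so the walk
  cannot have stopped at a proper prefix.\<close>

lemma spmf_sample_walk:
  assumes "sum_list (map increment (ts @ us)) = N" "\<forall>t\<in>set us. increment t > 0"
  shows "spmf (sample_walk N lam ts) (ts @ us) = (\<Prod>t\<leftarrow>us. spmf (sampler_Q lam) t)"
  using assms
proof (induction us arbitrary: ts)
  case Nil
  then show ?case by (subst sample_walk.simps) simp
next
  case (Cons t us)
  have eq: "sample_walk N lam ts = bind_spmf (sampler_Q lam) (\<lambda>t. sample_walk N lam (ts @ [t]))"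
    using Cons.prems by (subst sample_walk.simps) auto
  have other: "spmf (sample_walk N lam (ts @ [t'])) (ts @ t # us) = 0" if "t' \<noteq> t" for t'
    using sample_walk_support[of N "ts @ [t']"] that by (auto simp: spmf_eq_0_set_spmf)
  have "spmf (sample_walk N lam (ts @ [t])) ((ts @ [t]) @ us) = (\<Prod>t\<leftarrow>us. spmf (sampler_Q lam) t)"
    using Cons.prems by (intro Cons.IH) auto
  then show ?case unfolding eq
    by (subst spmf_bind_sum[of "{t}"]) (auto simp: other)
qed

end

section \<open>Log-convexity of cosh and the bound behind the acceptance test\<close>

text \<open>Log-convexity along multiples of \<open>l\<close>: by the addition theorems the
  difference of the two sides is \<open>sinh l * sinh (l * (y' - y))\<close>.\<close>

lemma cosh_ratio_mono:
  fixes l :: real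
  assumes "l > 0" "y \<le> y'"
  shows "cosh (l * real y') * cosh (l * real (Suc y)) \<le> cosh (l * real (Suc y')) * cosh (l * real y)"
proof -
  have split: "cosh (l * real (Suc z)) = cosh (l * real z) * cosh l + sinh (l * real z) * sinh l" for z
    by (simp add: cosh_add[symmetric] algebra_simps)
  have "cosh (l * real (Suc y')) * cosh (l * real y) - cosh (l * real y') * cosh (l * real (Suc y)) =
      sinh l * sinh (l * real y' - l * real y)"
    unfolding split sinh_diff by (simp add: algebra_simps)
  also have "\<dots> \<ge> 0" using assms by (intro mult_nonneg_nonneg) auto
  finally show ?thesis by simp
qed

text \<open>After taking logarithms: the line through the points of \<open>ln cosh\<close> at the
  neighbouring integers \<open>c\<close> and \<open>c + 1\<close> lies below the function at every
  integer, since no integer lies strictly between them.\<close>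

lemma cosh_chord:
  fixes l :: real and c :: nat
  assumes "l > 0"
  defines "q \<equiv> cosh (l * real (Suc c)) / cosh (l * real c)"
  shows "cosh (l * real c) * q ^ x \<le> cosh (l * real x) * q ^ c"
proof -
  have q0: "q > 0" by (simp add: q_def)
  show ?thesis
  proof (cases "c \<le> x")
    case True
    then show ?thesis
    proof (induction x rule: dec_induct)
      case (step x)
      have "cosh (l * real c) * q ^ Suc x \<le> (cosh (l * real x) * q ^ c) * q"
        using step.IH q0 by (simp add: mult.assoc[symmetric])
      also have "\<dots> = q ^ c * (cosh (l * real x) * q)" by simp
      also have "cosh (l * real x) * q \<le> cosh (l * real (Suc x))"
        using cosh_ratio_mono[OF assms(1) step.hyps(1)] by (simp add: q_def field_simps)
      finally show ?case using q0 by (simp add: mult.commute)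
    qed simp
  next
    case False
    then have "x \<le> c" by simp
    then show ?thesis
    proof (induction x rule: inc_induct)
      case (step x)
      have "(cosh (l * real c) * q ^ x) * q \<le> q ^ c * cosh (l * real (Suc x))"
        using step.IH by (simp add: mult.commute mult.left_commute)
      also have "cosh (l * real (Suc x)) \<le> cosh (l * real x) * q"
        using cosh_ratio_mono[OF assms(1), of x c] step.hyps by (simp add: q_def field_simps)
      finally have "(cosh (l * real c) * q ^ x) * q \<le> (cosh (l * real x) * q ^ c) * q"
        using q0 by (simp add: mult.commute mult.left_commute)
      then show ?case using q0 by simp
    qed simp
  qed
qed

text \<open>For given length and sum, the product of the \<open>cosh\<close> values is smallest when
  the entries are as equal as possible; \<open>D_par\<close> is the inverse of that value. The chord
  inequalities for one common \<open>c\<close> are multiplied, and as the sum is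
  \<open>k * c + r\<close>, the power \<open>q ^ r\<close> survives.\<close>

lemma prod_inverse_cosh_le_D_par:
  fixes l :: real
  assumes "l > 0" "xs \<noteq> []"
  shows "(\<Prod>x\<leftarrow>xs. inverse (cosh (l * real x))) \<le> D_par (sum_list xs) l (length xs)"
proof -
  define k c r where "k = length xs" and "c = sum_list xs div k" and "r = sum_list xs - k * c"
  define q where "q = cosh (l * real (Suc c)) / cosh (l * real c)"
  have q0: "q > 0" by (simp add: q_def)
  have k0: "k > 0" using assms by (simp add: k_def)
  have N: "sum_list xs = k * c + r" by (simp add: r_def c_def)
  have "r = sum_list xs mod k" by (simp add: r_def c_def minus_mult_div_eq_mod)
  then have rk: "r \<le> k" using k0 by (simp add: less_imp_le)
  have "cosh (l * real c) ^ length ys * q ^ sum_list ys \<le> (\<Prod>x\<leftarrow>ys. cosh (l * real x)) * q ^ (length ys * c)" for ys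
  proof (induction ys)
    case (Cons y ys)
    have "(cosh (l * real c) * q ^ y) * (cosh (l * real c) ^ length ys * q ^ sum_list ys) \<le>
       (cosh (l * real y) * q ^ c) * ((\<Prod>x\<leftarrow>ys. cosh (l * real x)) * q ^ (length ys * c))"
      using q0
      by (intro mult_mono[OF cosh_chord[OF assms(1), of c y, folded q_def] Cons.IH]) auto
    then show ?case by (simp add: power_add algebra_simps)
  qed simp
  from this[of xs] have "cosh (l * real c) ^ k * q ^ r * q ^ (k * c) \<le> (\<Prod>x\<leftarrow>xs. cosh (l * real x)) * q ^ (k * c)"
    by (simp add: N k_def[symmetric] power_add algebra_simps)
  then have "cosh (l * real c) ^ k * q ^ r \<le> (\<Prod>x\<leftarrow>xs. cosh (l * real x))"
    using q0 by simp
  moreover have "cosh (l * real c) ^ k * q ^ r = cosh (l * real c) ^ (k - r) * cosh (l * real (Suc c)) ^ r"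
  proof -
    have "cosh (l * real c) ^ k = cosh (l * real c) ^ (k - r) * cosh (l * real c) ^ r"
      using rk by (simp add: power_add[symmetric])
    then show ?thesis by (simp add: q_def power_divide)
  qed
  ultimately have "inverse (\<Prod>x\<leftarrow>xs. cosh (l * real x)) \<le> inverse (cosh (l * real c) ^ (k - r) * cosh (l * real (Suc c)) ^ r)"
    by (intro le_imp_inverse_le) auto
  also have "\<dots> = D_par (sum_list xs) l k"
    by (simp add: D_par_def Let_def c_def[symmetric] r_def[symmetric])
  also have "inverse (\<Prod>x\<leftarrow>xs. cosh (l * real x)) = (\<Prod>x\<leftarrow>xs. inverse (cosh (l * real x)))"
    by (induction xs) simp_all
  finally show ?thesis by (simp add: k_def)
qed

section \<open>Insertion of zero triples\<close>

abbreviation "zero_triple \<equiv> (0, 0, {#}) :: triple"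

lemma insert_at_Suc:
  "insert_at (Suc L) P ts = insert_at L P ts @ [if Suc L \<in> P then ts ! card {i \<in> P. i < Suc L} else zero_triple]"
  by (simp add: insert_at_def)

lemma length_insert_at [simp]: "length (insert_at L P ts) = L"
  by (simp add: insert_at_def)

lemma card_below_less:
  assumes "finite P" "j \<in> P"
  shows "card {i \<in> P. i < (j :: nat)} < card P"
  using assms by (intro psubset_card_mono) auto

lemma insert_at_remove:
  assumes "P \<subseteq> {1..Suc L}" "Suc L \<in> P" "card P = length (ts @ [t])"
  shows "insert_at (Suc L) P (ts @ [t]) = insert_at L (P - {Suc L}) ts @ [t]"
proof -
  have fin: "finite P" using assms(1) finite_subset by blast
  have below: "{i \<in> P. i < Suc L} = P - {Suc L}" using assms(1) by auto
  have "insert_at L P (ts @ [t]) = insert_at L (P - {Suc L}) ts"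
    unfolding insert_at_def
  proof (intro map_cong refl, goal_cases)
    case (1 j)
    then have j: "j \<le> L" by auto
    have "{i \<in> P. i < j} = {i \<in> P - {Suc L}. i < j}" using j by auto
    moreover have "card {i \<in> P - {Suc L}. i < j} < length ts" if "j \<in> P"
      using card_below_less[of "P - {Suc L}" j] fin that j assms by simp
    ultimately show ?case using j by (auto simp: nth_append)
  qed
  moreover have "card {i \<in> P. i < Suc L} = length ts"
    unfolding below using assms fin by simp
  ultimately show ?thesis using assms(2) by (simp add: insert_at_Suc)
qed

text \<open>Inserted triples have increment 0 and sampled ones do not, so the output reveals the
  sampled list and, by \<open>insert_at_mem\<close>, the chosen positions.\<close>

lemma filter_insert_at:
  assumes "P \<subseteq> {1..L}" "card P = length ts" "\<forall>t\<in>set ts. increment t > 0"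
  shows "filter (\<lambda>t. increment t > 0) (insert_at L P ts) = ts"
  using assms
proof (induction L arbitrary: P ts)
  case 0
  then show ?case by (auto simp: insert_at_def)
next
  case (Suc L)
  show ?case
  proof (cases "Suc L \<in> P")
    case True
    have fin: "finite P" using Suc.prems(1) finite_subset by blast
    then have "ts \<noteq> []" using True Suc.prems(2) by auto
    then obtain us t where ts: "ts = us @ [t]" by (metis append_butlast_last_id)
    have "filter (\<lambda>t. increment t > 0) (insert_at L (P - {Suc L}) us) = us"
      using Suc.prems True fin by (intro Suc.IH) (auto simp: ts)
    then show ?thesis using Suc.prems True unfolding ts
      by (subst insert_at_remove) auto
  next
    case False
    then have "P \<subseteq> {1..L}" using Suc.prems(1) by (auto simp: le_Suc_eq)
    then show ?thesis using Suc False by (simp add: insert_at_Suc)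
  qed
qed

lemma insert_at_mem:
  assumes "P \<subseteq> {1..L}" "card P = length ts" "j \<in> {1..L}" "\<forall>t\<in>set ts. increment t > 0"
  shows "increment (insert_at L P ts ! (j - 1)) > 0 \<longleftrightarrow> j \<in> P"
proof -
  have "finite P" using assms(1) finite_subset by blast
  then have "card {i \<in> P. i < j} < length ts" if "j \<in> P" using card_below_less[of P j] that assms by simp
  moreover have "insert_at L P ts ! (j - 1) = (if j \<in> P then ts ! card {i \<in> P. i < j} else zero_triple)"
  proof -
    have "[1..<Suc L] ! (j - 1) = j" "j - 1 < length [1..<Suc L]"
      using assms(3) by (auto simp: nth_upt simp del: upt_Suc)
    then show ?thesis unfolding insert_at_def by (subst nth_map) simp_all
  qed
  ultimately show ?thesis using assms(4) by auto
qed

definition nonzero_positions :: "triple list \<Rightarrow> nat set" where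
  "nonzero_positions xs = {j \<in> {1..length xs}. increment (xs ! (j - 1)) > 0}"

lemma nonzero_positions_snoc:
  "nonzero_positions (xs @ [t]) = (if increment t > 0 then insert (Suc (length xs)) (nonzero_positions xs) else nonzero_positions xs)"
  by (auto simp: nonzero_positions_def nth_append le_Suc_eq)

lemma nonzero_positions_subset: "nonzero_positions xs \<subseteq> {1..length xs}"
  by (auto simp: nonzero_positions_def)

lemma card_nonzero_positions: "card (nonzero_positions xs) = length (filter (\<lambda>t. increment t > 0) xs)"
proof (induction xs rule: rev_induct)
  case (snoc t xs)
  have "Suc (length xs) \<notin> nonzero_positions xs" "finite (nonzero_positions xs)"
    by (auto simp: nonzero_positions_def)
  then show ?case using snoc by (simp add: nonzero_positions_snoc)
qed (simp add: nonzero_positions_def)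

lemma insert_at_nonzero_positions:
  assumes "\<And>t. t \<in> set xs \<Longrightarrow> increment t = 0 \<Longrightarrow> t = zero_triple"
  shows "insert_at (length xs) (nonzero_positions xs) (filter (\<lambda>t. increment t > 0) xs) = xs"
  using assms
proof (induction xs rule: rev_induct)
  case Nil
  then show ?case by (simp add: insert_at_def)
next
  case (snoc t xs)
  have out: "Suc (length xs) \<notin> nonzero_positions xs" by (auto simp: nonzero_positions_def)
  have fin: "finite (nonzero_positions xs)" by (auto simp: nonzero_positions_def)
  have IH: "insert_at (length xs) (nonzero_positions xs) (filter (\<lambda>t. increment t > 0) xs) = xs"
    using snoc by simp
  show ?case
  proof (cases "increment t > 0")
    case True
    then show ?thesis using nonzero_positions_subset[of xs] out IH fin
      by (simp add: nonzero_positions_snoc card_nonzero_positions, subst insert_at_remove)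
         (auto simp: card_nonzero_positions)
  next
    case False
    then show ?thesis using out IH snoc.prems[of t] by (simp add: nonzero_positions_snoc insert_at_Suc)
  qed
qed

section \<open>The bridge sampler\<close>

text \<open>One round of the loop, with \<open>None\<close> for every kind of rejection, in the
  shape that \<open>spmf_rejection_loop\<close> expects.\<close>

definition bridge_attempt :: "nat \<Rightarrow> real \<Rightarrow> triple list option spmf" where
  "bridge_attempt N lam = do {
     ts \<leftarrow> sample_walk N lam [];
     let K = length ts;
     let M = 1 + (\<Sum>t\<leftarrow>ts. (int (fstc t) - 1));
     if sum_list (map increment ts) > N \<or> M < 0 then return_spmf None
     else do {
       accepted \<leftarrow> spmf_of_pmf (bernoulli_pmf (accept_prob N lam K (nat M) ts));
       if \<not> accepted then return_spmf None
       else do {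
         let L = K + nat M;
         P \<leftarrow> spmf_of_set {P. P \<subseteq> {1..L} \<and> card P = K};
         return_spmf (Some (insert_at L P ts))
       }
     }
   }"

lemma bridge_sampler_loop:
  "bridge_sampler N lam =
     bind_spmf (bridge_attempt N lam) (\<lambda>x. case x of None \<Rightarrow> bridge_sampler N lam | Some y \<Rightarrow> return_spmf y)"
proof -
  have "bridge_sampler N lam = do {
     ts \<leftarrow> sample_walk N lam [];
     if sum_list (map increment ts) > N \<or> 1 + (\<Sum>t\<leftarrow>ts. (int (fstc t) - 1)) < 0 then bridge_sampler N lam
     else do {
       accepted \<leftarrow> spmf_of_pmf (bernoulli_pmf (accept_prob N lam (length ts) (nat (1 + (\<Sum>t\<leftarrow>ts. (int (fstc t) - 1)))) ts));
       if \<not> accepted then bridge_sampler N lam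
       else do {
         P \<leftarrow> spmf_of_set {P. P \<subseteq> {1..length ts + nat (1 + (\<Sum>t\<leftarrow>ts. (int (fstc t) - 1)))} \<and> card P = length ts};
         return_spmf (insert_at (length ts + nat (1 + (\<Sum>t\<leftarrow>ts. (int (fstc t) - 1)))) P ts)
       }
     }
   }"
    by (subst bridge_sampler.simps) (simp only: Let_def)
  also have "\<dots> = bind_spmf (bridge_attempt N lam) (\<lambda>x. case x of None \<Rightarrow> bridge_sampler N lam | Some y \<Rightarrow> return_spmf y)"
    unfolding bridge_attempt_def Let_def bind_spmf_assoc
    by (intro bind_spmf_cong refl)
       (simp only: if_distrib[of "\<lambda>p. bind_spmf p _"] return_bind_spmf option.case bind_spmf_assoc split: if_split)
  finally show ?thesis .
qed

text \<open>Each of the \<open>M\<close> inserted triples contributes \<open>-1\<close>, so the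
  definition of \<open>M\<close> turns into total \<open>-1\<close>: the condition under which a
  rotation of the list codes a plane tree.\<close>

definition bridge_lists :: "nat \<Rightarrow> triple list set" where
  "bridge_lists N = {xs. (\<forall>t\<in>set xs. proper t) \<and> (\<Sum>t\<leftarrow>xs. int (fstc t) - 1) = -1 \<and>
     sum_list (map increment xs) = N}"

abbreviation "nz_part \<equiv> filter (\<lambda>t. increment t > 0)"

lemma fstc_le_increment: "fstc t \<le> increment t"
  by (cases t) simp

lemma sum_fstc_nz_part:
  "(\<Sum>t\<leftarrow>xs. int (fstc t) - 1) =
   (\<Sum>t\<leftarrow>nz_part xs. int (fstc t) - 1) - (int (length xs) - int (length (nz_part xs)))"
proof (induction xs)
  case (Cons t xs)
  then show ?case using fstc_le_increment[of t] by auto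
qed simp

lemma sum_increment_nz_part: "sum_list (map increment (nz_part xs)) = sum_list (map increment xs)"
  by (induction xs) auto

lemma set_insert_at:
  assumes "P \<subseteq> {1..L}" "card P = length ts"
  shows "set (insert_at L P ts) \<subseteq> insert zero_triple (set ts)"
proof -
  have fin: "finite P" using assms(1) finite_subset by blast
  have mem: "(if j \<in> P then ts ! card {i \<in> P. i < j} else zero_triple) \<in> insert zero_triple (set ts)" for j
    using card_below_less[OF fin, of j] assms(2) by auto
  show ?thesis unfolding insert_at_def set_map by (intro image_subsetI mem)
qed

lemma proper_zero_increment: "proper t \<Longrightarrow> increment t = 0 \<Longrightarrow> t = zero_triple"
  by (cases t) (auto simp: proper_def forest_size_eq_0)

definition list_weight :: "triple list \<Rightarrow> real" where
  "list_weight xs = (\<Prod>t\<leftarrow>xs. fixfree_weight (forest_of t) / fact (fstc t))"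

context tilt
begin

lemma weight_pos: "weight lam k m > 0"
  using B_pos \<rho>_pos by (simp add: weight_def)

lemma M_hat_ge:
  assumes "1 \<le> k" "k \<le> N" "m \<le> N"
  shows "weight lam k m * D_par N lam k \<le> M_hat N lam"
proof -
  have "finite {weight lam k m * D_par N lam k | k m. 1 \<le> k \<and> k \<le> N \<and> m \<le> N}"
    by (rule finite_subset[of _ "(\<lambda>(k, m). weight lam k m * D_par N lam k) ` ({1..N} \<times> {..N})"]) auto
  then show ?thesis unfolding M_hat_def using assms by (intro Max_ge) auto
qed

lemma D_par_pos: "D_par N lam k > 0"
  by (simp add: D_par_def Let_def)

lemma M_hat_pos: "N \<ge> 1 \<Longrightarrow> M_hat N lam > 0"
  using M_hat_ge[of 1 N 0] mult_pos_pos[OF weight_pos D_par_pos, of 1 0 N 1] by simp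

text \<open>Increments are at least 1 and dominate the first coordinates, so \<open>K\<close> and
  \<open>M\<close> lie in the range of the maximum. The bounds matter because
  \<open>bernoulli_pmf\<close> truncates its argument to the unit interval.\<close>

lemma accept_prob_bounds:
  assumes "N \<ge> 1" "\<forall>t\<in>set ts. increment t > 0" "sum_list (map increment ts) = N"
    and M: "int M = 1 + (\<Sum>t\<leftarrow>ts. int (fstc t) - 1)"
  shows "0 \<le> accept_prob N lam (length ts) M ts" "accept_prob N lam (length ts) M ts \<le> 1"
proof -
  have ne: "ts \<noteq> []" using assms(1,3) by auto
  have "length us \<le> sum_list (map increment us)" if "\<forall>t\<in>set us. increment t > 0" for us
    using that by (induction us) auto
  then have K: "1 \<le> length ts" "length ts \<le> N" using assms ne by (auto simp: Suc_le_eq)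
  have "(\<Sum>t\<leftarrow>us. int (fstc t) - 1) \<le> int (sum_list (map increment us)) - int (length us)" for us
  proof (induction us)
    case (Cons t us)
    then show ?case using fstc_le_increment[of t] by simp
  qed simp
  from this[of ts] have MN: "M \<le> N" using M K(1) assms(3) by linarith
  have "(\<Prod>t\<leftarrow>ts. inverse (cosh (lam * real (increment t)))) \<le> D_par N lam (length ts)"
    using prod_inverse_cosh_le_D_par[OF lam(1), of "map increment ts"] ne assms(3) by (simp add: o_def)
  then have "weight lam (length ts) M * (\<Prod>t\<leftarrow>ts. inverse (cosh (lam * real (increment t)))) \<le> weight lam (length ts) M * D_par N lam (length ts)"
    using weight_pos by (intro mult_left_mono) (auto intro: less_imp_le)
  also have "\<dots> \<le> M_hat N lam" using M_hat_ge[OF K MN] .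
  finally have "weight lam (length ts) M * (\<Prod>t\<leftarrow>ts. inverse (cosh (lam * real (increment t)))) / M_hat N lam \<le> 1"
    using M_hat_pos[OF assms(1)] by simp
  then show "accept_prob N lam (length ts) M ts \<le> 1"
    by (simp add: accept_prob_def divide_inverse mult.commute mult.left_commute)
  have "(\<Prod>t\<leftarrow>ts. inverse (cosh (lam * real (increment t)))) \<ge> 0" by (induction ts) auto
  then show "0 \<le> accept_prob N lam (length ts) M ts"
    unfolding accept_prob_def using M_hat_pos[OF assms(1)] weight_pos[of "length ts" M]
    by (intro mult_nonneg_nonneg) auto
qed

lemma position_sets_nonempty: "finite {P. P \<subseteq> {1..K + M} \<and> card P = K} \<and> {P. P \<subseteq> {1..K + M} \<and> card P = (K :: nat)} \<noteq> {}"
proof -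
  have "{1..K} \<subseteq> {1..K + M} \<and> card {1..K} = K" by auto
  moreover have "finite {P. P \<subseteq> {1..K + M} \<and> card P = K}"
    by (rule finite_subset[of _ "Pow {1..K + M}"]) auto
  ultimately show ?thesis by blast
qed

lemma lossless_bridge_attempt: "lossless_spmf (bridge_attempt N lam)"
  unfolding bridge_attempt_def Let_def
  using sample_walk_support[of N "[]"] position_sets_nonempty by simp

lemma set_bridge_attempt:
  assumes "Some xs \<in> set_spmf (bridge_attempt N lam)"
  shows "xs \<in> bridge_lists N"
proof -
  obtain ts P where ts: "ts \<in> set_spmf (sample_walk N lam [])"
    and sum: "\<not> sum_list (map increment ts) > N" and M: "\<not> 1 + (\<Sum>t\<leftarrow>ts. (int (fstc t) - 1)) < 0"
    and P: "P \<subseteq> {1..length ts + nat (1 + (\<Sum>t\<leftarrow>ts. (int (fstc t) - 1)))}" "card P = length ts"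
    and xs: "xs = insert_at (length ts + nat (1 + (\<Sum>t\<leftarrow>ts. (int (fstc t) - 1)))) P ts"
    using assms position_sets_nonempty
    by (auto simp: bridge_attempt_def Let_def set_bind_spmf set_spmf_bind_pmf set_spmf_of_set split: if_splits)
  have ts': "\<forall>t\<in>set ts. proper t \<and> increment t > 0" "N \<le> sum_list (map increment ts)"
    using sample_walk_support[of N "[]"] ts by auto
  have nz: "nz_part xs = ts"
    unfolding xs using P ts' by (intro filter_insert_at) auto
  have "proper t" if "t \<in> set xs" for t
    using set_insert_at[OF P] that ts' unfolding xs by (auto simp: proper_def)
  moreover have "(\<Sum>t\<leftarrow>xs. int (fstc t) - 1) = -1"
    using M sum_fstc_nz_part[of xs] unfolding nz by (simp add: xs)
  moreover have "sum_list (map increment xs) = N"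
    using sum ts'(2) sum_increment_nz_part[of xs] unfolding nz by simp
  ultimately show ?thesis by (simp add: bridge_lists_def)
qed

text \<open>\<open>B ^ K\<close> and the inverse cosines cancel against the walk. The factorials in
  \<open>weight\<close> are such that division by the number of position sets leaves
  \<open>1 / L\<close>. The factor \<open>\<rho> ^ M\<close> gives every inserted triple the weight
  it would have under the common formula, so the power of \<open>\<rho>\<close> depends on
  \<open>N\<close> alone.\<close>

lemma spmf_bridge_attempt:
  assumes N: "N \<ge> 1" and xs: "xs \<in> bridge_lists N"
  shows "spmf (bridge_attempt N lam) (Some xs) =
     \<rho> ^ Suc N / M_hat N lam * (list_weight xs / real (length xs))"
proof -
  define ts where "ts = nz_part xs"
  define K where "K = length ts"
  define M where "M = length xs - K"
  have KL: "K \<le> length xs" by (simp add: K_def ts_def)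
  have L: "length xs = K + M" using KL by (simp add: M_def)
  have proper: "proper t" if "t \<in> set xs" for t using xs that by (simp add: bridge_lists_def)
  have sum1: "(\<Sum>t\<leftarrow>xs. int (fstc t) - 1) = -1" and sumN: "sum_list (map increment xs) = N"
    using xs by (auto simp: bridge_lists_def)
  have Meq: "1 + (\<Sum>t\<leftarrow>ts. int (fstc t) - 1) = int M"
    using sum1 sum_fstc_nz_part[of xs] L unfolding ts_def[symmetric] K_def[symmetric] by simp
  have tsN: "sum_list (map increment ts) = N" using sum_increment_nz_part[of xs] sumN by (simp add: ts_def)
  have ts_pos: "\<forall>t\<in>set ts. increment t > 0" by (simp add: ts_def)
  have L0: "length xs > 0" using sum1 by (cases xs) auto
  define pos where "pos = nonzero_positions xs"
  define G where "G = (\<lambda>us. let K = length us; M = 1 + (\<Sum>t\<leftarrow>us. (int (fstc t) - 1)) in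
     if sum_list (map increment us) > N \<or> M < 0 then return_spmf None
     else do {
       accepted \<leftarrow> spmf_of_pmf (bernoulli_pmf (accept_prob N lam K (nat M) us));
       if \<not> accepted then return_spmf None
       else do {
         let L = K + nat M;
         P \<leftarrow> spmf_of_set {P. P \<subseteq> {1..L} \<and> card P = K};
         return_spmf (Some (insert_at L P us)) } })"
  have attempt: "bridge_attempt N lam = bind_spmf (sample_walk N lam []) G"
    by (simp add: bridge_attempt_def G_def Let_def)
  have other: "spmf (sample_walk N lam []) us * spmf (G us) (Some xs) = 0" if "us \<noteq> ts" for us
  proof (rule ccontr)
    assume "\<not> ?thesis"
    then have us: "us \<in> set_spmf (sample_walk N lam [])" and G: "Some xs \<in> set_spmf (G us)"
      by (auto simp: spmf_eq_0_set_spmf)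
    have us': "\<forall>t\<in>set us. increment t > 0" using sample_walk_support[of N "[]"] us by auto
    from G position_sets_nonempty obtain P M where "P \<subseteq> {1..length us + M}" "card P = length us" "xs = insert_at (length us + M) P us"
      by (auto simp: G_def Let_def set_bind_spmf set_spmf_bind_pmf set_spmf_of_set split: if_splits)
    then have "nz_part xs = us" using us' by (auto intro!: filter_insert_at)
    then show False using that by (simp add: ts_def)
  qed
  let ?S = "{P. P \<subseteq> {1..K + M} \<and> card P = K}"
  have pos_S: "pos \<in> ?S"
    unfolding L[symmetric] using nonzero_positions_subset[of xs] card_nonzero_positions[of xs]
    by (simp add: pos_def K_def ts_def)
  have ins_pos: "insert_at (K + M) pos ts = xs"
    unfolding L[symmetric] pos_def ts_def using proper by (intro insert_at_nonzero_positions proper_zero_increment)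
  have uniq: "P = pos" if "P \<in> ?S" "insert_at (K + M) P ts = xs" for P
  proof -
    have "j \<in> P \<longleftrightarrow> j \<in> pos" if "j \<in> {1..K + M}" for j
      using insert_at_mem[of P "K + M" ts j] \<open>P \<in> ?S\<close> that ts_pos \<open>insert_at (K + M) P ts = xs\<close>
      by (simp add: K_def pos_def nonzero_positions_def L)
    then show ?thesis using \<open>P \<in> ?S\<close> pos_S by blast
  qed
  have cardS: "card ?S = (K + M) choose K" using n_subsets[of "{1..K + M}" K] by simp
  define a where "a = accept_prob N lam K M ts"
  have a: "0 \<le> a" "a \<le> 1"
    unfolding a_def K_def using accept_prob_bounds[OF N ts_pos tsN, of M] Meq by auto
  have choose: "spmf (bind_spmf (spmf_of_set ?S) (\<lambda>P. return_spmf (Some (insert_at (K + M) P ts)))) (Some xs) = 1 / real ((K + M) choose K)"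
  proof -
    have "spmf (bind_spmf (spmf_of_set ?S) (\<lambda>P. return_spmf (Some (insert_at (K + M) P ts)))) (Some xs) =
      (\<Sum>P\<in>{pos}. spmf (spmf_of_set ?S) P * spmf (return_spmf (Some (insert_at (K + M) P ts))) (Some xs))"
    proof (rule spmf_bind_sum)
      fix P assume "P \<notin> {pos}"
      then show "spmf (spmf_of_set ?S) P * spmf (return_spmf (Some (insert_at (K + M) P ts))) (Some xs) = 0"
        using uniq[of P] by (auto simp: spmf_of_set indicator_def)
    qed simp
    then show ?thesis unfolding cardS[symmetric] using pos_S by (simp add: ins_pos spmf_of_set)
  qed
  have Gts: "spmf (G ts) (Some xs) = a / real ((K + M) choose K)"
  proof -
    have "G ts = bind_spmf (spmf_of_pmf (bernoulli_pmf a)) (\<lambda>accepted. if \<not> accepted then return_spmf None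
       else bind_spmf (spmf_of_set ?S) (\<lambda>P. return_spmf (Some (insert_at (K + M) P ts))))"
      using tsN by (simp only: G_def Let_def Meq K_def[symmetric] a_def nat_int) simp
    then have "spmf (G ts) (Some xs) = (\<Sum>b\<in>{True}. spmf (spmf_of_pmf (bernoulli_pmf a)) b * spmf (if \<not> b then return_spmf None
       else bind_spmf (spmf_of_set ?S) (\<lambda>P. return_spmf (Some (insert_at (K + M) P ts)))) (Some xs))"
      by (simp only:) (rule spmf_bind_sum, auto)
    then show ?thesis using a choose by simp
  qed
  have walk: "spmf (sample_walk N lam []) ts = (\<Prod>t\<leftarrow>ts. spmf (sampler_Q lam) t)"
    using spmf_sample_walk[of "[]" ts N] tsN ts_pos by simp
  have prod: "(\<Prod>t\<leftarrow>us. spmf (sampler_Q lam) t) * (\<Prod>t\<leftarrow>us. inverse (cosh (lam * real (increment t)))) * B ^ length us =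
      \<rho> ^ (length us + (\<Sum>t\<leftarrow>us. forest_size (forest_of t))) * list_weight us"
    if "\<forall>t\<in>set us. proper t \<and> increment t > 0" for us
    using that
  proof (induction us)
    case (Cons t us)
    obtain x y f where t: "t = (x, y, f)" by (cases t)
    have yf: "y = forest_size f" "x + y \<noteq> 0" using Cons.prems by (auto simp: t proper_def)
    have ch: "cosh (lam * real (x + y)) > 0" by simp
    have "spmf (sampler_Q lam) t * inverse (cosh (lam * real (increment t))) * B =
       \<rho> ^ Suc y * fixfree_weight f / (B * fact x) * B * (cosh (lam * real (x + y)) * inverse (cosh (lam * real (x + y))))"
      unfolding t spmf_sampler_Q using yf by simp
    also have "\<dots> = \<rho> ^ Suc (forest_size f) * (fixfree_weight f / fact x)"
      using B_pos ch yf(1) by simp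
    finally have 1: "spmf (sampler_Q lam) t * inverse (cosh (lam * real (increment t))) * B =
        \<rho> ^ Suc (forest_size f) * (fixfree_weight f / fact x)" .
    have "(\<Prod>t\<leftarrow>t # us. spmf (sampler_Q lam) t) * (\<Prod>t\<leftarrow>t # us. inverse (cosh (lam * real (increment t)))) * B ^ length (t # us) =
      (spmf (sampler_Q lam) t * inverse (cosh (lam * real (increment t))) * B) *
      ((\<Prod>t\<leftarrow>us. spmf (sampler_Q lam) t) * (\<Prod>t\<leftarrow>us. inverse (cosh (lam * real (increment t)))) * B ^ length us)"
      by simp
    also have "\<dots> = \<rho> ^ (length (t # us) + (\<Sum>t\<leftarrow>t # us. forest_size (forest_of t))) * list_weight (t # us)"
      unfolding 1 using Cons by (simp add: t list_weight_def power_add)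
    finally show ?case .
  qed (simp add: list_weight_def)
  have lw: "list_weight us = list_weight (nz_part us)"
    "(\<Sum>t\<leftarrow>us. forest_size (forest_of t)) = (\<Sum>t\<leftarrow>nz_part us. forest_size (forest_of t))"
    if "\<forall>t\<in>set us. proper t" for us
  proof -
    have "list_weight us = list_weight (nz_part us) \<and>
     (\<Sum>t\<leftarrow>us. forest_size (forest_of t)) = (\<Sum>t\<leftarrow>nz_part us. forest_size (forest_of t))"
      using that
    proof (induction us)
      case (Cons t us)
      show ?case
      proof (cases "increment t > 0")
        case True
        then show ?thesis using Cons by (simp add: list_weight_def)
      next
        case False
        then have "t = zero_triple" using Cons.prems proper_zero_increment[of t] by simp
        then show ?thesis using Cons by (simp add: list_weight_def)
      qed
    qed simp
    then show "list_weight us = list_weight (nz_part us)"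
      "(\<Sum>t\<leftarrow>us. forest_size (forest_of t)) = (\<Sum>t\<leftarrow>nz_part us. forest_size (forest_of t))" by auto
  qed
  \<comment> \<open>Each of the \<open>K + M\<close> entries is a vertex of the plane tree and the
    forests contain the remaining vertices.\<close>
  have total: "K + (\<Sum>t\<leftarrow>ts. forest_size (forest_of t)) + M = Suc N"
  proof -
    have "int (sum_list (map increment us)) = (\<Sum>t\<leftarrow>us. int (fstc t) - 1) + int (length us) + int (\<Sum>t\<leftarrow>us. forest_size (forest_of t))"
      if "\<forall>t\<in>set us. proper t" for us
      using that by (induction us) (auto simp: proper_def)
    from this[of xs] show ?thesis
      using lw(2)[of xs] proper sum1 sumN L by (simp add: ts_def)
  qed
  define ch where "ch = (\<Prod>t\<leftarrow>ts. inverse (cosh (lam * real (increment t))))"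
  define Q where "Q = (\<Prod>t\<leftarrow>ts. spmf (sampler_Q lam) t)"
  have QB: "Q * ch * B ^ K = \<rho> ^ (K + (\<Sum>t\<leftarrow>ts. forest_size (forest_of t))) * list_weight xs"
    using prod[of ts] proper lw(1)[of xs] by (simp add: Q_def ch_def K_def ts_def)
  have facts: "fact (K + M - 1) / (fact K * fact M) / real ((K + M) choose K) = 1 / real (length xs)"
  proof -
    have "fact (K + M) = real (length xs) * fact (K + M - 1)"
      using L0 fact_reduce[of "K + M"] by (simp add: L)
    moreover have "real ((K + M) choose K) = fact (K + M) / (fact K * fact M)"
      using binomial_fact[of K "K + M"] by simp
    ultimately show ?thesis using L0 by simp
  qed
  have "spmf (bridge_attempt N lam) (Some xs) = (\<Sum>us\<in>{ts}. spmf (sample_walk N lam []) us * spmf (G us) (Some xs))"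
    unfolding attempt by (rule spmf_bind_sum) (use other in auto)
  also have "\<dots> = Q * (inverse (M_hat N lam) * (B ^ K * \<rho> ^ M * (fact (K + M - 1) / (fact K * fact M))) * ch) / real ((K + M) choose K)"
    by (simp add: walk Gts a_def accept_prob_def weight_def Q_def ch_def)
  also have "\<dots> = inverse (M_hat N lam) * (Q * ch * B ^ K) * \<rho> ^ M * (fact (K + M - 1) / (fact K * fact M) / real ((K + M) choose K))"
    by simp
  also have "\<dots> = inverse (M_hat N lam) * (\<rho> ^ (K + (\<Sum>t\<leftarrow>ts. forest_size (forest_of t))) * \<rho> ^ M) * (list_weight xs / real (length xs))"
    unfolding QB facts by simp
  also have "\<rho> ^ (K + (\<Sum>t\<leftarrow>ts. forest_size (forest_of t))) * \<rho> ^ M = \<rho> ^ Suc N"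
    unfolding power_add[symmetric] total ..
  finally show ?thesis by (simp add: divide_inverse mult.commute)
qed

end

section \<open>The cycle lemma\<close>

text \<open>Read \<open>ds\<close> as the outdegrees met in depth-first order while \<open>m\<close> trees remain to be explored:
  \<open>luk m ds\<close> says that \<open>ds\<close> is the outdegree list of a plane forest with \<open>m\<close> trees.\<close>

primrec luk :: "nat \<Rightarrow> nat list \<Rightarrow> bool" where
  "luk m [] \<longleftrightarrow> m = 0"
| "luk m (d # ds) \<longleftrightarrow> m > 0 \<and> luk (m - 1 + d) ds"

lemma luk_append: "luk m xs \<Longrightarrow> luk m' ys \<Longrightarrow> luk (m + m') (xs @ ys)"
proof (induction xs arbitrary: m)
  case (Cons d ds)
  then have "m > 0" "luk (m - 1 + d) ds" by (simp_all only: luk.simps)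
  from \<open>m > 0\<close> Cons.IH[OF this(2) Cons.prems(2)] have "m > 0" "luk (m - 1 + d + m') (ds @ ys)" .
  moreover from \<open>m > 0\<close> have "m - 1 + d + m' = m + m' - 1 + d" by simp
  ultimately show ?case by simp
qed simp

lemma luk_concat:
  "(\<And>xs. xs \<in> set xss \<Longrightarrow> luk 1 xs) \<Longrightarrow> luk (length xss) (concat xss)"
proof (induction xss)
  case (Cons xs xss)
  then have "luk (1 + length xss) (xs @ concat xss)" by (intro luk_append) simp_all
  then show ?case by simp
qed simp

lemma luk_dfs_outdegrees: "luk 1 (map snd (dfs_outdegrees \<tau>))"
proof (induction \<tau>)
  case (Plane v ts)
  then have "luk (length ts) (concat (map (map snd \<circ> dfs_outdegrees) ts))"
    using luk_concat[of "map (map snd \<circ> dfs_outdegrees) ts"] by auto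
  then show ?case by (simp add: map_concat)
qed

lemma luk_iff:
  "luk m ds \<longleftrightarrow> (\<forall>j<length ds. int m + (\<Sum>d\<leftarrow>take j ds. int d - 1) > 0) \<and> int m + (\<Sum>d\<leftarrow>ds. int d - 1) = 0"
proof (induction ds arbitrary: m)
  case (Cons d ds)
  show ?case
  proof (cases "m > 0")
    case True
    then have m: "int (m - 1 + d) = int m + (int d - 1)" by simp
    have "(\<forall>j<length (d # ds). int m + (\<Sum>d\<leftarrow>take j (d # ds). int d - 1) > 0) \<longleftrightarrow>
      (\<forall>j<length ds. int (m - 1 + d) + (\<Sum>d\<leftarrow>take j ds. int d - 1) > 0)"
      using True unfolding m by (simp add: All_less_Suc2 algebra_simps)
    then show ?thesis using True Cons.IH[of "m - 1 + d"] unfolding m by (simp add: algebra_simps)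
  next
    case False
    then show ?thesis by (auto intro!: exI[of _ 0])
  qed
qed simp

text \<open>Decoding from the right: the first vertex adopts the first \<open>d\<close> trees of the
  forest coded by the rest.\<close>

lemma luk_imp_dfs:
  "luk m (map snd w) \<Longrightarrow> \<exists>ts. length ts = m \<and> concat (map dfs_outdegrees ts) = w"
proof (induction w arbitrary: m)
  case (Cons p w)
  obtain v d where p: "p = (v, d)" by (cases p)
  obtain ts where ts: "length ts = m - 1 + d" "concat (map dfs_outdegrees ts) = w"
    using Cons.IH[of "m - 1 + d"] Cons.prems by (auto simp: p)
  have "concat (map dfs_outdegrees (Plane v (take d ts) # drop d ts)) = p # w"
    using ts by (simp add: p) (metis append_take_drop_id concat_append map_append)
  moreover have "length (Plane v (take d ts) # drop d ts) = m"
    using ts(1) Cons.prems by (simp add: p)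
  ultimately show ?case by blast
qed simp

text \<open>The code is prefix-free, hence the arbitrary remainders. Replacing the first tree by its
  children, put in front of the other trees, shortens the code by one.\<close>

lemma concat_dfs_outdegrees_inject:
  assumes "concat (map dfs_outdegrees ts) @ r = concat (map dfs_outdegrees ts') @ r'" "length ts = length ts'"
  shows "ts = ts'"
  using assms
proof (induction "length (concat (map dfs_outdegrees ts))" arbitrary: ts ts' rule: less_induct)
  case less
  show ?case
  proof (cases ts)
    case Nil
    then show ?thesis using less.prems by simp
  next
    case (Cons \<tau> us)
    then obtain \<tau>' us' where ts': "ts' = \<tau>' # us'" using less.prems by (cases ts') auto
    obtain v ws where \<tau>: "\<tau> = Plane v ws" by (cases \<tau>)
    obtain v' ws' where \<tau>': "\<tau>' = Plane v' ws'" by (cases \<tau>')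
    have hd: "v = v'" "length ws = length ws'" and
      tl: "concat (map dfs_outdegrees (ws @ us)) @ r = concat (map dfs_outdegrees (ws' @ us')) @ r'"
      using less.prems(1) by (auto simp: Cons ts' \<tau> \<tau>')
    have "ws @ us = ws' @ us'"
      using less.prems(2) hd by (intro less.hyps[OF _ tl]) (auto simp: Cons ts' \<tau> \<tau>')
    then show ?thesis using hd by (simp add: Cons ts' \<tau> \<tau>')
  qed
qed

lemma dfs_outdegrees_inject: "dfs_outdegrees \<tau> = dfs_outdegrees \<tau>' \<longleftrightarrow> \<tau> = \<tau>'"
  using concat_dfs_outdegrees_inject[of "[\<tau>]" "[]" "[\<tau>']" "[]"] by auto

lemma dfs_outdegrees_map: "dfs_outdegrees (map_plane_tree f \<tau>) = map (\<lambda>(v, d). (f v, d)) (dfs_outdegrees \<tau>)"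
proof (induction \<tau>)
  case (Plane v ts)
  have "concat (map (dfs_outdegrees \<circ> map_plane_tree f) ts) = map (\<lambda>(v, d). (f v, d)) (concat (map dfs_outdegrees ts))"
    unfolding map_concat map_map using Plane by (intro arg_cong[of _ _ concat] map_cong) auto
  then show ?case by simp
qed

lemma attach_forests_map: "attach_forests g (map_plane_tree f \<tau>) = attach_forests (\<lambda>v. g (f v)) \<tau>"
proof (induction \<tau>)
  case (Plane v ts)
  have "map (\<lambda>\<tau>. attach_forests g (map_plane_tree f \<tau>)) ts = map (attach_forests (\<lambda>v. g (f v))) ts"
    using Plane by (intro map_cong) auto
  then have "mset (map (\<lambda>\<tau>. attach_forests g (map_plane_tree f \<tau>)) ts) = mset (map (attach_forests (\<lambda>v. g (f v))) ts)"
    by (rule arg_cong)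
  then show ?case by (simp add: image_mset.compositionality o_def)
qed

text \<open>Decorated plane trees carry the attached forests themselves as vertex labels, which
  keeps indices out of the counting.\<close>

abbreviation merge_tree :: "forest plane_tree \<Rightarrow> ptree" where
  "merge_tree \<equiv> attach_forests (\<lambda>f. f)"

definition code_list :: "forest plane_tree \<Rightarrow> triple list" where
  "code_list \<theta> = map (\<lambda>(f, d). (d, forest_size f, f)) (dfs_outdegrees \<theta>)"

lemma code_list_Plane:
  "code_list (Plane f ts) = (length ts, forest_size f, f) # concat (map code_list ts)"
  by (simp add: code_list_def[abs_def] map_concat o_def)

lemma code_list_nonempty: "code_list \<theta> \<noteq> []"
  by (cases \<theta>) (simp add: code_list_Plane)

lemma code_list_inject: "code_list \<theta> = code_list \<theta>' \<longleftrightarrow> \<theta> = \<theta>'"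
proof -
  have "inj (\<lambda>(f, d). (d, forest_size f, f) :: triple)" by (auto simp: inj_def)
  then show ?thesis by (auto simp: code_list_def inj_map_eq_map dfs_outdegrees_inject)
qed

lemma proper_code_list: "t \<in> set (code_list \<theta>) \<Longrightarrow> proper t"
  by (auto simp: code_list_def proper_def)

lemma luk_code_list: "luk 1 (map fstc (code_list \<theta>))"
proof -
  have "map fstc (code_list \<theta>) = map snd (dfs_outdegrees \<theta>)" by (auto simp: code_list_def)
  then show ?thesis using luk_dfs_outdegrees[of \<theta>] by simp
qed

lemma luk_imp_code_list:
  assumes "luk 1 (map fstc xs)" "\<And>t. t \<in> set xs \<Longrightarrow> proper t"
  shows "\<exists>\<theta>. code_list \<theta> = xs"
proof -
  have "map snd (map (\<lambda>t. (forest_of t, fstc t)) xs) = map fstc xs" by simp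
  then have "luk 1 (map snd (map (\<lambda>t. (forest_of t, fstc t)) xs))" using assms(1) by (simp only:)
  then obtain ts where "length ts = 1" "concat (map dfs_outdegrees ts) = map (\<lambda>t. (forest_of t, fstc t)) xs"
    using luk_imp_dfs by blast
  then obtain \<theta> where \<theta>: "dfs_outdegrees \<theta> = map (\<lambda>t. (forest_of t, fstc t)) xs"
    by (cases ts) auto
  have "code_list \<theta> = map (\<lambda>t. (fstc t, forest_size (forest_of t), forest_of t)) xs"
    by (simp add: code_list_def \<theta>)
  also have "\<dots> = xs" using assms(2) by (intro map_idI) (force simp: proper_def)
  finally show ?thesis by blast
qed

lemma vertices_attach_forests:
  "vertices (merge_tree \<theta>) = (\<Sum>t\<leftarrow>code_list \<theta>. Suc (forest_size (forest_of t)))"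
proof (induction \<theta>)
  case (Plane f ts)
  have "vertices (merge_tree (Plane f ts)) = Suc (forest_size f) + (\<Sum>\<theta>\<leftarrow>ts. vertices (merge_tree \<theta>))"
    by (simp add: vertices_Join forest_size_def sum_mset_sum_list[symmetric] image_mset.compositionality o_def del: vertices.simps)
  also have "(\<Sum>\<theta>\<leftarrow>ts. vertices (merge_tree \<theta>)) = (\<Sum>\<theta>\<leftarrow>ts. \<Sum>t\<leftarrow>code_list \<theta>. Suc (forest_size (forest_of t)))"
    using Plane by (intro arg_cong[of _ _ sum_list] map_cong) auto
  also have "\<dots> = (\<Sum>t\<leftarrow>concat (map code_list ts). Suc (forest_size (forest_of t)))"
    by (induction ts) simp_all
  finally show ?case by (simp add: code_list_Plane)
qed

section \<open>Rotations and first minima\<close>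

definition walk_height :: "triple list \<Rightarrow> nat \<Rightarrow> int" where
  "walk_height xs j = (\<Sum>t\<leftarrow>take j xs. int (fstc t) - 1)"

lemma height_eq: "j \<le> length xs \<Longrightarrow> height xs j = walk_height xs j"
proof (induction j)
  case (Suc j)
  then show ?case by (simp add: height_def walk_height_def take_Suc_conv_app_nth)
qed (simp add: height_def walk_height_def)

lemma walk_height_append:
  "walk_height (xs @ ys) j = (if j \<le> length xs then walk_height xs j
     else walk_height xs (length xs) + walk_height ys (j - length xs))"
  by (simp add: walk_height_def)

lemma walk_height_take: "j \<le> k \<Longrightarrow> walk_height (take k xs) j = walk_height xs j"
  by (simp add: walk_height_def min_def)

lemma walk_height_drop: "k \<le> length xs \<Longrightarrow> walk_height (drop k xs) j = walk_height xs (k + j) - walk_height xs k"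
  by (simp add: walk_height_def take_add)

lemma luk_walk_height:
  "luk 1 (map fstc xs) \<longleftrightarrow> (\<forall>j<length xs. walk_height xs j \<ge> 0) \<and> walk_height xs (length xs) = -1"
  by (auto simp: luk_iff walk_height_def take_map o_def)

lemma walk_height_rotated:
  assumes "k \<le> length xs" "walk_height xs (length xs) = -1" "j \<le> length xs"
  shows "walk_height (drop k xs @ take k xs) j = (if j \<le> length xs - k then walk_height xs (k + j) - walk_height xs k
     else -1 - walk_height xs k + walk_height xs (j - (length xs - k)))"
  using assms by (auto simp: walk_height_append walk_height_drop walk_height_take)

text \<open>The end of the code word sits at position \<open>length xs - k\<close>. Before it the
  walk is strictly higher, since \<open>xs\<close> reaches \<open>-1\<close> only at its end; after
  it the walk may return to that level but not below it. This is why the first minimum is the right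
  one.\<close>

lemma first_min_rotate:
  assumes luk: "luk 1 (map fstc xs)" and k: "k < length xs"
  shows "first_min (rotate k xs) = length xs - k"
proof -
  let ?L = "length xs" and ?y = "drop k xs @ take k xs"
  have y: "rotate k xs = ?y" "length ?y = ?L" using k by (simp_all add: rotate_drop_take)
  have nonneg: "walk_height xs j \<ge> 0" if "j < ?L" for j using luk that unfolding luk_walk_height by blast
  have last: "walk_height xs ?L = -1" using luk unfolding luk_walk_height by blast
  have h: "height ?y j = (if j \<le> ?L - k then walk_height xs (k + j) - walk_height xs k
     else -1 - walk_height xs k + walk_height xs (j - (?L - k)))" if "j \<le> ?L" for j
    using that k last by (simp only: height_eq y(2) walk_height_rotated less_imp_le)
  have hmin: "height ?y (?L - k) = -1 - walk_height xs k" using k last by (simp add: h)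
  have ge: "height ?y (?L - k) \<le> height ?y j" if "j \<in> {1..?L}" for j
  proof (cases "j \<le> ?L - k")
    case True
    have "walk_height xs (k + j) \<ge> -1"
    proof (cases "k + j = ?L")
      case False
      then have "k + j < ?L" using True k by linarith
      then show ?thesis using nonneg[of "k + j"] by linarith
    qed (simp add: last)
    then show ?thesis using True that k by (simp add: hmin h)
  next
    case False
    then show ?thesis using nonneg[of "j - (?L - k)"] that k by (simp add: hmin h)
  qed
  have less: "?L - k \<le> j" if j: "j \<in> {1..?L}" "\<forall>i\<in>{1..?L}. height ?y j \<le> height ?y i" for j
  proof (rule ccontr)
    assume "\<not> ?L - k \<le> j"
    then have "height ?y j = walk_height xs (k + j) - walk_height xs k" "walk_height xs (k + j) \<ge> 0"
      using nonneg[of "k + j"] j k by (auto simp: h)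
    moreover have "?L - k \<in> {1..?L}" using k by auto
    ultimately show False using j(2) hmin by fastforce
  qed
  show ?thesis
    unfolding first_min_def y using ge less k by (intro Least_equality) (auto simp: y(2))
qed

text \<open>Seen from the first minimum, later heights are not lower. Earlier ones are strictly
  higher, which compensates for the total drop of 1 when they are passed after the wrap.\<close>

lemma rotate_first_min:
  assumes sum: "(\<Sum>t\<leftarrow>xs. int (fstc t) - 1) = -1"
  defines "s \<equiv> first_min xs"
  shows "s \<in> {1..length xs}" "luk 1 (map fstc (drop s xs @ take s xs))"
proof -
  let ?L = "length xs"
  define P where "P s \<longleftrightarrow> s \<in> {1..?L} \<and> (\<forall>j\<in>{1..?L}. height xs s \<le> height xs j)" for s
  have last: "walk_height xs ?L = -1" using sum by (simp add: walk_height_def)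
  have "?L > 0" using sum by (cases xs) auto
  then have "1 \<le> ?L" by linarith
  then have "{1..?L} \<noteq> {}" by simp
  then have "\<exists>s. P s"
    unfolding P_def using ex_min_if_finite[of "height xs ` {1..?L}"]
    by (auto simp: not_less)
  moreover have s: "s = (LEAST s. P s)" by (simp add: s_def first_min_def P_def)
  ultimately have Ps: "P s" by (metis LeastI_ex)
  then show s_in: "s \<in> {1..?L}" by (simp add: P_def)
  have min: "walk_height xs s \<le> walk_height xs j" if "j \<in> {1..?L}" for j
    using Ps that by (auto simp: P_def height_eq)
  have first: "walk_height xs s < walk_height xs j" if j: "j \<in> {1..?L}" "j < s" for j
  proof (rule ccontr)
    assume "\<not> ?thesis"
    then have "walk_height xs j \<le> walk_height xs i" if "i \<in> {1..?L}" for i using min[OF that] by linarith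
    then have "P j" using j by (auto simp: P_def height_eq)
    then show False using j(2) not_less_Least[of j P] s by simp
  qed
  have len: "length (drop s xs @ take s xs) = ?L" using s_in by simp
  show "luk 1 (map fstc (drop s xs @ take s xs))"
    unfolding luk_walk_height len
  proof (intro conjI allI impI)
    fix j assume j: "j < ?L"
    show "0 \<le> walk_height (drop s xs @ take s xs) j"
    proof (cases "j \<le> ?L - s")
      case True
      then show ?thesis using j s_in min[of "s + j"] last by (subst walk_height_rotated) auto
    next
      case False
      then have "j - (?L - s) \<in> {1..?L}" "j - (?L - s) < s" using j s_in by auto
      then show ?thesis using False j s_in first[of "j - (?L - s)"] last by (subst walk_height_rotated) auto
    qed
  next
    show "walk_height (drop s xs @ take s xs) ?L = -1"
      using s_in last by (subst walk_height_rotated) auto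
  qed
qed

lemma mset_rotate: "mset (rotate k (xs :: 'a list)) = mset xs"
proof -
  have "mset (rotate1 ys) = mset ys" for ys :: "'a list" by (cases ys) simp_all
  then show ?thesis by (induction k) simp_all
qed

lemma rotate_back: "k \<le> length xs \<Longrightarrow> rotate (length xs - k) (rotate k xs) = xs"
  unfolding rotate_rotate by (intro rotate_id) simp

text \<open>The conditions on a list are invariant under rotation, and some rotation is a code word.
  Increments sum to one less than the number of vertices, since each vertex but the root is counted
  once, as a plane child or inside a forest.\<close>

lemma bridge_lists_eq:
  "bridge_lists N = {rotate k (code_list \<theta>) | \<theta> k.
     vertices (merge_tree \<theta>) = Suc N \<and> k < length (code_list \<theta>)}"
proof -
  have inc: "sum_list (map increment xs) = N \<longleftrightarrow> (\<Sum>t\<leftarrow>xs. Suc (forest_size (forest_of t))) = Suc N"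
    if "\<forall>t\<in>set xs. proper t" "(\<Sum>t\<leftarrow>xs. int (fstc t) - 1) = -1" for xs
  proof -
    have "int (sum_list (map increment xs)) = (\<Sum>t\<leftarrow>xs. int (fstc t) - 1) + int (\<Sum>t\<leftarrow>xs. Suc (forest_size (forest_of t)))"
      using that(1) by (induction xs) (auto simp: proper_def)
    then show ?thesis using that(2) by linarith
  qed
  have sum_rot: "sum_list (map g (rotate k xs)) = sum_list (map g xs)" for g :: "triple \<Rightarrow> 'b :: comm_monoid_add" and k xs
    by (metis mset_map mset_rotate sum_mset_sum_list)
  have code_sum: "(\<Sum>t\<leftarrow>code_list \<theta>. int (fstc t) - 1) = -1" for \<theta>
    using luk_code_list[of \<theta>] unfolding luk_walk_height by (simp add: walk_height_def)
  show ?thesis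
  proof (intro equalityI subsetI)
    fix xs assume xs: "xs \<in> bridge_lists N"
    define s where "s = first_min xs"
    have sum: "(\<Sum>t\<leftarrow>xs. int (fstc t) - 1) = -1" using xs by (simp add: bridge_lists_def)
    note s = rotate_first_min[OF sum, folded s_def]
    have "proper t" if "t \<in> set (drop s xs @ take s xs)" for t
      using that xs by (auto simp: bridge_lists_def dest: in_set_dropD in_set_takeD)
    then obtain \<theta> where \<theta>: "code_list \<theta> = drop s xs @ take s xs"
      using luk_imp_code_list[OF s(2)] by blast
    have "length (code_list \<theta>) = length xs" using s(1) by (simp add: \<theta>)
    moreover have "rotate (length xs - s) (code_list \<theta>) = xs"
      using s(1) unfolding \<theta> by (metis append_take_drop_id length_drop rotate_append)
    moreover have "(\<Sum>t\<leftarrow>code_list \<theta>. Suc (forest_size (forest_of t))) = Suc N"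
    proof -
      have "(\<Sum>t\<leftarrow>code_list \<theta>. Suc (forest_size (forest_of t))) = (\<Sum>t\<leftarrow>xs. Suc (forest_size (forest_of t)))"
        using \<open>rotate (length xs - s) (code_list \<theta>) = xs\<close> sum_rot by metis
      then show ?thesis using inc[OF _ sum] xs by (simp add: bridge_lists_def)
    qed
    ultimately show "xs \<in> {rotate k (code_list \<theta>) | \<theta> k. vertices (merge_tree \<theta>) = Suc N \<and> k < length (code_list \<theta>)}"
      using s(1) unfolding vertices_attach_forests
      by (intro CollectI exI[of _ \<theta>] exI[of _ "length xs - s"]) auto
  next
    fix xs assume "xs \<in> {rotate k (code_list \<theta>) | \<theta> k. vertices (merge_tree \<theta>) = Suc N \<and> k < length (code_list \<theta>)}"
    then obtain \<theta> k where xs: "xs = rotate k (code_list \<theta>)" and v: "vertices (merge_tree \<theta>) = Suc N" by blast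
    have "sum_list (map increment (code_list \<theta>)) = N"
      using v inc[of "code_list \<theta>"] proper_code_list code_sum unfolding vertices_attach_forests by blast
    then show "xs \<in> bridge_lists N"
      by (simp add: bridge_lists_def xs sum_rot code_sum proper_code_list)
  qed
qed

text \<open>The first minimum reveals the offset, so the rotation can be undone. In particular a
  code word of length \<open>L\<close> has \<open>L\<close> distinct rotations.\<close>

lemma inj_on_rotate_code_list:
  "inj_on (\<lambda>(\<theta>, k). rotate k (code_list \<theta>)) {(\<theta>, k). k < length (code_list \<theta>)}"
proof (rule inj_onI, clarify)
  fix \<theta> k \<theta>' k' assume k: "k < length (code_list \<theta>)" "k' < length (code_list \<theta>')"
    and eq: "rotate k (code_list \<theta>) = rotate k' (code_list \<theta>')"
  have len: "length (code_list \<theta>) = length (code_list \<theta>')" using eq by (metis length_rotate)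
  have "length (code_list \<theta>) - k = length (code_list \<theta>') - k'"
    using first_min_rotate[OF luk_code_list k(1)] first_min_rotate[OF luk_code_list k(2)] eq by simp
  then have kk: "k = k'" using k len by simp
  then have "code_list \<theta> = code_list \<theta>'" using rotate_back[of k "code_list \<theta>"] rotate_back[of k "code_list \<theta>'"] k len eq
    by (metis less_imp_le)
  then show "\<theta> = \<theta>' \<and> k = k'" using kk by (simp add: code_list_inject)
qed

text \<open>Relabelling commutes with the depth-first code and with merging. Replacing each index by
  its forest turns the code of the sampled tree into that of \<open>\<theta>\<close>, and codes are
  injective.\<close>

lemma plane_tree_of_rotate:
  assumes k: "k < length (code_list \<theta>)"
  defines "xs \<equiv> rotate k (code_list \<theta>)"
  shows "attach_forests (\<lambda>i. forest_of (xs ! (i - 1))) (plane_tree_of xs) = merge_tree \<theta>"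
proof -
  let ?L = "length (code_list \<theta>)"
  have fm: "first_min xs = ?L - k" unfolding xs_def by (rule first_min_rotate[OF luk_code_list k])
  have len: "length xs = ?L" by (simp add: xs_def)
  have rot: "rotate (?L - k) xs = code_list \<theta>"
    unfolding xs_def using k by (intro rotate_back) simp
  define w where "w = map (\<lambda>i. (i, fstc (xs ! (i - 1)))) (rotate (first_min xs) [1..<Suc (length xs)])"
  have nth: "map (\<lambda>i. xs ! (i - 1)) [1..<Suc (length xs)] = xs"
    by (rule nth_equalityI) (auto simp: nth_upt simp del: upt_Suc)
  have w_code: "map (\<lambda>i. xs ! (i - 1)) (rotate (first_min xs) [1..<Suc (length xs)]) = code_list \<theta>"
    by (simp only: rotate_map[symmetric] nth fm rot)
  have "map snd w = map fstc (code_list \<theta>)"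
    unfolding w_def w_code[symmetric] by simp
  then have "luk 1 (map snd w)" using luk_code_list by simp
  then obtain ts where "length ts = 1" "concat (map dfs_outdegrees ts) = w" using luk_imp_dfs by blast
  then obtain \<tau> where \<tau>: "dfs_outdegrees \<tau> = w" by (cases ts) auto
  have pt: "plane_tree_of xs = \<tau>"
    unfolding plane_tree_of_def w_def[symmetric] \<tau>[symmetric] by (simp add: dfs_outdegrees_inject)
  have "dfs_outdegrees (map_plane_tree (\<lambda>i. forest_of (xs ! (i - 1))) \<tau>) =
      map (\<lambda>t. (forest_of t, fstc t)) (map (\<lambda>i. xs ! (i - 1)) (rotate (first_min xs) [1..<Suc (length xs)]))"
    by (simp add: dfs_outdegrees_map \<tau> w_def)
  also have "\<dots> = dfs_outdegrees \<theta>"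
    unfolding w_code by (simp add: code_list_def o_def case_prod_beta)
  finally have "map_plane_tree (\<lambda>i. forest_of (xs ! (i - 1))) \<tau> = \<theta>"
    by (simp add: dfs_outdegrees_inject)
  then show ?thesis
    using attach_forests_map[of "\<lambda>f. f" "\<lambda>i. forest_of (xs ! (i - 1))" \<tau>] by (simp add: pt o_def)
qed

lemma list_weight_append: "list_weight (xs @ ys) = list_weight xs * list_weight ys"
  by (simp add: list_weight_def)

lemma list_weight_code_list_Plane:
  "list_weight (code_list (Plane f ts)) = fixfree_weight f / fact (length ts) * (\<Prod>\<theta>\<leftarrow>ts. list_weight (code_list \<theta>))"
proof -
  have "list_weight (concat (map code_list ts)) = (\<Prod>\<theta>\<leftarrow>ts. list_weight (code_list \<theta>))"
    by (induction ts) (simp_all add: list_weight_append, simp add: list_weight_def)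
  then show ?thesis by (simp add: code_list_Plane list_weight_def)
qed

lemma list_weight_rotate: "list_weight (rotate k xs) = list_weight xs"
  unfolding list_weight_def prod_mset_prod_list[symmetric] mset_map mset_rotate ..

text \<open>A decorated tree over \<open>Join G\<close> consists of an ordered list
  \<open>Us\<close> of trees from \<open>G\<close> for the plane children, a decorated tree over
  each of them, and the rest of \<open>G\<close> as root forest. By induction the children
  contribute 1, and \<open>1 / fact (length Us)\<close>, grouped by the multiset of
  \<open>Us\<close>, is \<open>block_weight 1\<close>.\<close>

lemma sum_list_weight_attach:
  "finite {\<theta>. merge_tree \<theta> = T} \<and> (\<Sum>\<theta> | merge_tree \<theta> = T. list_weight (code_list \<theta>)) = 1"
proof (induction T)
  case (Join G)
  define w where "w \<theta> = list_weight (code_list \<theta>)" for \<theta>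
  define \<Theta> where "\<Theta> Us = {ts. map merge_tree ts = Us}" for Us
  have lists: "finite (\<Theta> Us) \<and> (\<Sum>ts\<in>\<Theta> Us. \<Prod>\<theta>\<leftarrow>ts. w \<theta>) = 1" if "\<forall>U\<in>set Us. U \<in># G" for Us
    using that
  proof (induction Us)
    case Nil
    have "\<Theta> [] = {[]}" by (auto simp: \<Theta>_def)
    then show ?case by simp
  next
    case (Cons U Us)
    have eq: "\<Theta> (U # Us) = (\<lambda>(\<theta>, ts). \<theta> # ts) ` ({\<theta>. merge_tree \<theta> = U} \<times> \<Theta> Us)"
      by (auto simp: \<Theta>_def image_iff map_eq_Cons_conv)
    have U: "finite {\<theta>. merge_tree \<theta> = U}" "(\<Sum>\<theta> | merge_tree \<theta> = U. w \<theta>) = 1"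
    proof -
      have "U \<in># G" using Cons.prems by simp
      from Join.IH[OF this] show "finite {\<theta>. merge_tree \<theta> = U}" "(\<Sum>\<theta> | merge_tree \<theta> = U. w \<theta>) = 1"
        unfolding w_def by blast+
    qed
    have "(\<Sum>ts\<in>\<Theta> (U # Us). \<Prod>\<theta>\<leftarrow>ts. w \<theta>) =
        (\<Sum>(\<theta>, ts)\<in>{\<theta>. merge_tree \<theta> = U} \<times> \<Theta> Us. w \<theta> * (\<Prod>\<theta>\<leftarrow>ts. w \<theta>))"
      unfolding eq by (subst sum.reindex) (auto simp: inj_on_def case_prod_beta)
    also have "\<dots> = (\<Sum>\<theta> | merge_tree \<theta> = U. w \<theta>) * (\<Sum>ts\<in>\<Theta> Us. \<Prod>\<theta>\<leftarrow>ts. w \<theta>)"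
      by (simp add: sum_product sum.cartesian_product)
    finally show ?case using U Cons by (simp add: eq)
  qed
  let ?A = "SIGMA Us:{Us. mset Us \<subseteq># G}. \<Theta> Us"
  have sub: "\<forall>U\<in>set Us. U \<in># G" if "mset Us \<subseteq># G" for Us
    using mset_subset_eqD[OF that] by simp
  have eq: "{\<theta>. merge_tree \<theta> = Join G} = (\<lambda>(Us, ts). Plane (G - mset Us) ts) ` ?A"
  proof (intro equalityI subsetI)
    fix \<theta> assume "\<theta> \<in> {\<theta>. merge_tree \<theta> = Join G}"
    then obtain f ts where \<theta>: "\<theta> = Plane f ts" "mset (map merge_tree ts) + f = G"
      by (cases \<theta>) auto
    then show "\<theta> \<in> (\<lambda>(Us, ts). Plane (G - mset Us) ts) ` ?A"
      by (intro image_eqI[of _ _ "(map merge_tree ts, ts)"]) (auto simp: \<Theta>_def)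
  qed (auto simp: \<Theta>_def)
  have inj: "inj_on (\<lambda>(Us, ts). Plane (G - mset Us) ts) ?A"
    by (auto simp: inj_on_def \<Theta>_def)
  have lists_eq: "{Us. mset Us \<subseteq># G} = (\<Union>H\<in>{H. H \<subseteq># G}. {Us. mset Us = H})" by auto
  have fin: "finite {Us. mset Us \<subseteq># G}"
    unfolding lists_eq using finite_submultisets[of G] finite_lists_mset by blast
  have finA: "finite ?A" using fin lists sub by (intro finite_SigmaI) auto
  have "(\<Sum>\<theta> | merge_tree \<theta> = Join G. w \<theta>) = (\<Sum>(Us, ts)\<in>?A. w (Plane (G - mset Us) ts))"
    unfolding eq by (subst sum.reindex[OF inj]) (simp add: case_prod_beta)
  also have "\<dots> = (\<Sum>Us | mset Us \<subseteq># G. \<Sum>ts\<in>\<Theta> Us. w (Plane (G - mset Us) ts))"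
    using fin lists sub by (subst sum.Sigma) auto
  also have "\<dots> = (\<Sum>Us | mset Us \<subseteq># G. 1 / fact (length Us) * fixfree_weight (G - mset Us))"
  proof (intro sum.cong refl)
    fix Us assume "Us \<in> {Us. mset Us \<subseteq># G}"
    then have Us: "\<forall>U\<in>set Us. U \<in># G" using sub by simp
    have "(\<Sum>ts\<in>\<Theta> Us. w (Plane (G - mset Us) ts)) =
       (\<Sum>ts\<in>\<Theta> Us. fixfree_weight (G - mset Us) / fact (length Us) * (\<Prod>\<theta>\<leftarrow>ts. w \<theta>))"
      by (intro sum.cong refl) (auto simp: w_def list_weight_code_list_Plane \<Theta>_def)
    also have "\<dots> = fixfree_weight (G - mset Us) / fact (length Us)"
      unfolding sum_distrib_left[symmetric] using lists[OF Us] by simp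
    finally show "(\<Sum>ts\<in>\<Theta> Us. w (Plane (G - mset Us) ts)) = 1 / fact (length Us) * fixfree_weight (G - mset Us)" by simp
  qed
  also have "\<dots> = (\<Sum>H | H \<subseteq># G. \<Sum>Us | mset Us = H. 1 / fact (length Us) * fixfree_weight (G - mset Us))"
    unfolding lists_eq using finite_submultisets[of G] finite_lists_mset
    by (intro sum.UNION_disjoint) auto
  also have "\<dots> = (\<Sum>H | H \<subseteq># G. block_weight 1 H * fixfree_weight (G - H))"
    by (intro sum.cong refl) (simp add: block_weight_def sum_distrib_right)
  also have "\<dots> = 1"
    using mset_conv_fixfree_weight[of G] by (simp add: mset_conv_def)
  finally have "(\<Sum>\<theta> | merge_tree \<theta> = Join G. w \<theta>) = 1" .
  then show ?case using finA by (simp add: eq w_def)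
qed

section \<open>Uniformity\<close>

lemma eq_spmf_of_setI:
  assumes "finite A" "lossless_spmf p" "\<And>x. x \<in> A \<Longrightarrow> spmf p x = c" "\<And>x. x \<notin> A \<Longrightarrow> spmf p x = 0"
  shows "p = spmf_of_set A"
proof -
  have "ennreal (weight_spmf p) = (\<integral>\<^sup>+ x. ennreal (spmf p x) \<partial>count_space UNIV)"
    by (rule weight_spmf_eq_nn_integral_spmf)
  also have "\<dots> = (\<Sum>x\<in>A. ennreal (spmf p x))"
    using assms by (intro nn_integral_count_space') auto
  also have "\<dots> = ennreal (\<Sum>x\<in>A. spmf p x)"
    by (intro sum_ennreal) auto
  finally have "weight_spmf p = (\<Sum>x\<in>A. spmf p x)"
    by (subst (asm) ennreal_inj) (auto simp: weight_spmf_nonneg intro!: sum_nonneg)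
  then have "real (card A) * c = 1"
    using assms(2,3) by (simp add: lossless_spmf_def)
  then have c: "c = 1 / real (card A)"
    by (cases "card A = 0") (auto simp: field_simps)
  show ?thesis
  proof (rule spmf_eqI)
    fix x
    show "spmf p x = spmf (spmf_of_set A) x"
      using assms(3,4)[of x] c by (cases "x \<in> A") (auto simp: spmf_of_set)
  qed
qed

theorem theorem7p1:
  fixes n :: nat and \<epsilon> :: real
  assumes "n \<ge> 2" and "\<epsilon> > 0"
  shows "polya_tree_sampler n \<epsilon> = spmf_of_set (polya_trees n)"
proof -
  define N where "N = n - 1"
  define lam where "lam = lambda N \<epsilon>"
  have N: "N \<ge> 1" "n = Suc N" using assms(1) by (auto simp: N_def)
  interpret tilt lam
  proof
    show "0 < lam"
      using assms(2) N \<rho>_pos \<rho>_less_1 by (simp add: lam_def lambda_def)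
    show "lam \<le> 1 / 4 * ln (1 / \<rho>)"
      unfolding lam_def lambda_def by (rule min.cobounded2)
  qed
  define p where "p = bridge_attempt N lam"
  define h where "h xs = attach_forests (\<lambda>i. forest_of (xs ! (i - 1))) (plane_tree_of xs)" for xs
  define c where "c = \<rho> ^ n / M_hat N lam"
  have c0: "c > 0" using \<rho>_pos M_hat_pos[OF N(1)] by (simp add: c_def)
  have p_in: "spmf p (Some xs) = c * (list_weight xs / real (length xs))" if "xs \<in> bridge_lists N" for xs
    using spmf_bridge_attempt[OF N(1) that] by (simp add: p_def c_def N(2))
  have p_out: "spmf p (Some xs) = 0" if "xs \<notin> bridge_lists N" for xs
    using set_bridge_attempt[of xs N] that by (auto simp: p_def spmf_eq_0_set_spmf)
  \<comment> \<open>A list of positive probability is needed to bound the rejection probability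
    below 1: the weights over any tree sum to 1, so some decorated tree has nonzero weight.\<close>
  obtain T where "T \<in> polya_trees n" using polya_trees_nonempty[of n] assms(1) by auto
  then have T: "vertices T = Suc N" by (simp add: polya_trees_def N(2))
  obtain \<theta> where \<theta>: "merge_tree \<theta> = T" "list_weight (code_list \<theta>) \<noteq> 0"
    using sum_list_weight_attach[of T] sum.not_neutral_contains_not_neutral[of "\<lambda>\<theta>. list_weight (code_list \<theta>)" "{\<theta>. merge_tree \<theta> = T}"]
    by force
  have nonneg: "list_weight xs \<ge> 0" for xs
    unfolding list_weight_def by (induction xs) (auto intro!: mult_nonneg_nonneg divide_nonneg_nonneg fixfree_weight_nonneg)
  have "code_list \<theta> \<in> bridge_lists N"
    unfolding bridge_lists_eq using \<theta>(1) T code_list_nonempty[of \<theta>]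
    by (intro CollectI exI[of _ \<theta>] exI[of _ 0]) auto
  then have "spmf p (Some (code_list \<theta>)) > 0"
    using \<theta>(2) nonneg[of "code_list \<theta>"] c0 code_list_nonempty[of \<theta>] by (simp add: p_in)
  moreover have "spmf p None + spmf p (Some (code_list \<theta>)) \<le> 1"
    using sum_spmf_le_weight[of "{None, Some (code_list \<theta>)}" p] weight_spmf_le_1[of p] by simp
  ultimately have q: "spmf p None < 1" by linarith
  note bridge = spmf_rejection_loop[OF bridge_sampler_loop lossless_bridge_attempt, of N, folded p_def, OF q]
  have sampler: "polya_tree_sampler n \<epsilon> = bind_spmf (bridge_sampler N lam) (\<lambda>xs. return_spmf (h xs))"
    unfolding polya_tree_sampler_def Let_def N_def[symmetric] lam_def[symmetric] h_def ..
  have h_code: "h (rotate k (code_list \<theta>)) = merge_tree \<theta>" if "k < length (code_list \<theta>)" for k \<theta>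
    unfolding h_def using plane_tree_of_rotate[OF that] .
  have inside: "spmf (polya_tree_sampler n \<epsilon>) T = c / (1 - spmf p None)" if "T \<in> polya_trees n" for T
  proof -
    have vT: "vertices T = Suc N" using that by (simp add: polya_trees_def N(2))
    define I where "I = (SIGMA \<theta>:{\<theta>. merge_tree \<theta> = T}. {..<length (code_list \<theta>)})"
    define A where "A = (\<lambda>(\<theta>, k). rotate k (code_list \<theta>)) ` I"
    have fin: "finite {\<theta>. merge_tree \<theta> = T}" and sum1: "(\<Sum>\<theta> | merge_tree \<theta> = T. list_weight (code_list \<theta>)) = 1"
      using sum_list_weight_attach[of T] by auto
    have inj: "inj_on (\<lambda>(\<theta>, k). rotate k (code_list \<theta>)) I"
      by (rule inj_on_subset[OF inj_on_rotate_code_list]) (auto simp: I_def)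
    have finA: "finite A" unfolding A_def I_def using fin by auto
    have A_lists: "A \<subseteq> bridge_lists N"
      unfolding bridge_lists_eq A_def I_def using vT by auto
    have hA: "h xs = T" if "xs \<in> A" for xs using that by (auto simp: A_def I_def h_code)
    have "spmf (polya_tree_sampler n \<epsilon>) T = (\<Sum>xs\<in>A. spmf (bridge_sampler N lam) xs * spmf (return_spmf (h xs)) T)"
      unfolding sampler
    proof (rule spmf_bind_sum[OF finA])
      fix xs assume xs: "xs \<notin> A"
      show "spmf (bridge_sampler N lam) xs * spmf (return_spmf (h xs)) T = 0"
      proof (cases "xs \<in> bridge_lists N")
        case True
        then obtain \<theta> k where "xs = rotate k (code_list \<theta>)" "k < length (code_list \<theta>)"
          unfolding bridge_lists_eq by blast
        then have "h xs \<noteq> T" using xs by (auto simp: h_code A_def I_def)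
        then show ?thesis by simp
      qed (simp add: bridge p_out)
    qed
    also have "\<dots> = (\<Sum>xs\<in>A. c / (1 - spmf p None) * (list_weight xs / real (length xs)))"
      using A_lists by (intro sum.cong refl) (auto simp: bridge p_in hA)
    also have "\<dots> = (\<Sum>(\<theta>, k)\<in>I. c / (1 - spmf p None) * (list_weight (code_list \<theta>) / real (length (code_list \<theta>))))"
      unfolding A_def by (subst sum.reindex[OF inj]) (simp add: case_prod_beta list_weight_rotate)
    also have "\<dots> = (\<Sum>\<theta> | merge_tree \<theta> = T. \<Sum>k<length (code_list \<theta>). c / (1 - spmf p None) * (list_weight (code_list \<theta>) / real (length (code_list \<theta>))))"
      unfolding I_def using fin by (subst sum.Sigma) auto
    \<comment> \<open>All rotations of one code word have the same weight, and their number cancels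
      the division by the length.\<close>
    also have "\<dots> = (\<Sum>\<theta> | merge_tree \<theta> = T. c / (1 - spmf p None) * list_weight (code_list \<theta>))"
      using code_list_nonempty by (intro sum.cong refl) simp
    also have "\<dots> = c / (1 - spmf p None)"
      unfolding sum_distrib_left[symmetric] sum1 by simp
    finally show ?thesis .
  qed
  have outside: "spmf (polya_tree_sampler n \<epsilon>) T = 0" if "T \<notin> polya_trees n" for T
  proof -
    have "spmf (bridge_sampler N lam) xs * spmf (return_spmf (h xs)) T = 0" for xs
    proof (cases "xs \<in> bridge_lists N")
      case True
      then obtain \<theta> k where "xs = rotate k (code_list \<theta>)" "k < length (code_list \<theta>)" "vertices (merge_tree \<theta>) = Suc N"
        unfolding bridge_lists_eq by blast
      then have "h xs \<noteq> T" using that by (auto simp: h_code polya_trees_def N(2))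
      then show ?thesis by simp
    qed (simp add: bridge p_out)
    then show ?thesis unfolding sampler by (subst spmf_bind_sum[of "{}"]) auto
  qed
  have "lossless_spmf (polya_tree_sampler n \<epsilon>)"
    unfolding sampler using bridge(2) by simp
  then show ?thesis
    using finite_polya_trees inside outside by (intro eq_spmf_of_setI) auto
qed

end
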